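(* Let $(R,\mathfrak m,k)$ be a commutative local Noetherian ring and let $M$ be an $R$-module. Then the graded $\operatorname{Ext}_R(k,k)$-$\operatorname{Ext}_R(M,M)$-bimodules $\operatorname{Ext}_R(M,k)$ and $\operatorname{Hom}_k(\operatorname{Tor}^R(M,k),k)$ are isomorphic.
   Context: Acyclic closure. $F$ denotes the acyclic closure of $k$ over $R$: the graded-commutative DG $R$-algebra $R\langle X\rangle$ with divided powers obtained from $R$ by Tate's process of successively adjoining, in each degree, a minimal set of exterior (odd degree) and divided power (even degree) variables killing homology, so that $F\to k$ is a quasi-isomorphism; it is a minimal free resolution of $k$. $G$ denotes a free resolution of $M$. $\Gamma$-derivations. $\operatorname{Der}^\gamma_R(F)\subseteq\operatorname{End}_R(F)$ is the subcomplex of $\Gamma$-derivations: $R$-linear homogeneous maps $\theta$ with $\theta(ab)=\theta(a)b+(-1)^{|\theta||a|}a\theta(b)$ and $\theta(x^{(n)})=\theta(x)x^{(n-1)}$ for $x$ of even positive degree. It is a DG Lie algebra with $[\theta,\xi]=\theta\xi-(-1)^{|\theta||\xi|}\xi\theta$ and $\zeta^{[2]}=\zeta^2$ for $\zeta$ odd. The graded Lie $k$-algebra $\pi(R)=\mathrm H(\operatorname{Der}^\gamma_R(F))$ has universal enveloping algebra $U\pi(R)\cong\operatorname{Ext}_R(k,k)$, so a left $\operatorname{Ext}_R(k,k)$-module is the same as a left Lie $\pi(R)$-module. Bimodule structures. The structure on $\operatorname{Ext}_R(M,k)=\mathrm H(\operatorname{Hom}_R(G,F))$ is induced in homology by composition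 on $\operatorname{Hom}_R(G,F)$: on the left with $\operatorname{Der}^\gamma_R(F)$ and on the right with $\operatorname{End}_R(G)$. On $\operatorname{Hom}_F(G\otimes_RF,F)$, for $\psi\in\operatorname{Hom}_F(G\otimes_RF,F)$, $\alpha\in\operatorname{End}_R(G)$ and $\theta\in\operatorname{Der}^\gamma_R(F)$, put $$(\psi\cdot\alpha)(g\otimes f)=\psi(\alpha(g)\otimes f),\qquad(\theta\cdot\psi)(g\otimes f)=\theta(\psi(g\otimes f))-(-1)^{|\theta|(|\psi|+|g|)}\psi(g\otimes\theta(f)).$$ The structure on $\operatorname{Hom}_k(\operatorname{Tor}^R(M,k),k)$ is the one induced in homology by these actions through the identification $\mathrm H(\operatorname{Hom}_F(G\otimes_RF,F))\cong\mathrm H(\operatorname{Hom}_F(G\otimes_RF,k))\cong\operatorname{Hom}_k(\operatorname{Tor}^R(M,k),k)$, in which the first isomorphism is induced by the augmentation $F\to k$. In both cases the left $\pi(R)$-action is extended to $\operatorname{Ext}_R(k,k)\cong U\pi(R)$. *)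

theory Defs
  imports
    Complex_Main
    "HOL-Library.Poly_Mapping"
    "HOL-Library.Function_Algebras"
    "HOL-Library.Set_Algebras"
begin

text \<open>
  The ring \<open>R\<close> is a type of class \<^class>\<open>comm_ring_1\<close>; a module over it is a type of class
  \<^class>\<open>ab_group_add\<close> with a scalar multiplication satisfying \<^locale>\<open>module\<close>. All gradings
  are homological and indexed by \<^typ>\<open>int\<close>, so that \<open>Ext\<close> in cohomological degree \<open>n\<close> is the
  component of degree \<open>-n\<close>.
\<close>

section \<open>Local Noetherian rings\<close>

definition is_local_ring :: "'r::comm_ring_1 itself \<Rightarrow> bool" where
  "is_local_ring _ \<longleftrightarrow>
     (\<forall>a b :: 'r. \<not> a dvd 1 \<longrightarrow> \<not> b dvd 1 \<longrightarrow> \<not> (a + b) dvd 1)"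

definition is_noetherian_ring :: "'r::comm_ring_1 itself \<Rightarrow> bool" where
  "is_noetherian_ring _ \<longleftrightarrow>
     (\<forall>I :: 'r set. module.subspace (*) I \<longrightarrow> (\<exists>S. finite S \<and> I = module.span (*) S))"

text \<open>
  A surjective homomorphism onto a field presents that field as a residue field; when the ring is
  local, its kernel is the maximal ideal.
\<close>

definition residue_map :: "('r::comm_ring_1 \<Rightarrow> 'k::field) \<Rightarrow> bool" where
  "residue_map \<epsilon> \<longleftrightarrow> \<epsilon> 1 = 1 \<and> (\<forall>a b. \<epsilon> (a + b) = \<epsilon> a + \<epsilon> b) \<and>
     (\<forall>a b. \<epsilon> (a * b) = \<epsilon> a * \<epsilon> b) \<and> surj \<epsilon>"


section \<open>Complexes, Hom complexes and homology\<close>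

text \<open>\<open>ksgn n x\<close> is \<open>(-1)\<^sup>n x\<close>.\<close>

definition ksgn :: "int \<Rightarrow> 'a::ab_group_add \<Rightarrow> 'a" where
  "ksgn n x = (if even n then x else - x)"

record ('r, 'a) dgmod =
  scl :: "'r \<Rightarrow> 'a \<Rightarrow> 'a"
  gr :: "int \<Rightarrow> 'a set"
  dif :: "'a \<Rightarrow> 'a"

definition graded_module :: "('r::comm_ring_1, 'a::ab_group_add, 'z) dgmod_scheme \<Rightarrow> bool" where
  "graded_module A \<longleftrightarrow> module (scl A) \<and> (\<forall>n. module.subspace (scl A) (gr A n)) \<and>
     (\<forall>x. \<exists>!c. (\<forall>n. c n \<in> gr A n) \<and> finite {n. c n \<noteq> 0} \<and> x = (\<Sum>n | c n \<noteq> 0. c n))"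

definition chain_complex :: "('r::comm_ring_1, 'a::ab_group_add, 'z) dgmod_scheme \<Rightarrow> bool" where
  "chain_complex A \<longleftrightarrow> graded_module A \<and> module_hom (scl A) (scl A) (dif A) \<and>
     (\<forall>n. dif A ` gr A n \<subseteq> gr A (n - 1)) \<and> (\<forall>x. dif A (dif A x) = 0)"

definition free_resolution ::
  "('r::comm_ring_1 \<Rightarrow> 'm::ab_group_add \<Rightarrow> 'm) \<Rightarrow> ('r, 'g::ab_group_add, 'z) dgmod_scheme \<Rightarrow>
   ('g \<Rightarrow> 'm) \<Rightarrow> bool" where
  "free_resolution sM G \<eta> \<longleftrightarrow> chain_complex G \<and>
     (\<forall>n<0. gr G n = {0}) \<and>
     (\<forall>n. \<exists>B. \<not> module.dependent (scl G) B \<and> module.span (scl G) B = gr G n) \<and>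
     module_hom (scl G) sM \<eta> \<and> (\<forall>n. n \<noteq> 0 \<longrightarrow> \<eta> ` gr G n \<subseteq> {0}) \<and>
     \<eta> ` gr G 0 = UNIV \<and> {x \<in> gr G 0. \<eta> x = 0} = dif G ` gr G 1 \<and>
     (\<forall>n\<ge>1. {x \<in> gr G n. dif G x = 0} = dif G ` gr G (n + 1))"

definition hom_gr ::
  "('r::comm_ring_1, 'a::ab_group_add, 'y) dgmod_scheme \<Rightarrow>
   ('r, 'b::ab_group_add, 'z) dgmod_scheme \<Rightarrow> int \<Rightarrow> ('a \<Rightarrow> 'b) set" where
  "hom_gr A B d = {f. module_hom (scl A) (scl B) f \<and> (\<forall>n. f ` gr A n \<subseteq> gr B (n + d))}"

definition hom_dif ::
  "('r, 'a, 'y) dgmod_scheme \<Rightarrow> ('r, 'b::ab_group_add, 'z) dgmod_scheme \<Rightarrow>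
   int \<Rightarrow> ('a \<Rightarrow> 'b) \<Rightarrow> ('a \<Rightarrow> 'b)" where
  "hom_dif A B d f = (\<lambda>x. dif B (f x) - ksgn d (f (dif A x)))"

text \<open>
  The homology of a graded abelian group \<open>C\<close> with differentials \<open>\<delta> d : C d \<rightarrow> C (d - 1)\<close>
  consists of the cosets of the boundaries.
\<close>

definition bnd :: "(int \<Rightarrow> 'a set) \<Rightarrow> (int \<Rightarrow> 'a \<Rightarrow> 'a) \<Rightarrow> int \<Rightarrow> 'a set" where
  "bnd C \<delta> d = \<delta> (d + 1) ` C (d + 1)"

definition homology ::
  "(int \<Rightarrow> 'a::ab_group_add set) \<Rightarrow> (int \<Rightarrow> 'a \<Rightarrow> 'a) \<Rightarrow> int \<Rightarrow> 'a set set" where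
  "homology C \<delta> d = {z +o bnd C \<delta> d | z. z \<in> C d \<and> \<delta> d z = 0}"

text \<open>
  The operation that an operation on representatives induces on cosets: the union below is a
  single coset of \<open>B\<close> whenever the operation is compatible with the cosets.
\<close>

definition induced2 ::
  "'c::ab_group_add set \<Rightarrow> ('a \<Rightarrow> 'b \<Rightarrow> 'c) \<Rightarrow> 'a set \<Rightarrow> 'b set \<Rightarrow> 'c set" where
  "induced2 B f X Y = (\<Union>x\<in>X. \<Union>y\<in>Y. f x y +o B)"

record ('k, 'x) gvec =
  carr :: "int \<Rightarrow> 'x set"
  zer :: "int \<Rightarrow> 'x"
  pls :: "int \<Rightarrow> 'x \<Rightarrow> 'x \<Rightarrow> 'x"
  smul :: "int \<Rightarrow> 'k \<Rightarrow> 'x \<Rightarrow> 'x"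

text \<open>
  Homology as a graded \<open>k\<close>-vector space, for complexes whose homology is annihilated by the
  kernel of \<open>\<epsilon>\<close>: a scalar acts through its preimages in \<open>R\<close>.
\<close>

definition hvec ::
  "('r \<Rightarrow> 'k) \<Rightarrow> ('r \<Rightarrow> 'a \<Rightarrow> 'a) \<Rightarrow> (int \<Rightarrow> 'a::ab_group_add set) \<Rightarrow> (int \<Rightarrow> 'a \<Rightarrow> 'a) \<Rightarrow>
   ('k, 'a set) gvec" where
  "hvec \<epsilon> s C \<delta> = \<lparr>carr = homology C \<delta>, zer = bnd C \<delta>,
     pls = (\<lambda>d. induced2 (bnd C \<delta> d) (+)),
     smul = (\<lambda>d c. induced2 (bnd C \<delta> d) s (\<epsilon> -` {c}))\<rparr>"

text \<open>The graded dual; the component of degree \<open>d\<close> consists of the functionals on degree \<open>-d\<close>.\<close>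

definition gdual :: "('k::field, 'x) gvec \<Rightarrow> ('k, 'x \<Rightarrow> 'k) gvec" where
  "gdual V = \<lparr>
     carr = (\<lambda>d. {l. (\<forall>X. X \<notin> carr V (- d) \<longrightarrow> l X = 0) \<and>
       (\<forall>X\<in>carr V (- d). \<forall>Y\<in>carr V (- d). l (pls V (- d) X Y) = l X + l Y) \<and>
       (\<forall>c. \<forall>X\<in>carr V (- d). l (smul V (- d) c X) = c * l X)}),
     zer = (\<lambda>d. 0), pls = (\<lambda>d. (+)), smul = (\<lambda>d c l X. c * l X)\<rparr>"


section \<open>Acyclic closures\<close>

record ('r, 'f) gamma_alg = "('r, 'f) dgmod" +
  dp :: "nat \<Rightarrow> 'f \<Rightarrow> 'f"
  vars :: "int \<Rightarrow> 'f set"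

definition dg_algebra :: "('r::comm_ring_1, 'f::ring_1, 'z) dgmod_scheme \<Rightarrow> bool" where
  "dg_algebra F \<longleftrightarrow> chain_complex F \<and> (\<forall>n<0. gr F n = {0}) \<and>
     (\<forall>r x y. scl F r (x * y) = scl F r x * y \<and> scl F r (x * y) = x * scl F r y) \<and>
     1 \<in> gr F 0 \<and> (\<forall>i j. \<forall>x\<in>gr F i. \<forall>y\<in>gr F j. x * y \<in> gr F (i + j)) \<and>
     (\<forall>i j. \<forall>x\<in>gr F i. \<forall>y\<in>gr F j. x * y = ksgn (i * j) (y * x)) \<and>
     (\<forall>i. odd i \<longrightarrow> (\<forall>x\<in>gr F i. x * x = 0)) \<and>
     (\<forall>i. \<forall>x\<in>gr F i. \<forall>y. dif F (x * y) = dif F x * y + ksgn i (x * dif F y))"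

text \<open>
  The axioms for a system of divided powers \<open>x\<^sup>(\<^sup>n\<^sup>)\<close>, defined for \<open>x\<close> homogeneous of
  even positive degree, and their compatibility with the differential.
\<close>

definition divided_powers :: "('r::comm_ring_1, 'f::ring_1, 'z) gamma_alg_scheme \<Rightarrow> bool" where
  "divided_powers F \<longleftrightarrow>
     (\<forall>i>0. even i \<longrightarrow> (\<forall>x\<in>gr F i.
        dp F 0 x = 1 \<and> dp F 1 x = x \<and>
        (\<forall>n. dp F n x \<in> gr F (int n * i)) \<and>
        (\<forall>m n. dp F m x * dp F n x = of_nat ((m + n) choose m) * dp F (m + n) x) \<and>
        (\<forall>y\<in>gr F i. \<forall>n. dp F n (x + y) = (\<Sum>l\<le>n. dp F l x * dp F (n - l) y)) \<and>
        (\<forall>m n. n \<ge> 1 \<longrightarrow>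
           dp F m (dp F n x) = of_nat (fact (n * m) div (fact m * fact n ^ m)) * dp F (n * m) x) \<and>
        (\<forall>j\<ge>0. even j \<longrightarrow> (\<forall>y\<in>gr F j. \<forall>n\<ge>2. dp F n (y * x) = y ^ n * dp F n x)) \<and>
        (\<forall>n\<ge>1. dif F (dp F n x) = dif F x * dp F (n - 1) x))) \<and>
     (\<forall>i>0. \<forall>j>0. odd i \<longrightarrow> odd j \<longrightarrow>
        (\<forall>x\<in>gr F i. \<forall>y\<in>gr F j. \<forall>n\<ge>2. dp F n (x * y) = 0))"

text \<open>
  Exponents of the normal monomials in the variables of degree at most \<open>n\<close>. By graded
  commutativity the order in which the factors of a monomial are multiplied only affects its sign.
\<close>

definition exponents :: "('r, 'f, 'z) gamma_alg_scheme \<Rightarrow> int set \<Rightarrow> ('f \<Rightarrow> nat) set" where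
  "exponents F D = {a. finite {x. a x \<noteq> 0} \<and> {x. a x \<noteq> 0} \<subseteq> (\<Union>n\<in>D. vars F n) \<and>
     (\<forall>n. odd n \<longrightarrow> (\<forall>x\<in>vars F n. a x \<le> 1))}"

definition monomial :: "('r, 'f::ring_1, 'z) gamma_alg_scheme \<Rightarrow> ('f \<Rightarrow> nat) \<Rightarrow> 'f" where
  "monomial F a = prod_list (map (\<lambda>x. if a x = 1 then x else dp F (a x) x)
     (SOME xs. distinct xs \<and> set xs = {x. a x \<noteq> 0}))"

text \<open>The subalgebra \<open>R\<langle>X\<^sub>i : i \<le> n\<rangle>\<close>.\<close>

definition stage :: "('r::comm_ring_1, 'f::ring_1, 'z) gamma_alg_scheme \<Rightarrow> int \<Rightarrow> 'f set" where
  "stage F n = module.span (scl F) (monomial F ` exponents F {..n})"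

text \<open>
  The cycles of degree \<open>n\<close> to be killed by the variables of degree \<open>n + 1\<close>: in degree \<open>0\<close> the
  maximal ideal (the homology of \<open>R \<rightarrow> k\<close>), and all cycles of the \<open>n\<close>-th stage for \<open>n \<ge> 1\<close>.
\<close>

definition tate_cycles ::
  "('r::comm_ring_1 \<Rightarrow> 'k::field) \<Rightarrow> ('r, 'f::ring_1, 'z) gamma_alg_scheme \<Rightarrow> int \<Rightarrow> 'f set" where
  "tate_cycles \<epsilon> F n =
     (if n = 0 then {scl F r 1 | r. \<epsilon> r = 0}
      else {z \<in> gr F n \<inter> stage F n. dif F z = 0})"

text \<open>The classes of the \<open>\<partial>x\<close>, for \<open>x \<in> Y\<close>, generate the homology to be killed.\<close>

definition tate_generates ::
  "('r::comm_ring_1 \<Rightarrow> 'k::field) \<Rightarrow> ('r, 'f::ring_1, 'z) gamma_alg_scheme \<Rightarrow> int \<Rightarrow>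
   'f set \<Rightarrow> bool" where
  "tate_generates \<epsilon> F n Y \<longleftrightarrow>
     module.span (scl F) (dif F ` Y \<union> dif F ` (gr F (n + 1) \<inter> stage F n)) = tate_cycles \<epsilon> F n"

definition acyclic_closure ::
  "('r::comm_ring_1 \<Rightarrow> 'k::field) \<Rightarrow> ('r, 'f::ring_1, 'z) gamma_alg_scheme \<Rightarrow> bool" where
  "acyclic_closure \<epsilon> F \<longleftrightarrow> dg_algebra F \<and> divided_powers F \<and>
     (\<forall>n. vars F n \<subseteq> gr F n) \<and> (\<forall>n\<le>0. vars F n = {}) \<and>
     inj_on (monomial F) (exponents F UNIV) \<and>
     \<not> module.dependent (scl F) (monomial F ` exponents F UNIV) \<and>
     module.span (scl F) (monomial F ` exponents F UNIV) = UNIV \<and>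
     (\<forall>n\<ge>0. tate_generates \<epsilon> F n (vars F (n + 1)) \<and>
        (\<forall>Y. Y \<subset> vars F (n + 1) \<longrightarrow> \<not> tate_generates \<epsilon> F n Y))"

definition augmentation ::
  "('r::comm_ring_1 \<Rightarrow> 'k::field) \<Rightarrow> ('r, 'f::ring_1, 'z) dgmod_scheme \<Rightarrow> 'f \<Rightarrow> 'k" where
  "augmentation \<epsilon> F = (THE h. additive h \<and> (\<forall>r. h (scl F r 1) = \<epsilon> r) \<and>
     (\<forall>n. n \<noteq> 0 \<longrightarrow> (\<forall>x\<in>gr F n. h x = 0)))"

definition residue_cplx :: "('r \<Rightarrow> 'k::field) \<Rightarrow> ('r, 'k) dgmod" where
  "residue_cplx \<epsilon> = \<lparr>scl = (\<lambda>r c. \<epsilon> r * c), gr = (\<lambda>n. if n = 0 then UNIV else {0}),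
     dif = (\<lambda>_. 0)\<rparr>"


section \<open>Gamma-derivations and the homotopy Lie algebra\<close>

definition der :: "('r::comm_ring_1, 'f::ring_1, 'z) gamma_alg_scheme \<Rightarrow> int \<Rightarrow> ('f \<Rightarrow> 'f) set" where
  "der F d = {\<theta> \<in> hom_gr F F d.
     (\<forall>i. \<forall>a\<in>gr F i. \<forall>b. \<theta> (a * b) = \<theta> a * b + ksgn (d * i) (a * \<theta> b)) \<and>
     (\<forall>i>0. even i \<longrightarrow> (\<forall>x\<in>gr F i. \<forall>n\<ge>1. \<theta> (dp F n x) = \<theta> x * dp F (n - 1) x))}"

definition homotopy_lie ::
  "('r::comm_ring_1, 'f::ring_1, 'z) gamma_alg_scheme \<Rightarrow> int \<Rightarrow> ('f \<Rightarrow> 'f) set set" where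
  "homotopy_lie F = homology (der F) (hom_dif F F)"

text \<open>
  An element of degree \<open>p\<close> of the tensor algebra of \<open>\<pi>(R)\<close> over \<open>k\<close>, of which \<open>U\<pi>(R)\<close> is a
  quotient, is represented by a list of words with coefficients; the letters of a word are
  homogeneous and recorded with their degrees.
\<close>

type_synonym ('k, 'p) tens_elt = "('k \<times> (int \<times> 'p) list) list"

definition tens_alg :: "(int \<Rightarrow> 'p set) \<Rightarrow> int \<Rightarrow> ('k, 'p) tens_elt set" where
  "tens_alg P p = {t. \<forall>(c, w)\<in>set t. sum_list (map fst w) = p \<and> (\<forall>(i, \<xi>)\<in>set w. \<xi> \<in> P i)}"

text \<open>\<open>act p d \<xi> x\<close> is the action of \<open>\<xi>\<close>, of degree \<open>p\<close>, on \<open>x\<close>, of degree \<open>d\<close>.\<close>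

primrec word_act ::
  "(int \<Rightarrow> int \<Rightarrow> 'p \<Rightarrow> 'x \<Rightarrow> 'x) \<Rightarrow> int \<Rightarrow> (int \<times> 'p) list \<Rightarrow> 'x \<Rightarrow> 'x" where
  "word_act act d [] x = x"
| "word_act act d (l # w) x =
     act (fst l) (d + sum_list (map fst w)) (snd l) (word_act act d w x)"

definition tens_act ::
  "('k, 'x, 'z) gvec_scheme \<Rightarrow> (int \<Rightarrow> int \<Rightarrow> 'p \<Rightarrow> 'x \<Rightarrow> 'x) \<Rightarrow> int \<Rightarrow> int \<Rightarrow>
   ('k, 'p) tens_elt \<Rightarrow> 'x \<Rightarrow> 'x" where
  "tens_act N act p d t x =
     foldr (\<lambda>(c, w) y. pls N (p + d) (smul N (p + d) c (word_act act d w x)) y) t (zer N (p + d))"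


section \<open>Ext algebras and the bimodule Ext(M, k)\<close>

text \<open>\<open>Ext(M, k)\<close> is \<open>H(Hom(G, F))\<close>; for \<open>G = F\<close> this is \<open>Ext(k, k)\<close>.\<close>

definition ext_gvec ::
  "('r::comm_ring_1 \<Rightarrow> 'k::field) \<Rightarrow> ('r, 'g::ab_group_add, 'y) dgmod_scheme \<Rightarrow>
   ('r, 'f::ab_group_add, 'z) dgmod_scheme \<Rightarrow> ('k, ('g \<Rightarrow> 'f) set) gvec" where
  "ext_gvec \<epsilon> G F = hvec \<epsilon> (\<lambda>r f x. scl F r (f x)) (hom_gr G F) (hom_dif G F)"

definition ext_self ::
  "('r::comm_ring_1, 'g::ab_group_add, 'y) dgmod_scheme \<Rightarrow> int \<Rightarrow> ('g \<Rightarrow> 'g) set set" where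
  "ext_self G = homology (hom_gr G G) (hom_dif G G)"

definition ext_lie_act ::
  "('r::comm_ring_1, 'g::ab_group_add, 'y) dgmod_scheme \<Rightarrow>
   ('r, 'f::ab_group_add, 'z) dgmod_scheme \<Rightarrow> int \<Rightarrow> int \<Rightarrow> ('f \<Rightarrow> 'f) set \<Rightarrow>
   ('g \<Rightarrow> 'f) set \<Rightarrow> ('g \<Rightarrow> 'f) set" where
  "ext_lie_act G F p d = induced2 (bnd (hom_gr G F) (hom_dif G F) (p + d)) (\<lambda>\<theta> \<beta>. \<theta> \<circ> \<beta>)"

text \<open>
  The canonical map \<open>U\<pi>(R) \<rightarrow> Ext(k, k)\<close>, on representatives in the tensor algebra: a word is sent
  to the class of the composite of its letters.
\<close>

definition env_to_ext ::
  "('r::comm_ring_1 \<Rightarrow> 'k::field) \<Rightarrow> ('r, 'f::ring_1, 'z) gamma_alg_scheme \<Rightarrow> int \<Rightarrow>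
   ('k, ('f \<Rightarrow> 'f) set) tens_elt \<Rightarrow> ('f \<Rightarrow> 'f) set" where
  "env_to_ext \<epsilon> F p t = tens_act (ext_gvec \<epsilon> F F) (ext_lie_act F F) p 0 t
     (id +o bnd (hom_gr F F) (hom_dif F F) 0)"

text \<open>
  The extension of a Lie action of \<open>\<pi>(R)\<close> on \<open>N\<close> to \<open>Ext(k, k) \<cong> U\<pi>(R)\<close>: an element of
  \<open>Ext(k, k)\<close> acts through any preimage in \<open>U\<pi>(R)\<close>. As the canonical map is an isomorphism, the
  result does not depend on the choice and the last branch concerns no element of \<open>Ext(k, k)\<close>.
\<close>

definition extend_act ::
  "('r::comm_ring_1 \<Rightarrow> 'k::field) \<Rightarrow> ('r, 'f::ring_1, 'z) gamma_alg_scheme \<Rightarrow>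
   ('k, 'x, 'y) gvec_scheme \<Rightarrow> (int \<Rightarrow> int \<Rightarrow> ('f \<Rightarrow> 'f) set \<Rightarrow> 'x \<Rightarrow> 'x) \<Rightarrow>
   int \<Rightarrow> int \<Rightarrow> ('f \<Rightarrow> 'f) set \<Rightarrow> 'x \<Rightarrow> 'x" where
  "extend_act \<epsilon> F N act p d e x =
     (let T = tens_alg (homotopy_lie F) p in
      if e \<in> env_to_ext \<epsilon> F p ` T
      then tens_act N act p d (inv_into T (env_to_ext \<epsilon> F p) e) x
      else zer N (p + d))"

record ('k, 'e, 'a, 'x) gbimod = "('k, 'x) gvec" +
  lact :: "int \<Rightarrow> int \<Rightarrow> 'e \<Rightarrow> 'x \<Rightarrow> 'x"
  ract :: "int \<Rightarrow> int \<Rightarrow> 'x \<Rightarrow> 'a \<Rightarrow> 'x"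

definition gbimod_isomorphic ::
  "(int \<Rightarrow> 'e set) \<Rightarrow> (int \<Rightarrow> 'a set) \<Rightarrow> ('k, 'e, 'a, 'x) gbimod \<Rightarrow>
   ('k, 'e, 'a, 'y) gbimod \<Rightarrow> bool" where
  "gbimod_isomorphic E A N N' \<longleftrightarrow> (\<exists>\<phi>. \<forall>d.
     bij_betw (\<phi> d) (carr N d) (carr N' d) \<and>
     (\<forall>x\<in>carr N d. \<forall>y\<in>carr N d. \<phi> d (pls N d x y) = pls N' d (\<phi> d x) (\<phi> d y)) \<and>
     (\<forall>c. \<forall>x\<in>carr N d. \<phi> d (smul N d c x) = smul N' d c (\<phi> d x)) \<and>
     (\<forall>p. \<forall>e\<in>E p. \<forall>x\<in>carr N d. \<phi> (p + d) (lact N p d e x) = lact N' p d e (\<phi> d x)) \<and>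
     (\<forall>q. \<forall>a\<in>A q. \<forall>x\<in>carr N d. \<phi> (d + q) (ract N d q x a) = ract N' d q (\<phi> d x) a))"

definition ext_bimod ::
  "('r::comm_ring_1 \<Rightarrow> 'k::field) \<Rightarrow> ('r, 'g::ab_group_add, 'y) dgmod_scheme \<Rightarrow>
   ('r, 'f::ring_1, 'z) gamma_alg_scheme \<Rightarrow>
   ('k, ('f \<Rightarrow> 'f) set, ('g \<Rightarrow> 'g) set, ('g \<Rightarrow> 'f) set) gbimod" where
  "ext_bimod \<epsilon> G F = gvec.extend (ext_gvec \<epsilon> G F)
     \<lparr>lact = extend_act \<epsilon> F (ext_gvec \<epsilon> G F) (ext_lie_act G F),
      ract = (\<lambda>d q. induced2 (bnd (hom_gr G F) (hom_dif G F) (d + q)) (\<lambda>\<beta> \<alpha>. \<beta> \<circ> \<alpha>))\<rparr>"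


section \<open>The complex G (x) F and the bimodule Hom(Tor(M, k), k)\<close>

text \<open>
  A module together with a map \<open>\<otimes>\<close> is a tensor product if the linear map from the free module
  on the pairs to it that is determined by \<open>\<otimes>\<close> is surjective and its kernel is generated by the
  bilinearity relations.
\<close>

definition bilin_relations ::
  "('r::comm_ring_1 \<Rightarrow> 'a::ab_group_add \<Rightarrow> 'a) \<Rightarrow> ('r \<Rightarrow> 'b::ab_group_add \<Rightarrow> 'b) \<Rightarrow>
   ('a \<times> 'b \<Rightarrow>\<^sub>0 'r) set" where
  "bilin_relations s s' =
     {Poly_Mapping.single (a + a', b) 1 - Poly_Mapping.single (a, b) 1
        - Poly_Mapping.single (a', b) 1 | a a' b. True} \<union>
     {Poly_Mapping.single (a, b + b') 1 - Poly_Mapping.single (a, b) 1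
        - Poly_Mapping.single (a, b') 1 | a b b'. True} \<union>
     {Poly_Mapping.single (s r a, b) 1 - Poly_Mapping.single (a, b) r | r a b. True} \<union>
     {Poly_Mapping.single (a, s' r b) 1 - Poly_Mapping.single (a, b) r | r a b. True}"

definition free_lift ::
  "('r::comm_ring_1 \<Rightarrow> 't::ab_group_add \<Rightarrow> 't) \<Rightarrow> ('p \<Rightarrow> 't) \<Rightarrow> ('p \<Rightarrow>\<^sub>0 'r) \<Rightarrow> 't" where
  "free_lift sT h u = (\<Sum>p\<in>Poly_Mapping.keys u. sT (Poly_Mapping.lookup u p) (h p))"

definition is_tensor_product ::
  "('r::comm_ring_1 \<Rightarrow> 'a::ab_group_add \<Rightarrow> 'a) \<Rightarrow> ('r \<Rightarrow> 'b::ab_group_add \<Rightarrow> 'b) \<Rightarrow>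
   ('r \<Rightarrow> 't::ab_group_add \<Rightarrow> 't) \<Rightarrow> ('a \<Rightarrow> 'b \<Rightarrow> 't) \<Rightarrow> bool" where
  "is_tensor_product s s' sT tens \<longleftrightarrow> module sT \<and>
     surj (free_lift sT (case_prod tens)) \<and>
     {u. free_lift sT (case_prod tens) u = 0} =
       module.span (\<lambda>r. Poly_Mapping.map ((*) r)) (bilin_relations s s')"

definition tens_cplx ::
  "('r::comm_ring_1, 'g::ab_group_add, 'y) dgmod_scheme \<Rightarrow>
   ('r, 'f::ab_group_add, 'z) dgmod_scheme \<Rightarrow> ('r \<Rightarrow> 't::ab_group_add \<Rightarrow> 't) \<Rightarrow>
   ('g \<Rightarrow> 'f \<Rightarrow> 't) \<Rightarrow> ('r, 't) dgmod" where
  "tens_cplx G F sT tens = \<lparr>scl = sT,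
     gr = (\<lambda>n. module.span sT {tens g f | g f i j. g \<in> gr G i \<and> f \<in> gr F j \<and> i + j = n}),
     dif = (THE D. additive D \<and> (\<forall>i. \<forall>g\<in>gr G i. \<forall>f.
       D (tens g f) = tens (dif G g) f + ksgn i (tens g (dif F f))))\<rparr>"

text \<open>The right action of \<open>F\<close>, given by \<open>(g \<otimes> f') f = g \<otimes> f'f\<close>.\<close>

definition tens_rmult :: "('g \<Rightarrow> 'f \<Rightarrow> 't) \<Rightarrow> 't::ab_group_add \<Rightarrow> 'f::ring_1 \<Rightarrow> 't" where
  "tens_rmult tens t f =
     (THE h. additive h \<and> (\<forall>g f'. h (tens g f') = tens g (f' * f))) t"

text \<open>
  Hom over \<open>F\<close> from \<open>G \<otimes> F\<close> into a complex of right \<open>F\<close>-modules, with \<open>bact\<close> the action on the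
  target. For right modules linearity involves no sign.
\<close>

definition homF_gr ::
  "('r, 't::ab_group_add, 'y) dgmod_scheme \<Rightarrow> ('t \<Rightarrow> 'f \<Rightarrow> 't) \<Rightarrow>
   ('r, 'b::ab_group_add, 'z) dgmod_scheme \<Rightarrow> ('b \<Rightarrow> 'f \<Rightarrow> 'b) \<Rightarrow> int \<Rightarrow> ('t \<Rightarrow> 'b) set" where
  "homF_gr T tact B bact d = {\<psi>. additive \<psi> \<and> (\<forall>t f. \<psi> (tact t f) = bact (\<psi> t) f) \<and>
     (\<forall>n. \<psi> ` gr T n \<subseteq> gr B (n + d))}"

definition homFF ::
  "('r::comm_ring_1, 'f::ring_1, 'z) dgmod_scheme \<Rightarrow> ('r, 't::ab_group_add) dgmod \<Rightarrow>
   ('g \<Rightarrow> 'f \<Rightarrow> 't) \<Rightarrow> int \<Rightarrow> ('t \<Rightarrow> 'f) set" where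
  "homFF F T tens = homF_gr T (tens_rmult tens) F (*)"

definition homFk ::
  "('r::comm_ring_1 \<Rightarrow> 'k::field) \<Rightarrow> ('r, 'f::ring_1, 'z) dgmod_scheme \<Rightarrow>
   ('r, 't::ab_group_add) dgmod \<Rightarrow> ('g \<Rightarrow> 'f \<Rightarrow> 't) \<Rightarrow> int \<Rightarrow> ('t \<Rightarrow> 'k) set" where
  "homFk \<epsilon> F T tens =
     homF_gr T (tens_rmult tens) (residue_cplx \<epsilon>) (\<lambda>c f. c * augmentation \<epsilon> F f)"

text \<open>\<open>Tor(M, k)\<close> is the homology of \<open>T = G \<otimes> F\<close>.\<close>

definition tor_gvec ::
  "('r \<Rightarrow> 'k) \<Rightarrow> ('r, 't::ab_group_add) dgmod \<Rightarrow> ('k, 't set) gvec" where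
  "tor_gvec \<epsilon> T = hvec \<epsilon> (scl T) (gr T) (\<lambda>_. dif T)"

text \<open>
  The identification of \<open>H(Hom\<^sub>F(G \<otimes> F, F))\<close> with \<open>Hom(Tor(M, k), k)\<close>: composition with
  the augmentation \<open>F \<rightarrow> k\<close>, followed by evaluation of cocycles on cycles.
\<close>

definition ident_aug ::
  "('r::comm_ring_1 \<Rightarrow> 'k::field) \<Rightarrow> ('r, 'f::ring_1, 'z) dgmod_scheme \<Rightarrow>
   ('r, 't::ab_group_add) dgmod \<Rightarrow> ('g \<Rightarrow> 'f \<Rightarrow> 't) \<Rightarrow> int \<Rightarrow> ('t \<Rightarrow> 'f) set \<Rightarrow>
   ('t \<Rightarrow> 'k) set" where
  "ident_aug \<epsilon> F T tens d P = (\<Union>\<psi>\<in>P. (augmentation \<epsilon> F \<circ> \<psi>) +o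
     bnd (homFk \<epsilon> F T tens) (hom_dif T (residue_cplx \<epsilon>)) d)"

definition ident_eval ::
  "('r \<Rightarrow> 'k::field) \<Rightarrow> ('r, 't::ab_group_add) dgmod \<Rightarrow> int \<Rightarrow> ('t \<Rightarrow> 'k) set \<Rightarrow>
   't set \<Rightarrow> 'k" where
  "ident_eval \<epsilon> T d Q =
     (\<lambda>X. if X \<in> carr (tor_gvec \<epsilon> T) (- d) then the_elem (\<Union>\<chi>\<in>Q. \<chi> ` X) else 0)"

definition ident ::
  "('r::comm_ring_1 \<Rightarrow> 'k::field) \<Rightarrow> ('r, 'f::ring_1, 'z) dgmod_scheme \<Rightarrow>
   ('r, 't::ab_group_add) dgmod \<Rightarrow> ('g \<Rightarrow> 'f \<Rightarrow> 't) \<Rightarrow> int \<Rightarrow> ('t \<Rightarrow> 'f) set \<Rightarrow>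
   't set \<Rightarrow> 'k" where
  "ident \<epsilon> F T tens d P = ident_eval \<epsilon> T d (ident_aug \<epsilon> F T tens d P)"

definition ident_inv ::
  "('r::comm_ring_1 \<Rightarrow> 'k::field) \<Rightarrow> ('r, 'f::ring_1, 'z) dgmod_scheme \<Rightarrow>
   ('r, 't::ab_group_add) dgmod \<Rightarrow> ('g \<Rightarrow> 'f \<Rightarrow> 't) \<Rightarrow> int \<Rightarrow> ('t set \<Rightarrow> 'k) \<Rightarrow>
   ('t \<Rightarrow> 'f) set" where
  "ident_inv \<epsilon> F T tens d =
     inv_into (homology (homFF F T tens) (hom_dif T F) d) (ident \<epsilon> F T tens d)"

text \<open>
  \<open>(\<theta> \<cdot> \<psi>)(g \<otimes> f) = \<theta>(\<psi>(g \<otimes> f)) - (-1)\<^sup>|\<^sup>\<theta>\<^sup>|\<^sup>(\<^sup>|\<^sup>\<psi>\<^sup>|\<^sup>+\<^sup>|\<^sup>g\<^sup>|\<^sup>) \<psi>(g \<otimes> \<theta>(f))\<close> and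
  \<open>(\<psi> \<cdot> \<alpha>)(g \<otimes> f) = \<psi>(\<alpha>(g) \<otimes> f)\<close>, with \<open>p\<close> and \<open>d\<close> the degrees of \<open>\<theta>\<close> and \<open>\<psi>\<close>.
\<close>

definition der_act ::
  "('r, 'g, 'y) dgmod_scheme \<Rightarrow> ('g \<Rightarrow> 'f \<Rightarrow> 't) \<Rightarrow> int \<Rightarrow> int \<Rightarrow> ('f \<Rightarrow> 'f) \<Rightarrow>
   ('t::ab_group_add \<Rightarrow> 'f::ring_1) \<Rightarrow> 't \<Rightarrow> 'f" where
  "der_act G tens p d \<theta> \<psi> = (THE \<chi>. additive \<chi> \<and> (\<forall>j. \<forall>g\<in>gr G j. \<forall>f.
     \<chi> (tens g f) = \<theta> (\<psi> (tens g f)) - ksgn (p * (d + j)) (\<psi> (tens g (\<theta> f)))))"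

definition end_act ::
  "('g \<Rightarrow> 'f \<Rightarrow> 't) \<Rightarrow> ('t::ab_group_add \<Rightarrow> 'f::ring_1) \<Rightarrow> ('g \<Rightarrow> 'g) \<Rightarrow> 't \<Rightarrow> 'f" where
  "end_act tens \<psi> \<alpha> = (THE \<chi>. additive \<chi> \<and> (\<forall>g f. \<chi> (tens g f) = \<psi> (tens (\<alpha> g) f)))"

definition tor_lie_act ::
  "('r::comm_ring_1 \<Rightarrow> 'k::field) \<Rightarrow> ('r, 'g::ab_group_add, 'y) dgmod_scheme \<Rightarrow>
   ('r, 'f::ring_1, 'z) dgmod_scheme \<Rightarrow> ('r, 't::ab_group_add) dgmod \<Rightarrow>
   ('g \<Rightarrow> 'f \<Rightarrow> 't) \<Rightarrow> int \<Rightarrow> int \<Rightarrow> ('f \<Rightarrow> 'f) set \<Rightarrow> ('t set \<Rightarrow> 'k) \<Rightarrow> 't set \<Rightarrow> 'k" where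
  "tor_lie_act \<epsilon> G F T tens p d \<xi> l = ident \<epsilon> F T tens (p + d)
     (induced2 (bnd (homFF F T tens) (hom_dif T F) (p + d)) (der_act G tens p d)
       \<xi> (ident_inv \<epsilon> F T tens d l))"

definition tor_end_act ::
  "('r::comm_ring_1 \<Rightarrow> 'k::field) \<Rightarrow> ('r, 'f::ring_1, 'z) dgmod_scheme \<Rightarrow>
   ('r, 't::ab_group_add) dgmod \<Rightarrow> ('g \<Rightarrow> 'f \<Rightarrow> 't) \<Rightarrow> int \<Rightarrow> int \<Rightarrow>
   ('t set \<Rightarrow> 'k) \<Rightarrow> ('g \<Rightarrow> 'g) set \<Rightarrow> 't set \<Rightarrow> 'k" where
  "tor_end_act \<epsilon> F T tens d q l a = ident \<epsilon> F T tens (d + q)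
     (induced2 (bnd (homFF F T tens) (hom_dif T F) (d + q)) (end_act tens)
       (ident_inv \<epsilon> F T tens d l) a)"

definition tor_dual_bimod ::
  "('r::comm_ring_1 \<Rightarrow> 'k::field) \<Rightarrow> ('r, 'g::ab_group_add, 'y) dgmod_scheme \<Rightarrow>
   ('r, 'f::ring_1, 'z) gamma_alg_scheme \<Rightarrow> ('r \<Rightarrow> 't::ab_group_add \<Rightarrow> 't) \<Rightarrow>
   ('g \<Rightarrow> 'f \<Rightarrow> 't) \<Rightarrow>
   ('k, ('f \<Rightarrow> 'f) set, ('g \<Rightarrow> 'g) set, 't set \<Rightarrow> 'k) gbimod" where
  "tor_dual_bimod \<epsilon> G F sT tens =
     (let T = tens_cplx G F sT tens; V = gdual (tor_gvec \<epsilon> T) in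
      gvec.extend V
       \<lparr>lact = extend_act \<epsilon> F V (tor_lie_act \<epsilon> G F T tens),
        ract = tor_end_act \<epsilon> F T tens\<rparr>)"

end

theory Submission
  imports Defs
begin

text \<open>
  The map \<open>\<beta> \<mapsto> (g \<otimes> f \<mapsto> \<beta>(g) f)\<close> is an isomorphism of complexes from \<open>Hom\<^sub>R(G, F)\<close> onto
  \<open>Hom\<^sub>F(G \<otimes> F, F)\<close>. It carries composition with a derivation \<open>\<theta>\<close> to \<open>\<psi> \<mapsto> \<theta> \<cdot> \<psi>\<close>, because the term
  subtracted in \<open>\<theta> \<cdot> \<psi>\<close> cancels the second summand of the Leibniz rule for \<open>\<theta>(\<beta>(g) f)\<close>, and it carries
  composition with \<open>\<alpha>\<close> to \<open>\<psi> \<mapsto> \<psi> \<cdot> \<alpha>\<close>.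

  It remains to see that evaluating \<open>aug \<circ> \<psi>\<close> on cycles identifies \<open>H(Hom\<^sub>F(G \<otimes> F, F))\<close> with the
  dual of \<open>Tor(M, k) = H(G \<otimes> F)\<close>. Since \<open>F \<rightarrow> k\<close> is a quasi-isomorphism and \<open>G\<close> is free and bounded
  below, the kernel \<open>K\<close> of \<open>G \<otimes> F \<rightarrow> G \<otimes> k\<close> is acyclic. Hence a functional on the homology extends to
  the cycles modulo \<open>K\<close>, then to the whole \<open>k\<close>-vector space \<open>G \<otimes> k\<close>, and the resulting cocycle
  \<open>G \<rightarrow> k\<close> lifts along \<open>F \<rightarrow> k\<close> to a cocycle \<open>G \<rightarrow> F\<close>; injectivity follows in the same way.
\<close>

section \<open>Signs\<close>

text \<open>The complex \<open>G \<otimes> k\<close> is never built: \<open>K n\<close> stands for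
  the kernel in degree \<open>n\<close>, and functionals on the quotient are functionals on
  \<open>gr GF n\<close> that vanish on \<open>K n\<close>. The tensor product is known only through
  generators and relations, while its differential, the multiplication by \<open>F\<close> and both
  actions are definite descriptions. Each of them needs existence, from the universal property, and
  uniqueness, from additivity; because of the Koszul signs the latter is often tested on tensors
  with homogeneous left factor. A scalar of \<open>k\<close> acts on homology through all its
  preimages under \<open>\<epsilon>\<close> at once, so it has to be shown that the kernel of
  \<open>\<epsilon>\<close> annihilates homology. For Tor this follows from the acyclicity of
  \<open>K\<close>; for Ext it follows from the injectivity of the evaluation, since
  \<open>aug\<close> kills such multiples. The passage from the homotopy Lie algebra to its
  enveloping algebra is formal: a linear bijection that commutes with the letters commutes with
  words and their combinations.\<close>

lemma ksgn_zero [simp]: "ksgn n 0 = 0"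
  by (simp add: ksgn_def)

lemma ksgn_add: "ksgn n (x + y) = ksgn n x + ksgn n y"
  by (simp add: ksgn_def)

lemma ksgn_diff: "ksgn n (x - y) = ksgn n x - ksgn n y"
  by (simp add: ksgn_def)

lemma ksgn_ksgn: "ksgn m (ksgn n x) = ksgn (m + n) x"
  by (simp add: ksgn_def)

lemma ksgn_cancel [simp]: "ksgn n (ksgn n x) = x"
  by (simp add: ksgn_def)

lemma ksgn_one_plus: "ksgn (n + 1) x = - ksgn n x"
  by (simp add: ksgn_def)

lemma ksgn_additive: "additive f \<Longrightarrow> f (ksgn n x) = ksgn n (f x)"
  by (simp add: ksgn_def additive.minus)

lemma ksgn_mult_left: "ksgn n x * y = ksgn n (x * y :: 'a::ring)"
  by (simp add: ksgn_def)

lemma ksgn_sum: "ksgn n (\<Sum>x\<in>A. f x) = (\<Sum>x\<in>A. ksgn n (f x))"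
  by (simp add: ksgn_def sum_negf)

lemma (in module) subspace_ksgn: "subspace S \<Longrightarrow> x \<in> S \<Longrightarrow> ksgn n x \<in> S"
  by (simp add: ksgn_def subspace_neg)

lemma module_hom_additive: "module_hom s s' f \<Longrightarrow> additive f"
  by (simp add: additive_def module_hom_iff)

lemma module_hom_ksgn: "module_hom s s' f \<Longrightarrow> module_hom s s' (\<lambda>x. ksgn n (f x))"
  by (cases "even n") (auto simp: ksgn_def module_hom_iff module.scale_minus_right)

lemma module_homI:
  fixes s :: "'r::comm_ring_1 \<Rightarrow> 'a::ab_group_add \<Rightarrow> 'a" and s' :: "'r \<Rightarrow> 'b::ab_group_add \<Rightarrow> 'b"
  assumes "module s" "module s'"
    and "\<And>x y. f (x + y) = f x + f y" and "\<And>r x. f (s r x) = s' r (f x)"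
  shows "module_hom s s' f"
  using assms by (simp add: module_hom_iff)


section \<open>Graded modules\<close>

locale graded_mod =
  fixes A :: "('r::comm_ring_1, 'a::ab_group_add, 'z) dgmod_scheme"
  assumes graded: "graded_module A"
begin

sublocale module "scl A"
  using graded by (simp add: graded_module_def)

lemma subspace_gr: "subspace (gr A n)"
  using graded by (simp add: graded_module_def)

lemmas gr_zero [simp] = subspace_0[OF subspace_gr]
  and gr_add = subspace_add[OF subspace_gr]
  and gr_diff = subspace_diff[OF subspace_gr]
  and gr_scale = subspace_scale[OF subspace_gr]
  and gr_ksgn = subspace_ksgn[OF subspace_gr]

text \<open>Components live in the same type as the element itself, so a map prescribed on one
  degree becomes a total map by precomposition with \<open>hcomp n\<close>.\<close>

definition hcomp :: "int \<Rightarrow> 'a \<Rightarrow> 'a" where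
  "hcomp n x = (THE c. (\<forall>n. c n \<in> gr A n) \<and> finite {n. c n \<noteq> 0} \<and> x = (\<Sum>n | c n \<noteq> 0. c n)) n"

lemma hcomp_decomposition:
  "(\<forall>n. hcomp n x \<in> gr A n) \<and> finite {n. hcomp n x \<noteq> 0} \<and> x = (\<Sum>n | hcomp n x \<noteq> 0. hcomp n x)"
proof -
  define c where
    "c = (THE c. (\<forall>n. c n \<in> gr A n) \<and> finite {n. c n \<noteq> 0} \<and> x = (\<Sum>n | c n \<noteq> 0. c n))"
  have "\<exists>!c. (\<forall>n. c n \<in> gr A n) \<and> finite {n. c n \<noteq> 0} \<and> x = (\<Sum>n | c n \<noteq> 0. c n)"
    using graded by (simp add: graded_module_def)
  from theI'[OF this] have c:
    "(\<forall>n. c n \<in> gr A n) \<and> finite {n. c n \<noteq> 0} \<and> x = (\<Sum>n | c n \<noteq> 0. c n)"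
    unfolding c_def .
  have eq: "hcomp n x = c n" for n
    by (simp only: hcomp_def c_def)
  show ?thesis unfolding eq by (rule c)
qed

lemma hcomp_in_gr: "hcomp n x \<in> gr A n"
  and finite_hcomp: "finite {n. hcomp n x \<noteq> 0}"
  and sum_hcomp: "(\<Sum>n | hcomp n x \<noteq> 0. hcomp n x) = x"
  using hcomp_decomposition[of x] by auto

text \<open>The index set \<open>S\<close> may exceed the support, which allows the decompositions
  of two elements to be compared over the union of their supports.\<close>

lemma hcomp_unique:
  assumes "\<And>n. c n \<in> gr A n" and "finite S" and "\<And>n. n \<notin> S \<Longrightarrow> c n = 0" and "x = (\<Sum>n\<in>S. c n)"
  shows "hcomp n x = c n"
proof -
  have fin: "finite {n. c n \<noteq> 0}"
    by (rule finite_subset[OF _ assms(2)]) (use assms(3) in blast)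
  have "x = (\<Sum>n | c n \<noteq> 0. c n)"
    unfolding assms(4) by (rule sum.mono_neutral_right) (use assms(2,3) in auto)
  moreover have "\<exists>!c. (\<forall>n. c n \<in> gr A n) \<and> finite {n. c n \<noteq> 0} \<and> x = (\<Sum>n | c n \<noteq> 0. c n)"
    using graded by (simp add: graded_module_def)
  ultimately have "(\<lambda>n. hcomp n x) = c"
    using hcomp_decomposition[of x] fin assms(1) by (elim ex1E) metis
  then show ?thesis by (rule fun_cong)
qed

lemma sum_hcomp_superset: "finite S \<Longrightarrow> {n. hcomp n x \<noteq> 0} \<subseteq> S \<Longrightarrow> (\<Sum>n\<in>S. hcomp n x) = x"
  by (rule trans[OF sum.mono_neutral_right sum_hcomp]) auto

lemma hcomp_homogeneous: "x \<in> gr A m \<Longrightarrow> hcomp n x = (if n = m then x else 0)"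
  by (rule hcomp_unique[where c = "\<lambda>n. if n = m then x else 0" and S = "{m}"]) auto

lemma gr_disjoint: "x \<in> gr A m \<Longrightarrow> x \<in> gr A n \<Longrightarrow> m \<noteq> n \<Longrightarrow> x = 0"
  using hcomp_homogeneous[of x m m] hcomp_homogeneous[of x n m] by simp

lemma module_hom_hcomp: "module_hom (scl A) (scl A) (hcomp n)"
proof (rule module_homI)
  fix x y
  let ?S = "{n. hcomp n x \<noteq> 0} \<union> {n. hcomp n y \<noteq> 0}"
  have "finite ?S" by (simp add: finite_hcomp)
  then show "hcomp n (x + y) = hcomp n x + hcomp n y"
    by (intro hcomp_unique[where c = "\<lambda>n. hcomp n x + hcomp n y" and S = ?S])
      (auto simp: hcomp_in_gr gr_add sum.distrib sum_hcomp_superset)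
next
  fix r x
  show "hcomp n (scl A r x) = scl A r (hcomp n x)"
    by (intro hcomp_unique[where c = "\<lambda>n. scl A r (hcomp n x)" and S = "{n. hcomp n x \<noteq> 0}"])
      (auto simp: hcomp_in_gr gr_scale finite_hcomp sum_hcomp simp flip: scale_sum_right)
qed (rule module_axioms)+

lemmas hcomp_add = module_hom.add[OF module_hom_hcomp]
  and hcomp_scale = module_hom.scale[OF module_hom_hcomp]

lemma homogeneous_induct [case_names zero add homogeneous]:
  assumes "P 0" and "\<And>x y. P x \<Longrightarrow> P y \<Longrightarrow> P (x + y)" and "\<And>n x. x \<in> gr A n \<Longrightarrow> P x"
  shows "P x"
proof -
  have "P (\<Sum>n\<in>S. hcomp n x)" if "finite S" for S
    using that by (induction S rule: finite_induct) (simp_all add: assms(1) assms(2)[OF assms(3)[OF hcomp_in_gr]])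
  then show ?thesis
    using sum_hcomp[of x] finite_hcomp[of x] by metis
qed

lemma additive_eqI:
  assumes "additive f" "additive g" and "\<And>n x. x \<in> gr A n \<Longrightarrow> f x = g x"
  shows "f x = g x"
  by (induction x rule: homogeneous_induct)
    (simp_all add: assms additive.add[OF assms(1)] additive.add[OF assms(2)]
      additive.zero[OF assms(1)] additive.zero[OF assms(2)])

text \<open>The universal property of a direct sum: \<open>h n\<close> is evaluated on the component
  of degree \<open>n\<close>, and only finitely many terms are nonzero. It assembles signs that
  depend on the degree, and homotopies constructed degree by degree, into one linear map.\<close>

lemma ex_module_hom_on_components:
  fixes s :: "'r \<Rightarrow> 'b::ab_group_add \<Rightarrow> 'b"
  assumes "\<And>n. module_hom (scl A) s (h n)"
  shows "\<exists>f. module_hom (scl A) s f \<and> (\<forall>n. \<forall>x\<in>gr A n. f x = h n x)"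
proof -
  define f where "f x = (\<Sum>n | hcomp n x \<noteq> 0. h n (hcomp n x))" for x
  have f: "f x = (\<Sum>n\<in>S. h n (hcomp n x))" if "finite S" "{n. hcomp n x \<noteq> 0} \<subseteq> S" for S x
    unfolding f_def by (rule sum.mono_neutral_left)
      (use that module_hom.zero[OF assms] in auto)
  have mods: "module s" using assms by (simp add: module_hom_iff)
  have "module_hom (scl A) s f"
  proof (rule module_homI)
    fix x y
    let ?S = "{n. hcomp n x \<noteq> 0} \<union> {n. hcomp n y \<noteq> 0} \<union> {n. hcomp n (x + y) \<noteq> 0}"
    have "finite ?S" by (simp add: finite_hcomp)
    then show "f (x + y) = f x + f y"
      by (subst (1 2 3) f[of ?S]) (auto simp: hcomp_add sum.distrib module_hom.add[OF assms])
  next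
    fix r x
    let ?S = "{n. hcomp n x \<noteq> 0} \<union> {n. hcomp n (scl A r x) \<noteq> 0}"
    have "finite ?S" by (simp add: finite_hcomp)
    then show "f (scl A r x) = s r (f x)"
      by (subst (1 2) f[of ?S])
        (auto simp: hcomp_scale module_hom.scale[OF assms] module.scale_sum_right[OF mods])
  qed (simp_all add: module_axioms mods)
  moreover have "f x = h n x" if "x \<in> gr A n" for n x
  proof -
    have "f x = (\<Sum>m\<in>{n}. h m (hcomp m x))"
      by (rule f) (use that in \<open>auto simp: hcomp_homogeneous\<close>)
    then show ?thesis
      using that by (simp add: hcomp_homogeneous)
  qed
  ultimately show ?thesis by blast
qed

end

locale dg_mod = graded_mod +
  assumes complex: "chain_complex A"
begin

lemma module_hom_dif: "module_hom (scl A) (scl A) (dif A)"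
  using complex by (simp add: chain_complex_def)

lemma dif_in_gr: "x \<in> gr A n \<Longrightarrow> dif A x \<in> gr A (n - 1)"
  using complex by (auto simp: chain_complex_def)

lemma dif_dif [simp]: "dif A (dif A x) = 0"
  using complex by (simp add: chain_complex_def)

lemmas dif_zero [simp] = module_hom.zero[OF module_hom_dif]
  and dif_add = module_hom.add[OF module_hom_dif]
  and dif_diff = module_hom.diff[OF module_hom_dif]
  and dif_neg = module_hom.neg[OF module_hom_dif]
  and dif_scale = module_hom.scale[OF module_hom_dif]
  and dif_ksgn = ksgn_additive[OF module_hom_additive[OF module_hom_dif]]

end

lemma dg_modI: "chain_complex A \<Longrightarrow> dg_mod A"
  by (simp add: dg_mod_def dg_mod_axioms_def graded_mod_def chain_complex_def)

section \<open>Homology\<close>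

lemma mem_coset_iff: "x \<in> z +o B \<longleftrightarrow> x - z \<in> B" for x :: "'a::ab_group_add"
  by (auto simp: elt_set_plus_def) (metis add_diff_cancel_left' diff_add_cancel add.commute)

text \<open>Only additive data on subsets of a fixed type are recorded, so that the locale covers
  Hom complexes, where the differential depends on the degree, as well as
  \<open>G \<otimes> F\<close>, where it does not.\<close>

locale abelian_complex =
  fixes C :: "int \<Rightarrow> 'a::ab_group_add set" and \<delta> :: "int \<Rightarrow> 'a \<Rightarrow> 'a"
  assumes zero_closed: "0 \<in> C d"
    and diff_closed: "x \<in> C d \<Longrightarrow> y \<in> C d \<Longrightarrow> x - y \<in> C d"
    and \<delta>_diff: "x \<in> C d \<Longrightarrow> y \<in> C d \<Longrightarrow> \<delta> d (x - y) = \<delta> d x - \<delta> d y"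
    and \<delta>_closed: "x \<in> C d \<Longrightarrow> \<delta> d x \<in> C (d - 1)"
    and \<delta>_\<delta>: "x \<in> C d \<Longrightarrow> \<delta> (d - 1) (\<delta> d x) = 0"
begin

definition cyc :: "int \<Rightarrow> 'a set" where
  "cyc d = {z \<in> C d. \<delta> d z = 0}"

abbreviation bd :: "int \<Rightarrow> 'a set" where
  "bd \<equiv> bnd C \<delta>"

abbreviation cls :: "int \<Rightarrow> 'a \<Rightarrow> 'a set" where
  "cls d z \<equiv> z +o bd d"

lemma \<delta>_zero: "\<delta> d 0 = 0"
  using \<delta>_diff[OF zero_closed zero_closed] by simp

lemma neg_closed: "x \<in> C d \<Longrightarrow> - x \<in> C d"
  using diff_closed[OF zero_closed] by fastforce

lemma add_closed: "x \<in> C d \<Longrightarrow> y \<in> C d \<Longrightarrow> x + y \<in> C d"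
  using diff_closed[of x d "- y"] neg_closed by simp

lemma cyc_zero: "0 \<in> cyc d"
  by (simp add: cyc_def zero_closed \<delta>_zero)

lemma cyc_diff: "x \<in> cyc d \<Longrightarrow> y \<in> cyc d \<Longrightarrow> x - y \<in> cyc d"
  by (simp add: cyc_def diff_closed \<delta>_diff)

lemma cyc_add: "x \<in> cyc d \<Longrightarrow> y \<in> cyc d \<Longrightarrow> x + y \<in> cyc d"
  using cyc_diff[of x d "0 - y"] cyc_diff[OF cyc_zero] by simp

lemma bd_zero: "0 \<in> bd d"
  unfolding bnd_def using zero_closed \<delta>_zero by (metis image_eqI)

lemma bd_diff: "x \<in> bd d \<Longrightarrow> y \<in> bd d \<Longrightarrow> x - y \<in> bd d"
  unfolding bnd_def using diff_closed by (auto simp flip: \<delta>_diff)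

lemma bd_add: "x \<in> bd d \<Longrightarrow> y \<in> bd d \<Longrightarrow> x + y \<in> bd d"
  using bd_diff[of x d "0 - y"] bd_diff[OF bd_zero] by simp

lemma bd_subset_cyc: "bd d \<subseteq> cyc d"
  using \<delta>_closed[of _ "d + 1"] \<delta>_\<delta>[of _ "d + 1"] by (auto simp: bnd_def cyc_def)

lemma cls_eq_iff: "cls d z = cls d z' \<longleftrightarrow> z - z' \<in> bd d"
proof
  assume "cls d z = cls d z'"
  moreover have "z \<in> cls d z" by (simp add: mem_coset_iff bd_zero)
  ultimately show "z - z' \<in> bd d" by (simp add: mem_coset_iff)
next
  assume z: "z - z' \<in> bd d"
  show "cls d z = cls d z'"
  proof (intro set_eqI)
    fix x
    show "x \<in> cls d z \<longleftrightarrow> x \<in> cls d z'"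
      using bd_add[OF _ z, of "x - z"] bd_diff[OF _ z, of "x - z'"] by (auto simp: mem_coset_iff)
  qed
qed

lemma homology_eq: "homology C \<delta> d = cls d ` cyc d"
  by (auto simp: homology_def cyc_def)

lemma homology_subset_cyc: "X \<in> homology C \<delta> d \<Longrightarrow> X \<subseteq> cyc d"
  using bd_subset_cyc cyc_add by (fastforce simp: homology_eq elt_set_plus_def)

lemma cls_self: "z \<in> cls d z"
  by (simp add: mem_coset_iff bd_zero)

text \<open>The union that defines \<open>induced2\<close> collapses to one coset once all values
  are congruent to \<open>w\<close>. Well-definedness of an operation on homology is thereby reduced
  to a congruence.\<close>

lemma induced2_eq_cls:
  assumes "X \<noteq> {}" "Y \<noteq> {}" and "\<And>x y. x \<in> X \<Longrightarrow> y \<in> Y \<Longrightarrow> f x y - w \<in> bd d"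
  shows "induced2 (bd d) f X Y = cls d w"
proof -
  have "f x y +o bd d = cls d w" if "x \<in> X" "y \<in> Y" for x y
    using assms(3)[OF that] cls_eq_iff by blast
  then show ?thesis using assms(1,2) by (auto simp: induced2_def)
qed

lemma induced2_add_cls: "induced2 (bd d) (+) (cls d z) (cls d z') = cls d (z + z')"
proof (rule induced2_eq_cls)
  fix x y assume "x \<in> cls d z" "y \<in> cls d z'"
  then have "(x - z) + (y - z') \<in> bd d" by (intro bd_add) (simp_all add: mem_coset_iff)
  then show "x + y - (z + z') \<in> bd d" by (simp add: algebra_simps)
qed (use cls_self in blast)+

end


section \<open>Hom complexes\<close>

lemma hom_grD:
  assumes "\<beta> \<in> hom_gr A B d"
  shows "module_hom (scl A) (scl B) \<beta>" "x \<in> gr A n \<Longrightarrow> \<beta> x \<in> gr B (n + d)"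
  using assms by (auto simp: hom_gr_def)

locale hom_complex = A: dg_mod A + B: dg_mod B
  for A :: "('r::comm_ring_1, 'a::ab_group_add, 'y) dgmod_scheme"
    and B :: "('r, 'b::ab_group_add, 'z) dgmod_scheme"
begin

sublocale pair: module_pair "scl A" "scl B"
  by (simp add: module_pair_def A.module_axioms B.module_axioms)

lemma hom_gr_zero: "0 \<in> hom_gr A B d"
  using pair.module_hom_zero by (auto simp: hom_gr_def zero_fun_def)

lemma hom_gr_diff:
  assumes "\<beta> \<in> hom_gr A B d" "\<beta>' \<in> hom_gr A B d"
  shows "\<beta> - \<beta>' \<in> hom_gr A B d"
  using pair.module_hom_sub[OF hom_grD(1)[OF assms(1)] hom_grD(1)[OF assms(2)]]
    hom_grD(2)[OF assms(1)] hom_grD(2)[OF assms(2)]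
  by (auto simp: hom_gr_def fun_diff_def B.gr_diff)

lemma hom_gr_scale:
  assumes "\<beta> \<in> hom_gr A B d"
  shows "(\<lambda>x. scl B r (\<beta> x)) \<in> hom_gr A B d"
  using pair.module_hom_scale[OF hom_grD(1)[OF assms]] hom_grD(2)[OF assms]
  by (auto simp: hom_gr_def B.gr_scale)

lemma hom_dif_diff: "hom_dif A B d (\<beta> - \<beta>') = hom_dif A B d \<beta> - hom_dif A B d \<beta>'"
  by (rule ext) (simp add: hom_dif_def B.dif_diff ksgn_diff)

lemma hom_dif_scale: "hom_dif A B d (\<lambda>x. scl B r (\<beta> x)) = (\<lambda>x. scl B r (hom_dif A B d \<beta> x))"
  by (rule ext) (simp add: hom_dif_def ksgn_def B.dif_scale B.scale_right_diff_distrib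
      B.scale_right_distrib)

lemma hom_dif_in_hom_gr:
  assumes "\<beta> \<in> hom_gr A B d"
  shows "hom_dif A B d \<beta> \<in> hom_gr A B (d - 1)"
proof -
  note hom = hom_grD(1)[OF assms]
  have "module_hom (scl A) (scl B) (hom_dif A B d \<beta>)"
    by (rule module_homI[OF A.module_axioms B.module_axioms])
      (simp_all add: hom_dif_def module_hom.add[OF hom] module_hom.scale[OF hom] B.dif_add
        A.dif_add B.dif_scale A.dif_scale ksgn_def B.scale_right_diff_distrib B.scale_right_distrib)
  moreover have "hom_dif A B d \<beta> x \<in> gr B (n + (d - 1))" if "x \<in> gr A n" for n x
    using B.dif_in_gr[OF hom_grD(2)[OF assms that]] hom_grD(2)[OF assms A.dif_in_gr[OF that]]
    by (simp add: hom_dif_def B.gr_diff B.gr_ksgn algebra_simps)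
  ultimately show ?thesis by (auto simp: hom_gr_def)
qed

lemma hom_dif_hom_dif:
  assumes "\<beta> \<in> hom_gr A B d"
  shows "hom_dif A B (d - 1) (hom_dif A B d \<beta>) = 0"
proof
  fix x
  \<comment> \<open>The mixed terms carry the signs of degrees \<open>d\<close> and
    \<open>d - 1\<close>, which are opposite, and so cancel.\<close>
  have "ksgn (d - 1) y = - ksgn d y" for y :: 'b by (simp add: ksgn_def)
  then show "hom_dif A B (d - 1) (hom_dif A B d \<beta>) x = 0 x"
    using module_hom.zero[OF hom_grD(1)[OF assms]]
    by (simp add: hom_dif_def B.dif_diff B.dif_ksgn ksgn_diff)
qed

sublocale abelian_complex "hom_gr A B" "hom_dif A B"
  by unfold_locales
    (simp_all add: hom_gr_zero hom_gr_diff hom_dif_diff hom_dif_in_hom_gr hom_dif_hom_dif)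

lemma hom_gr_ksgn: "\<beta> \<in> hom_gr A B d \<Longrightarrow> ksgn n \<beta> \<in> hom_gr A B d"
  by (simp add: ksgn_def neg_closed)

lemma hom_dif_ksgn: "hom_dif A B d (ksgn n \<beta>) = ksgn n (hom_dif A B d \<beta>)"
  by (rule ext) (simp add: hom_dif_def ksgn_def B.dif_neg)

end

section \<open>Tensor products\<close>

lemma module_poly_mapping: "module (\<lambda>(r::'r::comm_ring_1) (u::'p \<Rightarrow>\<^sub>0 'r). Poly_Mapping.map ((*) r) u)"
proof -
  have "Poly_Mapping.lookup (Poly_Mapping.map ((*) r) u) p = r * Poly_Mapping.lookup u p"
    for r :: 'r and u :: "'p \<Rightarrow>\<^sub>0 'r" and p
    by (simp add: Poly_Mapping.map.rep_eq when_def)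
  then show ?thesis
    by unfold_locales (auto intro!: poly_mapping_eqI simp: lookup_add algebra_simps)
qed

lemma (in module) free_lift_superset:
  assumes "finite S" and "Poly_Mapping.keys u \<subseteq> S"
  shows "free_lift scale h u = (\<Sum>p\<in>S. scale (Poly_Mapping.lookup u p) (h p))"
  unfolding free_lift_def
  by (rule sum.mono_neutral_left) (use assms in \<open>auto simp: in_keys_iff\<close>)

lemma (in module) module_hom_free_lift:
  "module_hom (\<lambda>r. Poly_Mapping.map ((*) r)) scale (free_lift scale h)"
proof (rule module_homI[OF module_poly_mapping module_axioms])
  fix u v :: "'c \<Rightarrow>\<^sub>0 'a"
  let ?S = "Poly_Mapping.keys u \<union> Poly_Mapping.keys v \<union> Poly_Mapping.keys (u + v)"
  show "free_lift scale h (u + v) = free_lift scale h u + free_lift scale h v"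
    by (subst (1 2 3) free_lift_superset[of ?S])
      (auto simp: lookup_add scale_left_distrib sum.distrib)
next
  fix r and u :: "'c \<Rightarrow>\<^sub>0 'a"
  let ?S = "Poly_Mapping.keys u \<union> Poly_Mapping.keys (Poly_Mapping.map ((*) r) u)"
  have "Poly_Mapping.lookup (Poly_Mapping.map ((*) r) u) p = r * Poly_Mapping.lookup u p" for p
    by (simp add: Poly_Mapping.map.rep_eq when_def)
  then show "free_lift scale h (Poly_Mapping.map ((*) r) u) = scale r (free_lift scale h u)"
    by (subst (1 2) free_lift_superset[of ?S]) (auto simp: scale_sum_right)
qed

lemma (in module) free_lift_single: "free_lift scale h (Poly_Mapping.single p r) = scale r (h p)"
  by (subst free_lift_superset[of "{p}"]) auto

locale tensor_product =
  fixes s :: "'r::comm_ring_1 \<Rightarrow> 'a::ab_group_add \<Rightarrow> 'a"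
    and s' :: "'r \<Rightarrow> 'b::ab_group_add \<Rightarrow> 'b"
    and sT :: "'r \<Rightarrow> 't::ab_group_add \<Rightarrow> 't"
    and tens :: "'a \<Rightarrow> 'b \<Rightarrow> 't"
  assumes tensor: "is_tensor_product s s' sT tens"
begin

sublocale T: module sT
  using tensor by (simp add: is_tensor_product_def)

lemma free_lift_relation:
  assumes "u \<in> bilin_relations s s'"
  shows "free_lift sT (case_prod tens) u = 0"
proof -
  have "u \<in> module.span (\<lambda>r. Poly_Mapping.map ((*) r)) (bilin_relations s s')"
    by (rule module.span_base[OF module_poly_mapping assms])
  then show ?thesis
    using tensor unfolding is_tensor_product_def by blast
qed

lemmas free_lift_simps =
  module_hom.diff[OF T.module_hom_free_lift] T.free_lift_single

lemma tens_add_left: "tens (a + a') b = tens a b + tens a' b"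
proof -
  have "free_lift sT (case_prod tens) (Poly_Mapping.single (a + a', b) 1
      - Poly_Mapping.single (a, b) 1 - Poly_Mapping.single (a', b) 1) = 0"
    by (rule free_lift_relation) (unfold bilin_relations_def, blast)
  then show ?thesis by (simp add: free_lift_simps diff_eq_eq)
qed

lemma tens_add_right: "tens a (b + b') = tens a b + tens a b'"
proof -
  have "free_lift sT (case_prod tens) (Poly_Mapping.single (a, b + b') 1
      - Poly_Mapping.single (a, b) 1 - Poly_Mapping.single (a, b') 1) = 0"
    by (rule free_lift_relation) (unfold bilin_relations_def, blast)
  then show ?thesis by (simp add: free_lift_simps diff_eq_eq)
qed

lemma tens_scale_left: "tens (s r a) b = sT r (tens a b)"
proof -
  have "free_lift sT (case_prod tens)
      (Poly_Mapping.single (s r a, b) 1 - Poly_Mapping.single (a, b) r) = 0"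
    by (rule free_lift_relation) (unfold bilin_relations_def, blast)
  then show ?thesis by (simp add: free_lift_simps)
qed

lemma tens_scale_right: "tens a (s' r b) = sT r (tens a b)"
proof -
  have "free_lift sT (case_prod tens)
      (Poly_Mapping.single (a, s' r b) 1 - Poly_Mapping.single (a, b) r) = 0"
    by (rule free_lift_relation) (unfold bilin_relations_def, blast)
  then show ?thesis by (simp add: free_lift_simps)
qed

lemma additive_tens_left: "additive (\<lambda>a. tens a b)"
  and additive_tens_right: "additive (tens a)"
  by (simp_all add: additive_def tens_add_left tens_add_right)

lemmas tens_zero_left [simp] = additive.zero[OF additive_tens_left]
  and tens_zero_right [simp] = additive.zero[OF additive_tens_right]
  and tens_ksgn_left = ksgn_additive[OF additive_tens_left]

text \<open>The zero and scalar cases are covered by \<open>tens\<close>: \<open>0\<close> is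
  \<open>tens 0 0\<close>, and a scalar is absorbed into the left factor.\<close>

lemma tensor_induct [case_names add tens]:
  assumes "\<And>x y. P x \<Longrightarrow> P y \<Longrightarrow> P (x + y)" and "\<And>a b. P (tens a b)"
  shows "P t"
proof -
  have "surj (free_lift sT (case_prod tens))"
    using tensor by (simp add: is_tensor_product_def)
  then obtain u where "t = free_lift sT (case_prod tens) u" by blast
  moreover have "P (\<Sum>p\<in>S. sT (c p) (case_prod tens p))" if "finite S" for S and c :: "'a \<times> 'b \<Rightarrow> 'r"
    using that
  proof (induction S rule: finite_induct)
    case empty
    then show ?case using assms(2)[of 0 0] by simp
  next
    case (insert p S)
    then show ?case
      by (cases p) (simp add: assms flip: tens_scale_left)
  qed
  ultimately show ?thesis by (simp add: free_lift_def)
qed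

text \<open>Pure tensors generate the tensor product already as an abelian group. Hence the definite
  descriptions that ask for an additive map with prescribed values on tensors determine it.\<close>

lemma tensor_eqI:
  assumes "additive f" "additive h" and "\<And>a b. f (tens a b) = h (tens a b)"
  shows "f = h"
proof
  fix t
  show "f t = h t"
    by (induction t rule: tensor_induct)
      (simp_all add: assms additive.add[OF assms(1)] additive.add[OF assms(2)])
qed

text \<open>The linear map that \<open>h\<close> induces on the free module kills the bilinearity
  relations, hence their span, which is the kernel of the presentation of the tensor product. It
  therefore descends along that surjection.\<close>

lemma ex_tensor_lift:
  fixes sX :: "'r \<Rightarrow> 'x::ab_group_add \<Rightarrow> 'x"
  assumes "\<And>b. module_hom s sX (\<lambda>a. h a b)" and "\<And>a. module_hom s' sX (h a)"
  shows "\<exists>H. module_hom sT sX H \<and> (\<forall>a b. H (tens a b) = h a b)"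
proof -
  interpret X: module sX using assms(1) by (simp add: module_hom_iff)
  let ?L = "free_lift sT (case_prod tens)" and ?M = "free_lift sX (case_prod h)"
  let ?sc = "\<lambda>r. Poly_Mapping.map ((*) r)"
  have "?M u = 0" if "u \<in> bilin_relations s s'" for u
    using that module_hom.add[OF assms(1)] module_hom.add[OF assms(2)]
      module_hom.scale[OF assms(1)] module_hom.scale[OF assms(2)]
    by (auto simp: bilin_relations_def module_hom.diff[OF X.module_hom_free_lift] X.free_lift_single)
  then have "?M u = 0" if "u \<in> module.span ?sc (bilin_relations s s')" for u
    using module_hom.eq_0_on_span[OF X.module_hom_free_lift] that by blast
  then have ker: "?M u = 0" if "?L u = 0" for u
    using that tensor unfolding is_tensor_product_def by blast
  have wd: "?M u = ?M v" if "?L u = ?L v" for u v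
    using ker[of "u - v"] that
    by (simp add: module_hom.diff[OF X.module_hom_free_lift] module_hom.diff[OF T.module_hom_free_lift])
  have surj: "surj ?L" using tensor by (simp add: is_tensor_product_def)
  \<comment> \<open>Any section of \<open>?L\<close> would do, as \<open>wd\<close> makes the value
    independent of the preimage.\<close>
  define H where "H t = ?M (inv ?L t)" for t
  have H: "H (?L u) = ?M u" for u
    unfolding H_def by (rule wd) (simp add: surj surj_f_inv_f)
  have "module_hom sT sX H"
  proof (rule module_homI[OF T.module_axioms X.module_axioms])
    fix x y
    obtain u v where "x = ?L u" "y = ?L v" using surj by (metis surjD)
    then show "H (x + y) = H x + H y"
      using H[of "u + v"] by (simp add: H module_hom.add[OF X.module_hom_free_lift]
          module_hom.add[OF T.module_hom_free_lift])
  next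
    fix r x
    obtain u where "x = ?L u" using surj by (metis surjD)
    then show "H (sT r x) = sX r (H x)"
      using H[of "?sc r u"] by (simp add: H module_hom.scale[OF X.module_hom_free_lift]
          module_hom.scale[OF T.module_hom_free_lift])
  qed
  moreover have "H (tens a b) = h a b" for a b
    using H[of "Poly_Mapping.single (a, b) 1"] by (simp add: X.free_lift_single T.free_lift_single)
  ultimately show ?thesis by blast
qed

end


section \<open>Extension of functionals\<close>

lemma residue_map_simps:
  assumes "residue_map \<epsilon>"
  shows "\<epsilon> 0 = 0" "\<epsilon> 1 = 1" "\<epsilon> (a + b) = \<epsilon> a + \<epsilon> b" "\<epsilon> (a * b) = \<epsilon> a * \<epsilon> b"
    "\<epsilon> (- a) = - \<epsilon> a" "\<epsilon> (a - b) = \<epsilon> a - \<epsilon> b"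
proof -
  have add: "additive \<epsilon>" using assms by (simp add: additive_def residue_map_def)
  show "\<epsilon> 0 = 0" "\<epsilon> 1 = 1" "\<epsilon> (a + b) = \<epsilon> a + \<epsilon> b" "\<epsilon> (a * b) = \<epsilon> a * \<epsilon> b"
    "\<epsilon> (- a) = - \<epsilon> a" "\<epsilon> (a - b) = \<epsilon> a - \<epsilon> b"
    using assms additive.zero[OF add] additive.minus[OF add] additive.diff[OF add]
    by (simp_all add: residue_map_def)
qed

lemma residue_map_onto: "residue_map \<epsilon> \<Longrightarrow> \<exists>r. \<epsilon> r = c"
  by (metis residue_map_def surjD)

lemma module_residue: "residue_map \<epsilon> \<Longrightarrow> module (\<lambda>r c. \<epsilon> r * c)"
  by unfold_locales (simp_all add: residue_map_simps algebra_simps)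

text \<open>
  Instead of extending \<open>l\<close> directly, a submodule \<open>N\<close> is chosen maximal among those meeting \<open>S\<close> in
  the kernel of \<open>l\<close>. When \<open>l \<noteq> 0\<close>, maximality forces \<open>N + S = V\<close>, which determines the extension.
\<close>

lemma (in module) ex_extend_functional:
  fixes \<epsilon> :: "'a \<Rightarrow> 'k::field"
  assumes \<epsilon>: "residue_map \<epsilon>" and V: "subspace V" and S: "subspace S" and "S \<subseteq> V"
    and l_add: "\<And>x y. x \<in> S \<Longrightarrow> y \<in> S \<Longrightarrow> l (x + y) = l x + l y"
    and l_scale: "\<And>r x. x \<in> S \<Longrightarrow> l (scale r x) = \<epsilon> r * l x"
    and kill: "\<And>r x. x \<in> V \<Longrightarrow> \<epsilon> r = 0 \<Longrightarrow> scale r x \<in> S \<and> l (scale r x) = 0"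
  shows "\<exists>l'. (\<forall>x\<in>S. l' x = l x) \<and> (\<forall>x\<in>V. \<forall>y\<in>V. l' (x + y) = l' x + l' y) \<and>
    (\<forall>r. \<forall>x\<in>V. l' (scale r x) = \<epsilon> r * l' x)"
proof (cases "\<forall>x\<in>S. l x = 0")
  case True
  then show ?thesis by (intro exI[of _ "\<lambda>_. 0"]) simp
next
  case False
  then obtain s where s: "s \<in> S" "l s \<noteq> 0" by blast
  have l_0: "l 0 = 0"
    using l_scale[of s 0] s(1) by (simp add: residue_map_simps[OF \<epsilon>])
  have l_diff: "l (x - y) = l x - l y" if "x \<in> S" "y \<in> S" for x y
    using l_add[of "x - y" y] that subspace_diff[OF S] by simp
  define \<N> where "\<N> = {N. subspace N \<and> N \<subseteq> V \<and> N \<inter> S = {x\<in>S. l x = 0}}"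
  have ker: "{x\<in>S. l x = 0} \<in> \<N>"
    unfolding \<N>_def using \<open>S \<subseteq> V\<close> l_0 S
    by (auto simp: subspace_def l_add l_scale)
  have "\<exists>N\<in>\<N>. \<forall>X\<in>\<N>. N \<subseteq> X \<longrightarrow> X = N"
  proof (rule subset_Zorn_nonempty)
    fix C assume C: "C \<noteq> {}" "subset.chain \<N> C"
    then have mem: "\<And>N. N \<in> C \<Longrightarrow> N \<in> \<N>" by (auto simp: subset.chain_def)
    have "subspace (\<Union>C)"
    proof (rule subspaceI)
      show "0 \<in> \<Union>C"
        using C(1) mem subspace_0 unfolding \<N>_def by blast
    next
      fix x y assume "x \<in> \<Union>C" "y \<in> \<Union>C"
      then obtain X Y where "X \<in> C" "x \<in> X" "Y \<in> C" "y \<in> Y" by blast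
      moreover from this have "X \<subseteq> Y \<or> Y \<subseteq> X" using C(2) by (auto simp: subset.chain_def)
      ultimately show "x + y \<in> \<Union>C"
        using mem subspace_add unfolding \<N>_def by blast
    next
      fix c x assume "x \<in> \<Union>C"
      then show "scale c x \<in> \<Union>C"
        using mem subspace_scale unfolding \<N>_def by blast
    qed
    moreover have "\<Union>C \<subseteq> V" using mem unfolding \<N>_def by blast
    moreover have "\<Union>C \<inter> S = {x\<in>S. l x = 0}"
      using C(1) mem unfolding \<N>_def by blast
    ultimately show "\<Union>C \<in> \<N>" unfolding \<N>_def by blast
  qed (use ker in blast)
  then obtain N where mem: "N \<in> \<N>" and max: "\<And>X. X \<in> \<N> \<Longrightarrow> N \<subseteq> X \<Longrightarrow> X = N"
    by blast
  from mem have N: "subspace N" "N \<subseteq> V" "N \<inter> S = {x\<in>S. l x = 0}"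
    by (simp_all add: \<N>_def)
  have ex: "\<exists>n y. n \<in> N \<and> y \<in> S \<and> x = n + y" if "x \<in> V" for x
  proof (cases "x \<in> N")
    case True
    then show ?thesis using subspace_0[OF S] by force
  next
    case False
    \<comment> \<open>Enlarging the maximal \<open>N\<close> by the multiples of \<open>x\<close>
      must violate the condition on the intersection with \<open>S\<close>, so some
      \<open>n + scale r x\<close> lies in \<open>S\<close> outside the kernel of
      \<open>l\<close>.\<close>
    define X where "X = {n + scale r x | n r. n \<in> N}"
    have "subspace X"
    proof (rule subspaceI)
      show "0 \<in> X" unfolding X_def using subspace_0[OF N(1)]
        by (auto intro!: exI[of _ 0])
    next
      fix u v assume "u \<in> X" "v \<in> X"
      then obtain n r n' r' where *: "u = n + scale r x" "n \<in> N" "v = n' + scale r' x" "n' \<in> N"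
        unfolding X_def by blast
      then have "u + v = (n + n') + scale (r + r') x"
        by (simp add: scale_left_distrib)
      moreover have "n + n' \<in> N" by (rule subspace_add[OF N(1) *(2,4)])
      ultimately show "u + v \<in> X" unfolding X_def by blast
    next
      fix c u assume "u \<in> X"
      then obtain n r where *: "u = n + scale r x" "n \<in> N" unfolding X_def by blast
      then have "scale c u = scale c n + scale (c * r) x"
        by (simp add: scale_right_distrib)
      moreover have "scale c n \<in> N" by (rule subspace_scale[OF N(1) *(2)])
      ultimately show "scale c u \<in> X" unfolding X_def by blast
    qed
    moreover have "N \<subseteq> X" unfolding X_def by (force intro: exI[of _ 0])
    moreover have "X \<subseteq> V"
      unfolding X_def using N(2) V that by (auto intro!: subspace_add subspace_scale)
    moreover have "x \<in> X"
      unfolding X_def using subspace_0[OF N(1)] by (auto intro!: exI[of _ 0] exI[of _ 1])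
    ultimately have "X \<inter> S \<noteq> {x\<in>S. l x = 0}"
      using max[of X] False unfolding \<N>_def by blast
    then have "\<exists>y. y \<in> X \<and> y \<in> S \<and> l y \<noteq> 0" using \<open>N \<subseteq> X\<close> N(3) by blast
    then obtain n r where nr: "n \<in> N" "n + scale r x \<in> S" "l (n + scale r x) \<noteq> 0"
      unfolding X_def by blast
    \<comment> \<open>Otherwise \<open>kill\<close> puts \<open>scale r x\<close> into the kernel of
      \<open>l\<close>, and \<open>n\<close>, which would then lie in both \<open>N\<close> and
      \<open>S\<close>, would carry the nonzero value.\<close>
    have "\<epsilon> r \<noteq> 0"
    proof
      assume "\<epsilon> r = 0"
      then have "scale r x \<in> S" "l (scale r x) = 0" using kill that by auto
      moreover from this have "n \<in> S" using subspace_diff[OF S nr(2)] by fastforce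
      ultimately show False using nr N(3) l_add[of n "scale r x"] by auto
    qed
    then obtain r' where r': "\<epsilon> r' = 1 / \<epsilon> r" using residue_map_onto[OF \<epsilon>] by blast
    \<comment> \<open>\<open>r'\<close> inverts \<open>r\<close> modulo the kernel of
      \<open>\<epsilon>\<close>, so the defect \<open>m\<close> multiplies \<open>x\<close> into
      \<open>S\<close>. The sum of \<open>scale m x\<close> and
      \<open>scale r' (n + scale r x)\<close> lies in \<open>S\<close> and differs from
      \<open>x\<close> by an element of \<open>N\<close>.\<close>
    define m where "m = 1 - r' * r"
    have "\<epsilon> m = 0"
      using \<open>\<epsilon> r \<noteq> 0\<close> r' by (simp add: m_def residue_map_simps[OF \<epsilon>])
    then have "scale m x \<in> S" using kill that by blast
    moreover have "scale r' (n + scale r x) \<in> S" by (rule subspace_scale[OF S nr(2)])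
    ultimately have "scale m x + scale r' (n + scale r x) \<in> S" by (rule subspace_add[OF S])
    moreover have "x = scale (- r') n + (scale m x + scale r' (n + scale r x))"
      by (simp add: m_def scale_right_distrib scale_left_diff_distrib)
    moreover have "scale (- r') n \<in> N" by (rule subspace_scale[OF N(1) nr(1)])
    ultimately show ?thesis by blast
  qed
  \<comment> \<open>Two admissible choices of \<open>y\<close> differ by an element of
    \<open>N\<close> and \<open>S\<close>, that is, of the kernel of \<open>l\<close>.\<close>
  define l' where "l' x = l (SOME y. y \<in> S \<and> x - y \<in> N)" for x
  have l': "l' x = l y" if "y \<in> S" "x - y \<in> N" for x y
  proof -
    define z where "z = (SOME y. y \<in> S \<and> x - y \<in> N)"
    have z: "z \<in> S \<and> x - z \<in> N" unfolding z_def by (rule someI_ex) (use that in blast)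
    have "(x - y) - (x - z) \<in> N" by (rule subspace_diff[OF N(1)]) (use that z in auto)
    then have "z - y \<in> N \<inter> S" using subspace_diff[OF S] z that by simp
    then have "l z = l y" using N(3) l_diff[of z y] z that by simp
    then show ?thesis by (simp add: l'_def z_def)
  qed
  have "l' x = l x" if "x \<in> S" for x
    using l'[of x x] that subspace_0[OF N(1)] by simp
  moreover have "l' (x + x') = l' x + l' x'" if xV: "x \<in> V" "x' \<in> V" for x x'
  proof -
    obtain n y n' y' where *: "n \<in> N" "y \<in> S" "x = n + y" "n' \<in> N" "y' \<in> S" "x' = n' + y'"
      using ex[OF xV(1)] ex[OF xV(2)] by blast
    then have "x + x' - (y + y') = n + n'" by simp
    then have "x + x' - (y + y') \<in> N" using subspace_add[OF N(1)] * by metis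
    then have "l' (x + x') = l (y + y')" using l' subspace_add[OF S] * by blast
    moreover have "l' x = l y" "l' x' = l y'" using * by (auto intro!: l')
    ultimately show ?thesis using * l_add by simp
  qed
  moreover have "l' (scale r x) = \<epsilon> r * l' x" if xV: "x \<in> V" for r x
  proof -
    obtain n y where *: "n \<in> N" "y \<in> S" "x = n + y"
      using ex[OF xV] by blast
    then have "l' (scale r x) = l (scale r y)"
      by (intro l') (auto simp: scale_right_distrib subspace_scale[OF N(1)] subspace_scale[OF S])
    moreover have "l' x = l y" using * by (auto intro!: l')
    ultimately show ?thesis using * l_scale by simp
  qed
  ultimately show ?thesis by blast
qed

section \<open>Acyclic closures\<close>

locale acyclic_closure_alg =
  fixes \<epsilon> :: "'r::comm_ring_1 \<Rightarrow> 'k::field"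
    and F :: "('r, 'f::ring_1, 'z) gamma_alg_scheme"
  assumes residue: "residue_map \<epsilon>" and closure: "acyclic_closure \<epsilon> F"
begin

lemma dg_algebra_F: "dg_algebra F"
  using closure unfolding acyclic_closure_def by metis

sublocale F: dg_mod F
  using dg_algebra_F by (intro dg_modI) (simp add: dg_algebra_def)

lemmas \<epsilon>_simps = residue_map_simps[OF residue]

lemma gr_negative: "n < 0 \<Longrightarrow> gr F n = {0}"
  and scale_mult_left: "scl F r x * y = scl F r (x * y)"
  and scale_mult_right: "x * scl F r y = scl F r (x * y)"
  and one_in_gr: "1 \<in> gr F 0"
  and mult_in_gr: "x \<in> gr F i \<Longrightarrow> y \<in> gr F j \<Longrightarrow> x * y \<in> gr F (i + j)"
  and dif_mult: "x \<in> gr F i \<Longrightarrow> dif F (x * y) = dif F x * y + ksgn i (x * dif F y)"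
  using dg_algebra_F unfolding dg_algebra_def by metis+

lemma dif_one [simp]: "dif F 1 = 0"
  using F.dif_in_gr[OF one_in_gr] by (simp add: gr_negative)

section \<open>The monomial basis and its degrees\<close>

abbreviation monomials :: "'f set" where
  "monomials \<equiv> monomial F ` exponents F UNIV"

lemma span_monomials: "F.span monomials = UNIV"
  and independent_monomials: "F.independent monomials"
  and vars_in_gr: "vars F n \<subseteq> gr F n"
  and vars_nonpos: "n \<le> 0 \<Longrightarrow> vars F n = {}"
  using closure unfolding acyclic_closure_def by metis+

lemma monomial_nonzero: "y \<in> monomials \<Longrightarrow> y \<noteq> 0"
  using F.dependent_zero[of monomials] independent_monomials by metis

definition factor :: "('f \<Rightarrow> nat) \<Rightarrow> 'f \<Rightarrow> 'f" where
  "factor a x = (if a x = 1 then x else dp F (a x) x)"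

lemma dp_in_gr:
  assumes "i > 0" and "even i" and "x \<in> gr F i"
  shows "dp F n x \<in> gr F (int n * i)"
proof -
  have "divided_powers F" using closure unfolding acyclic_closure_def by metis
  from conjunct1[OF this[unfolded divided_powers_def], rule_format, OF assms]
  show ?thesis by (elim conjE) (erule allE)
qed

lemma factor_in_gr:
  assumes "a \<in> exponents F UNIV" and "x \<in> vars F m" and "a x \<noteq> 0"
  shows "factor a x \<in> gr F (int (a x) * m)"
proof (cases "a x = 1")
  case True
  then show ?thesis using assms(2) vars_in_gr by (auto simp: factor_def)
next
  case False
  have "m > 0" using vars_nonpos[of m] assms(2) by force
  moreover have "even m"
  proof (rule ccontr)
    assume "odd m"
    then have "a x \<le> 1" using assms(1,2) by (auto simp: exponents_def)
    then show False using False assms(3) by linarith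
  qed
  moreover have "x \<in> gr F m" using assms(2) vars_in_gr[of m] by (rule subsetD[rotated])
  ultimately have "dp F (a x) x \<in> gr F (int (a x) * m)"
    by (rule dp_in_gr)
  then show ?thesis using False by (simp add: factor_def)
qed

text \<open>Every variable has positive degree, so the degree of a product bounds both the number of
  its factors and the degree of each of them. The first bound pins down the monomials of degree 0
  and 1, the second places a monomial of degree \<open>n\<close> in the \<open>n\<close>-th
  stage.\<close>

lemma prod_factors_in_gr:
  assumes "a \<in> exponents F UNIV" and "set xs \<subseteq> {x. a x \<noteq> 0}"
  shows "\<exists>N. prod_list (map (factor a) xs) \<in> gr F N \<and> int (length xs) \<le> N \<and>
    (\<forall>x\<in>set xs. \<exists>m\<ge>1. x \<in> vars F m \<and> int (a x) * m \<le> N)"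
  using assms(2)
proof (induction xs)
  case Nil
  show ?case using one_in_gr by auto
next
  case (Cons x xs)
  then obtain N where N: "prod_list (map (factor a) xs) \<in> gr F N" "int (length xs) \<le> N"
    "\<forall>x\<in>set xs. \<exists>m\<ge>1. x \<in> vars F m \<and> int (a x) * m \<le> N"
    by auto
  have ax: "a x \<noteq> 0" using Cons.prems by simp
  then obtain m where m: "x \<in> vars F m" using assms(1) by (auto simp: exponents_def)
  have "m \<ge> 1" using vars_nonpos[of m] m by force
  then have "int (a x) * m \<ge> 1" using ax
    by (simp add: int_one_le_iff_zero_less)
  moreover have "factor a x * prod_list (map (factor a) xs) \<in> gr F (int (a x) * m + N)"
    by (rule mult_in_gr[OF factor_in_gr[OF assms(1) m ax] N(1)])
  moreover have "\<exists>m\<ge>1. y \<in> vars F m \<and> int (a y) * m \<le> int (a x) * m' + N"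
    if "y \<in> set xs" "int (a x) * m' \<ge> 0" for y m'
    using N(3) that by force
  ultimately show ?case
    using N(2) m \<open>m \<ge> 1\<close> by (intro exI[of _ "int (a x) * m + N"]) (auto intro!: exI[of _ m])
qed

lemma monomial_eq_prod:
  assumes "a \<in> exponents F UNIV"
  shows "\<exists>xs. set xs = {x. a x \<noteq> 0} \<and> monomial F a = prod_list (map (factor a) xs)"
proof -
  define xs where "xs = (SOME xs. distinct xs \<and> set xs = {x. a x \<noteq> 0})"
  have "finite {x. a x \<noteq> 0}" using assms by (simp add: exponents_def)
  then have "\<exists>xs. distinct xs \<and> set xs = {x. a x \<noteq> 0}"
    using finite_distinct_list by metis
  then have "set xs = {x. a x \<noteq> 0}"
    unfolding xs_def by (metis (mono_tags, lifting) someI_ex)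
  moreover have "monomial F a = prod_list (map (factor a) xs)"
    unfolding monomial_def xs_def factor_def[abs_def] ..
  ultimately show ?thesis by blast
qed

lemma monomial_homogeneous: "y \<in> monomials \<Longrightarrow> \<exists>N. y \<in> gr F N"
  using monomial_eq_prod prod_factors_in_gr by (metis (no_types, lifting) imageE subset_refl)

lemma monomial_in_grE:
  assumes "y \<in> monomials" and "y \<in> gr F n"
  obtains a xs where "a \<in> exponents F UNIV" "y = monomial F a" "set xs = {x. a x \<noteq> 0}"
    "y = prod_list (map (factor a) xs)" "int (length xs) \<le> n"
    "\<forall>x\<in>set xs. \<exists>m\<ge>1. x \<in> vars F m \<and> int (a x) * m \<le> n"
proof -
  obtain a where a: "a \<in> exponents F UNIV" "y = monomial F a" using assms(1) by blast
  then obtain xs where set: "set xs = {x. a x \<noteq> 0}" and y: "y = prod_list (map (factor a) xs)"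
    using monomial_eq_prod by metis
  obtain N where N: "prod_list (map (factor a) xs) \<in> gr F N" "int (length xs) \<le> N"
    "\<forall>x\<in>set xs. \<exists>m\<ge>1. x \<in> vars F m \<and> int (a x) * m \<le> N"
    using prod_factors_in_gr[OF a(1)] set by blast
  \<comment> \<open>A member of a linearly independent set is nonzero, and a nonzero element has
    only one degree.\<close>
  have "N = n"
    using F.gr_disjoint[of y N n] N(1) assms monomial_nonzero[of y] y by metis
  then show thesis using that a set y N by blast
qed

text \<open>An expansion in monomials is projected to degree \<open>n\<close>; each monomial is
  homogeneous, so the projection either keeps it or kills it.\<close>

lemma gr_eq_span: "gr F n = F.span (monomials \<inter> gr F n)"
proof
  have "F.hcomp n x \<in> F.span (monomials \<inter> gr F n)" for x
  proof -
    have "x \<in> F.span monomials" by (simp add: span_monomials)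
    then show ?thesis
    proof (induction x rule: F.span_induct)
      case base
      show ?case
        using module_hom.subspace_linear_preimage[OF F.module_hom_hcomp F.subspace_span]
        by blast
    next
      case (step y)
      then obtain N where N: "y \<in> gr F N" using monomial_homogeneous by blast
      then show ?case
        using step by (auto simp: F.hcomp_homogeneous[OF N] F.span_zero intro: F.span_base)
    qed
  qed
  then show "gr F n \<subseteq> F.span (monomials \<inter> gr F n)"
    by (metis F.hcomp_homogeneous subsetI)
  show "F.span (monomials \<inter> gr F n) \<subseteq> gr F n"
    by (rule F.span_minimal) (auto simp: F.subspace_gr)
qed

text \<open>A monomial of degree \<open>n\<close> involves only variables of degree at most
  \<open>n\<close>. Hence intersecting with the stage in \<open>tate_cycles\<close> loses nothing:
  all cycles of \<open>F\<close> of a positive degree are killed.\<close>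

lemma gr_subset_stage: "gr F n \<subseteq> stage F n"
proof -
  have "y \<in> monomial F ` exponents F {..n}" if y: "y \<in> monomials" "y \<in> gr F n" for y
  proof -
    obtain a xs where a: "a \<in> exponents F UNIV" "y = monomial F a" "set xs = {x. a x \<noteq> 0}"
      "y = prod_list (map (factor a) xs)" "int (length xs) \<le> n"
      and vars: "\<forall>x\<in>set xs. \<exists>m\<ge>1. x \<in> vars F m \<and> int (a x) * m \<le> n"
      by (rule monomial_in_grE[OF y]) (rule that)
    have "x \<in> (\<Union>m\<in>{..n}. vars F m)" if "a x \<noteq> 0" for x
    proof -
      have "x \<in> set xs" using a(3) that by simp
      with vars obtain m where m: "m \<ge> 1" "x \<in> vars F m" "int (a x) * m \<le> n"
        by blast
      have "1 * m \<le> int (a x) * m" by (rule mult_right_mono) (use m that in auto)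
      then have "m \<le> n" using m(3) by linarith
      then show ?thesis using m(2) by auto
    qed
    then have "a \<in> exponents F {..n}" using a(1) by (auto simp: exponents_def)
    then show ?thesis using a(2) by blast
  qed
  then show ?thesis
    unfolding stage_def by (subst gr_eq_span) (auto intro!: F.span_mono)
qed

lemma monomials_gr_0: "monomials \<inter> gr F 0 \<subseteq> {1}"
proof
  fix y assume "y \<in> monomials \<inter> gr F 0"
  then have y: "y \<in> monomials" "y \<in> gr F 0" by auto
  show "y \<in> {1}"
    by (rule monomial_in_grE[OF y]) auto
qed

text \<open>The empty product has degree 0, and two factors already have degree at least 2; a single
  factor of degree 1 is a variable of degree 1 with exponent 1.\<close>

lemma monomials_gr_1: "monomials \<inter> gr F 1 \<subseteq> vars F 1"
proof
  fix y assume "y \<in> monomials \<inter> gr F 1"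
  then have y: "y \<in> monomials" "y \<in> gr F 1" by auto
  obtain a xs where "a \<in> exponents F UNIV" "y = monomial F a" and set: "set xs = {x. a x \<noteq> 0}"
    and prod: "y = prod_list (map (factor a) xs)" and len: "int (length xs) \<le> 1"
    and vars: "\<forall>x\<in>set xs. \<exists>m\<ge>1. x \<in> vars F m \<and> int (a x) * m \<le> 1"
    by (rule monomial_in_grE[OF y]) (rule that)
  have "xs \<noteq> []"
  proof
    assume "xs = []"
    then have "y \<in> gr F 0" using prod one_in_gr by simp
    then show False using F.gr_disjoint[of y 0 1] y monomial_nonzero by auto
  qed
  then obtain x where x: "xs = [x]" using len by (cases xs) auto
  then obtain m where m: "m \<ge> 1" "x \<in> vars F m" "int (a x) * m \<le> 1" using vars by auto
  have "a x \<ge> 1" using set x by auto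
  have "int (a x) * 1 \<le> int (a x) * m" by (rule mult_left_mono) (use m in auto)
  then have "a x = 1" using m(3) \<open>a x \<ge> 1\<close> by linarith
  then show "y \<in> vars F 1" using m x prod by (simp add: factor_def)
qed

lemma one_in_monomials: "1 \<in> monomials"
proof -
  have "(SOME xs :: 'f list. distinct xs \<and> xs = []) = []"
    by (rule some_equality) auto
  then have "monomial F (\<lambda>_. 0) = 1" by (simp add: monomial_def)
  moreover have "(\<lambda>_. 0) \<in> exponents F UNIV" by (simp add: exponents_def)
  ultimately show ?thesis by (metis image_eqI)
qed

text \<open>\<open>1\<close> is the monomial with zero exponents, hence part of a linearly
  independent set. The coefficient of an element of degree 0 can thus be read off, as the
  construction of the augmentation requires.\<close>

lemma scale_one_inj: "scl F r 1 = scl F r' 1 \<longleftrightarrow> r = r'"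
proof
  assume "scl F r 1 = scl F r' 1"
  then have "(\<Sum>v\<in>{1}. scl F (r - r') v) = 0" by (simp add: F.scale_left_diff_distrib)
  then have "r - r' = 0"
    using F.independentD[OF independent_monomials, of "{1}" "\<lambda>_. r - r'" 1] one_in_monomials
    by simp
  then show "r = r'" by simp
qed simp

lemma gr_0E:
  assumes "x \<in> gr F 0"
  obtains r where "x = scl F r 1"
proof -
  have "x \<in> F.span {1}"
    using assms F.span_mono[OF monomials_gr_0] gr_eq_span[of 0] by blast
  then show thesis using that by (auto simp: F.span_singleton)
qed

section \<open>The augmentation of the acyclic closure\<close>

abbreviation aug :: "'f \<Rightarrow> 'k" where
  "aug \<equiv> augmentation \<epsilon> F"

text \<open>The definite description is realised by applying \<open>\<epsilon>\<close> to the
  coefficient of the component of degree 0. It is unique because the multiples of \<open>1\<close>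
  exhaust degree 0 and homogeneous elements generate \<open>F\<close> additively.\<close>

lemma augmentation_char: "additive aug \<and> (\<forall>r. aug (scl F r 1) = \<epsilon> r) \<and>
  (\<forall>n. n \<noteq> 0 \<longrightarrow> (\<forall>x\<in>gr F n. aug x = 0))"
proof -
  let ?P = "\<lambda>h. additive h \<and> (\<forall>r. h (scl F r 1) = \<epsilon> r) \<and>
    (\<forall>n. n \<noteq> 0 \<longrightarrow> (\<forall>x\<in>gr F n. h x = 0))"
  define h where "h x = \<epsilon> (SOME r. F.hcomp 0 x = scl F r 1)" for x
  have h: "h x = \<epsilon> r" if "F.hcomp 0 x = scl F r 1" for x r
    using that by (simp add: h_def scale_one_inj)
  have "additive h"
  proof
    fix x y
    obtain r r' where "F.hcomp 0 x = scl F r 1" "F.hcomp 0 y = scl F r' 1"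
      using gr_0E[OF F.hcomp_in_gr] by metis
    moreover from this have "F.hcomp 0 (x + y) = scl F (r + r') 1"
      by (simp add: F.hcomp_add F.scale_left_distrib)
    ultimately show "h (x + y) = h x + h y" by (simp add: h \<epsilon>_simps)
  qed
  moreover have "h (scl F r 1) = \<epsilon> r" for r
    by (rule h) (simp add: F.hcomp_homogeneous[OF F.gr_scale[OF one_in_gr]])
  moreover have "h x = 0" if "n \<noteq> 0" "x \<in> gr F n" for n x
    using h[of x 0] that by (simp add: F.hcomp_homogeneous[OF that(2)] \<epsilon>_simps)
  ultimately have h: "?P h" by blast
  have "h' = h" if h': "?P h'" for h'
  proof
    fix x show "h' x = h x"
    proof (rule F.additive_eqI)
      show "additive h'" "additive h" using h h' by simp_all
    next
      fix n y assume y: "y \<in> gr F n"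
      show "h' y = h y"
      proof (cases "n = 0")
        case True
        then obtain r where "y = scl F r 1" using y gr_0E by blast
        then show ?thesis using h h' by metis
      next
        case False
        then show ?thesis using h h' y by metis
      qed
    qed
  qed
  with h have "\<exists>!h. ?P h" by (rule ex1I)
  from theI'[OF this] show ?thesis unfolding augmentation_def .
qed

lemma additive_aug: "additive aug"
  and aug_scale_one: "aug (scl F r 1) = \<epsilon> r"
  and aug_gr: "x \<in> gr F n \<Longrightarrow> n \<noteq> 0 \<Longrightarrow> aug x = 0"
  using augmentation_char by auto

lemmas aug_add = additive.add[OF additive_aug]
  and aug_zero [simp] = additive.zero[OF additive_aug]
  and aug_diff = additive.diff[OF additive_aug]
  and aug_ksgn = ksgn_additive[OF additive_aug]

lemma aug_one [simp]: "aug 1 = 1"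
  using aug_scale_one[of 1] by (simp add: \<epsilon>_simps)

lemma aug_scale: "aug (scl F r x) = \<epsilon> r * aug x"
proof (induction x rule: F.homogeneous_induct)
  case (homogeneous n x)
  show ?case
  proof (cases "n = 0")
    case True
    then obtain r' where "x = scl F r' 1" using homogeneous gr_0E by blast
    then show ?thesis by (simp add: aug_scale_one \<epsilon>_simps)
  next
    case False
    then show ?thesis
      by (simp add: aug_gr[OF homogeneous] aug_gr[OF F.gr_scale[OF homogeneous]])
  qed
qed (simp_all add: F.scale_right_distrib aug_add distrib_left)

text \<open>If \<open>x\<close> has nonzero degree, \<open>aug x\<close> vanishes, and so does
  \<open>aug (x * y)\<close> unless the degrees are opposite; in that case one factor has negative
  degree and is 0.\<close>

lemma aug_mult: "aug (x * y) = aug x * aug y"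
proof (induction x rule: F.homogeneous_induct)
  case (homogeneous i x)
  show ?case
  proof (cases "i = 0")
    case True
    then obtain r where "x = scl F r 1" using homogeneous gr_0E by blast
    then show ?thesis by (simp add: aug_scale_one scale_mult_left aug_scale)
  next
    case i: False
    show ?thesis
    proof (induction y rule: F.homogeneous_induct)
      case (homogeneous j y)
      show ?case
      proof (cases "i + j = 0")
        case True
        then have "i < 0 \<or> j < 0" using i by linarith
        then have "x = 0 \<or> y = 0"
          using homogeneous \<open>x \<in> gr F i\<close> gr_negative[of i] gr_negative[of j] by auto
        then show ?thesis by auto
      next
        case False
        then have "aug (x * y) = 0" using aug_gr mult_in_gr homogeneous \<open>x \<in> gr F i\<close> by blast
        then show ?thesis using i \<open>x \<in> gr F i\<close> by (simp add: aug_gr)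
      qed
    qed (simp_all add: aug_add distrib_left)
  qed
qed (simp_all add: aug_add distrib_right)

section \<open>Exactness of the augmented acyclic closure\<close>

lemma tate_generates: "n \<ge> 0 \<Longrightarrow> tate_generates \<epsilon> F n (vars F (n + 1))"
  using closure unfolding acyclic_closure_def by metis

text \<open>Only boundaries of elements of degree 1 can have degree 0. That degree is spanned by
  variables, and their boundaries lie in the kernel of \<open>\<epsilon>\<close> by the Tate
  condition in degree 0.\<close>

lemma aug_dif [simp]: "aug (dif F x) = 0"
proof (induction x rule: F.homogeneous_induct)
  case (homogeneous n x)
  show ?case
  proof (cases "n = 1")
    case True
    have "aug (dif F y) = 0" if "y \<in> vars F 1" for y
    proof -
      have "dif F y \<in> tate_cycles \<epsilon> F 0"
        using tate_generates[of 0] that unfolding tate_generates_def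
        by (auto intro: F.span_base)
      then show ?thesis by (auto simp: tate_cycles_def aug_scale_one)
    qed
    then have base: "aug (dif F y) = 0" if "y \<in> monomials \<inter> gr F 1" for y
      using that monomials_gr_1 by blast
    have "x \<in> F.span (monomials \<inter> gr F 1)" using homogeneous True gr_eq_span by blast
    then show ?thesis
      by (induction x rule: F.span_induct)
        (auto simp: base F.subspace_def F.dif_add F.dif_scale aug_add aug_scale)
  next
    case False
    then show ?thesis using aug_gr[OF F.dif_in_gr[OF homogeneous]] by simp
  qed
qed (simp_all add: F.dif_add aug_add)

text \<open>The Tate condition in degree \<open>m\<close> kills all cycles, because the stage
  contains the whole of degree \<open>m\<close>; in degree 0 the condition \<open>aug x = 0\<close>
  singles out the multiples of \<open>1\<close> that are killed. For \<open>m \<ge> 0\<close> the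
  primitive has positive degree, so its augmentation vanishes as well, and the kernel of
  \<open>aug\<close> is exact in every degree.\<close>

lemma acyclic:
  assumes "x \<in> gr F m" and "dif F x = 0" and "aug x = 0"
  shows "\<exists>y\<in>gr F (m + 1). dif F y = x \<and> aug y = 0"
proof (cases "m < 0")
  case True
  then have "x = 0" using assms(1) gr_negative by auto
  then show ?thesis by (intro bexI[of _ 0]) simp_all
next
  case False
  have "x \<in> tate_cycles \<epsilon> F m"
  proof (cases "m = 0")
    case True
    then obtain r where "x = scl F r 1" using assms(1) gr_0E by blast
    then show ?thesis using True assms(3) by (auto simp: tate_cycles_def aug_scale_one)
  next
    case False
    then show ?thesis using assms gr_subset_stage by (auto simp: tate_cycles_def)
  qed
  moreover have "tate_cycles \<epsilon> F m \<subseteq> dif F ` gr F (m + 1)"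
    using tate_generates[of m] False vars_in_gr[of "m + 1"]
      module_hom.subspace_image[OF F.module_hom_dif F.subspace_gr, of "m + 1"]
    unfolding tate_generates_def by (metis F.span_minimal Int_lower1 Un_least image_mono not_less)
  ultimately obtain y where "y \<in> gr F (m + 1)" "dif F y = x" by blast
  moreover from this have "aug y = 0" using False by (auto intro: aug_gr)
  ultimately show ?thesis by blast
qed

end

section \<open>Free complexes\<close>

locale free_dg_mod = dg_mod +
  assumes bounded: "n < 0 \<Longrightarrow> gr A n = {0}"
    and free: "\<exists>B. independent B \<and> span B = gr A n"
begin

definition basis :: "int \<Rightarrow> 'b set" where
  "basis n = (SOME B. independent B \<and> span B = gr A n)"

lemma independent_basis: "independent (basis n)"
  and span_basis: "span (basis n) = gr A n"
proof -
  have "independent (basis n) \<and> span (basis n) = gr A n"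
    unfolding basis_def by (rule someI_ex[OF free])
  then show "independent (basis n)" "span (basis n) = gr A n" by simp_all
qed

lemma basis_in_gr: "b \<in> basis n \<Longrightarrow> b \<in> gr A n"
  using span_basis span_base by blast

lemma gr_subset: "subspace S \<Longrightarrow> basis n \<subseteq> S \<Longrightarrow> gr A n \<subseteq> S"
  using span_minimal[of "basis n" S] by (simp add: span_basis)

lemma hom_eq_on_gr:
  assumes "module_hom (scl A) s f" "module_hom (scl A) s h" and "\<And>b. b \<in> basis n \<Longrightarrow> f b = h b"
    and "x \<in> gr A n"
  shows "f x = h x"
proof -
  interpret f: module_hom "scl A" s f by fact
  interpret h: module_hom "scl A" s h by fact
  have "subspace {x. f x = h x}"
    by (auto intro!: subspaceI simp: f.add h.add f.scale h.scale)
  then show ?thesis using gr_subset[of "{x. f x = h x}" n] assms(3,4) by blast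
qed

text \<open>\<open>representation\<close> is linear only on the span of the basis, so the projection
  \<open>hcomp n\<close> is applied before coordinates are taken.\<close>

lemma ex_hom_on_basis:
  fixes s :: "'a \<Rightarrow> 'd::ab_group_add \<Rightarrow> 'd"
  assumes "module s"
  shows "\<exists>h. module_hom (scl A) s h \<and> (\<forall>b\<in>basis n. h b = v b)"
proof -
  interpret X: module s by fact
  let ?R = "representation (basis n)"
  define h where "h x = (\<Sum>b | ?R (hcomp n x) b \<noteq> 0. s (?R (hcomp n x) b) (v b))" for x
  have h: "h x = (\<Sum>b\<in>S. s (?R (hcomp n x) b) (v b))"
    if "finite S" "{b. ?R (hcomp n x) b \<noteq> 0} \<subseteq> S" for S x
    unfolding h_def by (rule sum.mono_neutral_left) (use that in auto)
  have span: "hcomp n x \<in> span (basis n)" for x by (simp add: span_basis hcomp_in_gr)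
  note fin = finite_representation[of "basis n"]
  have "module_hom (scl A) s h"
  proof (rule module_homI[OF module_axioms assms])
    fix x y
    let ?S = "{b. ?R (hcomp n x) b \<noteq> 0} \<union> {b. ?R (hcomp n y) b \<noteq> 0} \<union> {b. ?R (hcomp n (x + y)) b \<noteq> 0}"
    have "finite ?S" by (simp add: fin)
    then show "h (x + y) = h x + h y"
      by (subst (1 2 3) h[of ?S])
        (auto simp: hcomp_add representation_add[OF independent_basis span span] sum.distrib
          X.scale_left_distrib)
  next
    fix r x
    let ?S = "{b. ?R (hcomp n x) b \<noteq> 0} \<union> {b. ?R (hcomp n (scl A r x)) b \<noteq> 0}"
    have "finite ?S" by (simp add: fin)
    then show "h (scl A r x) = s r (h x)"
      by (subst (1 2) h[of ?S])
        (auto simp: hcomp_scale representation_scale[OF independent_basis span] X.scale_sum_right)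
  qed
  moreover have "h b = v b" if "b \<in> basis n" for b
  proof -
    have "?R b = (\<lambda>c. if c = b then 1 else 0)"
      by (rule representation_basis[OF independent_basis that])
    then show ?thesis
      using h[of "{b}" b] by (auto simp: hcomp_homogeneous[OF basis_in_gr[OF that]])
  qed
  ultimately show ?thesis by blast
qed

lemma ex_hom_on_basis_degree:
  fixes s :: "'a \<Rightarrow> 'd::ab_group_add \<Rightarrow> 'd"
  assumes "module s"
  shows "\<exists>h. module_hom (scl A) s h \<and> (\<forall>b\<in>basis n. h b = v b) \<and> (\<forall>m. m \<noteq> n \<longrightarrow> (\<forall>x\<in>gr A m. h x = 0))"
proof -
  obtain h where h: "module_hom (scl A) s h" "\<forall>b\<in>basis n. h b = v b"
    using ex_hom_on_basis[OF assms] by blast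
  then have "module_hom (scl A) s (\<lambda>x. h (hcomp n x))"
    by (auto simp: module_hom_iff hcomp_add hcomp_scale)
  moreover have "h (hcomp n b) = v b" if "b \<in> basis n" for b
    using h(2) that by (simp add: hcomp_homogeneous[OF basis_in_gr[OF that]])
  moreover have "h (hcomp n x) = 0" if "m \<noteq> n" "x \<in> gr A m" for m x
    using that module_hom.zero[OF h(1)] by (simp add: hcomp_homogeneous[OF that(2)])
  ultimately show ?thesis by blast
qed

end


section \<open>Lifting along the augmentation\<close>

locale free_and_closure = acyclic_closure_alg \<epsilon> F + G: free_dg_mod G
  for \<epsilon> :: "'r::comm_ring_1 \<Rightarrow> 'k::field"
    and F :: "('r, 'f::ring_1, 'z) gamma_alg_scheme"
    and G :: "('r, 'g::ab_group_add, 'y) dgmod_scheme"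
begin

sublocale Hom: hom_complex G F ..

text \<open>One step of lifting against an exact complex: primitives of the values of
  \<open>\<zeta>\<close> are chosen on a basis, and the required properties are linear, so they pass
  to the whole degree.\<close>

lemma ex_lift_dif:
  assumes "module_hom (scl G) (scl F) \<zeta>"
    and "\<And>x. x \<in> gr G i \<Longrightarrow> \<zeta> x \<in> gr F m \<and> dif F (\<zeta> x) = 0 \<and> aug (\<zeta> x) = 0"
  shows "\<exists>h. module_hom (scl G) (scl F) h \<and>
    (\<forall>x\<in>gr G i. h x \<in> gr F (m + 1) \<and> aug (h x) = 0 \<and> dif F (h x) = \<zeta> x)"
proof -
  have "\<forall>b\<in>G.basis i. \<exists>y. y \<in> gr F (m + 1) \<and> aug y = 0 \<and> dif F y = \<zeta> b"
    using acyclic assms(2) G.basis_in_gr by blast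
  then obtain v where v:
    "\<And>b. b \<in> G.basis i \<Longrightarrow> v b \<in> gr F (m + 1) \<and> aug (v b) = 0 \<and> dif F (v b) = \<zeta> b"
    by metis
  obtain h where h: "module_hom (scl G) (scl F) h" "\<forall>b\<in>G.basis i. h b = v b"
    using G.ex_hom_on_basis[OF F.module_axioms] by blast
  let ?S = "{x. h x \<in> gr F (m + 1) \<and> aug (h x) = 0 \<and> dif F (h x) = \<zeta> x}"
  have "G.subspace ?S"
    by (rule G.subspaceI)
      (auto simp: module_hom.zero[OF h(1)] module_hom.zero[OF assms(1)] module_hom.add[OF h(1)]
        module_hom.add[OF assms(1)] module_hom.scale[OF h(1)] module_hom.scale[OF assms(1)]
        F.gr_add F.gr_scale aug_add aug_scale F.dif_add F.dif_scale)
  moreover have "G.basis i \<subseteq> ?S" using v h(2) by auto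
  ultimately show ?thesis using G.gr_subset[of ?S i] h(1) by blast
qed

text \<open>A cocycle with values in the exact complex formed by the kernel of \<open>aug\<close> is
  a coboundary, since \<open>G\<close> is free and bounded below. The homotopy is built by recursion
  on the degree in \<open>G\<close>.\<close>

lemma ex_homotopy:
  assumes \<alpha>: "\<alpha> \<in> hom_gr G F e" and closed: "hom_dif G F e \<alpha> = 0" and aug: "\<And>x. aug (\<alpha> x) = 0"
  shows "\<exists>h\<in>hom_gr G F (e + 1). (\<forall>x. aug (h x) = 0) \<and> hom_dif G F (e + 1) h = \<alpha>"
proof -
  have hom: "module_hom (scl G) (scl F) \<alpha>" and deg: "\<And>n x. x \<in> gr G n \<Longrightarrow> \<alpha> x \<in> gr F (n + e)"
    using \<alpha> by (auto simp: hom_gr_def)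
  have dif: "dif F (\<alpha> x) = ksgn e (\<alpha> (dif G x))" for x
    using fun_cong[OF closed, of x] by (simp add: hom_dif_def)
  \<comment> \<open>On cycles the homotopy equation involves no other degree. Applied to the cycle
    \<open>dif G x\<close>, it makes the right-hand side of the next equation a cycle, as
    \<open>\<alpha>\<close> is closed.\<close>
  define P where "P n h \<longleftrightarrow> module_hom (scl G) (scl F) h \<and> (\<forall>x\<in>gr G (int n).
      h x \<in> gr F (int n + e + 1) \<and> aug (h x) = 0 \<and> (dif G x = 0 \<longrightarrow> dif F (h x) = \<alpha> x))" for n h
  \<comment> \<open>This is \<open>hom_dif G F (e + 1) h = \<alpha>\<close> on degree
    \<open>n + 1\<close>, solved for the differential of the new component.\<close>
  define Q where "Q n h h' \<longleftrightarrow> (\<forall>x\<in>gr G (int (Suc n)).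
      dif F (h' x) = \<alpha> x + ksgn (e + 1) (h (dif G x)))" for n h h'
  have "\<exists>H. \<forall>n. P n (H n) \<and> Q n (H n) (H (Suc n))"
  proof (rule dependent_nat_choice)
    have "dif G x = 0" if "x \<in> gr G 0" for x
      using G.dif_in_gr[OF that] by (simp add: G.bounded)
    then show "\<exists>h. P 0 h"
      using ex_lift_dif[OF hom, of 0 e] deg[of _ 0] aug
      by (auto simp: P_def dif module_hom.zero[OF hom])
  next
    fix n h assume "P n h"
    then have h: "module_hom (scl G) (scl F) h"
      and h': "\<And>x. x \<in> gr G (int n) \<Longrightarrow> h x \<in> gr F (int n + e + 1) \<and> aug (h x) = 0 \<and>
        (dif G x = 0 \<longrightarrow> dif F (h x) = \<alpha> x)"
      by (auto simp: P_def)
    let ?\<zeta> = "\<lambda>x. \<alpha> x + ksgn (e + 1) (h (dif G x))"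
    have "module_hom (scl G) (scl F) ?\<zeta>"
      by (rule module_homI[OF G.module_axioms F.module_axioms])
        (simp_all add: module_hom.add[OF hom] module_hom.scale[OF hom] module_hom.add[OF h]
          module_hom.scale[OF h] G.dif_add G.dif_scale ksgn_def F.scale_right_diff_distrib
          F.scale_right_distrib)
    moreover have "?\<zeta> x \<in> gr F (int n + e + 1) \<and> dif F (?\<zeta> x) = 0 \<and> aug (?\<zeta> x) = 0"
      if x: "x \<in> gr G (int (Suc n))" for x
    proof -
      have "dif G x \<in> gr G (int n)" using G.dif_in_gr[OF x] by simp
      note * = h'[OF this]
      have "\<alpha> x \<in> gr F (int n + e + 1)" using deg[OF x] by (simp add: ac_simps)
      then show ?thesis
        using * by (auto simp: F.gr_diff F.gr_ksgn F.dif_diff F.dif_ksgn dif ksgn_one_plus aug_diff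
            aug_ksgn aug)
    qed
    ultimately obtain h'' where "module_hom (scl G) (scl F) h''"
      "\<forall>x\<in>gr G (int (Suc n)). h'' x \<in> gr F (int n + e + 1 + 1) \<and> aug (h'' x) = 0 \<and> dif F (h'' x) = ?\<zeta> x"
      using ex_lift_dif[of ?\<zeta> "int (Suc n)" "int n + e + 1"] by blast
    then have "P (Suc n) h'' \<and> Q n h h''"
      by (auto simp: P_def Q_def module_hom.zero[OF h] algebra_simps)
    then show "\<exists>h'. P (Suc n) h' \<and> Q n h h'" by blast
  qed
  then obtain H where H: "\<And>n. P n (H n)" "\<And>n. Q n (H n) (H (Suc n))" by blast
  have "module_hom (scl G) (scl F) (H (nat n))" for n
    using H(1)[of "nat n"] by (simp add: P_def)
  from G.ex_module_hom_on_components[where h = "\<lambda>n. H (nat n)", OF this]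
  obtain h where h: "module_hom (scl G) (scl F) h"
    and h_eq: "\<And>n x. x \<in> gr G n \<Longrightarrow> h x = H (nat n) x" by blast
  have h_n: "h x \<in> gr F (n + e + 1) \<and> aug (h x) = 0 \<and>
      dif F (h x) - ksgn (e + 1) (h (dif G x)) = \<alpha> x" if x: "x \<in> gr G n" for n x
  proof (cases "n < 0")
    case True
    then show ?thesis using x
      by (simp add: G.bounded module_hom.zero[OF h] module_hom.zero[OF hom])
  next
    case False
    have 1: "h x \<in> gr F (n + e + 1) \<and> aug (h x) = 0"
      using H(1)[of "nat n"] x False by (simp add: P_def h_eq[OF x])
    have "dif F (h x) - ksgn (e + 1) (h (dif G x)) = \<alpha> x"
    proof (cases "n = 0")
      case True
      then have "dif G x = 0" using G.dif_in_gr[OF x] by (simp add: G.bounded)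
      then show ?thesis
        using H(1)[of 0] x True by (simp add: P_def h_eq[OF x] module_hom.zero[OF h])
    next
      case n: False
      define k where "k = nat (n - 1)"
      have k: "n = int (Suc k)" using False n by (simp add: k_def)
      then have "dif G x \<in> gr G (int k)" using G.dif_in_gr[OF x] by simp
      then show ?thesis
        using H(2)[of k] x by (simp add: Q_def h_eq[OF x] h_eq k nat_add_distrib)
    qed
    with 1 show ?thesis by blast
  qed
  have "h \<in> hom_gr G F (e + 1)"
    using h h_n by (auto simp: hom_gr_def add.assoc)
  moreover have "aug (h x) = 0" for x
    by (induction x rule: G.homogeneous_induct)
      (use h_n in \<open>auto simp: module_hom.zero[OF h] module_hom.add[OF h] aug_add\<close>)
  moreover have "hom_dif G F (e + 1) h x = \<alpha> x" for x
    unfolding hom_dif_def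
    by (induction x rule: G.homogeneous_induct)
      (use h_n in \<open>auto simp: module_hom.zero[OF h] module_hom.add[OF h] module_hom.zero[OF hom]
        module_hom.add[OF hom] F.dif_add G.dif_add ksgn_add add_diff_add\<close>)
  ultimately show ?thesis by blast
qed

text \<open>As \<open>\<gamma>\<close> lives in degree \<open>n\<close> only, basis values can be
  lifted to multiples of \<open>1\<close>, which have degree 0. The lift is merely graded;
  compatibility with the differentials is arranged later by \<open>ex_homotopy\<close>.\<close>

lemma ex_aug_lift:
  assumes \<gamma>: "module_hom (scl G) (\<lambda>r c. \<epsilon> r * c) \<gamma>"
    and deg: "\<And>m x. x \<in> gr G m \<Longrightarrow> m \<noteq> n \<Longrightarrow> \<gamma> x = 0"
  shows "\<exists>\<beta>\<in>hom_gr G F (- n). \<forall>x. aug (\<beta> x) = \<gamma> x"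
proof -
  have "\<forall>b. \<exists>r. \<epsilon> r = \<gamma> b" using residue_map_onto[OF residue] by blast
  then obtain v where v: "\<And>b. \<epsilon> (v b) = \<gamma> b" by metis
  obtain \<beta> where \<beta>: "module_hom (scl G) (scl F) \<beta>" "\<And>b. b \<in> G.basis n \<Longrightarrow> \<beta> b = scl F (v b) 1"
    "\<And>m x. m \<noteq> n \<Longrightarrow> x \<in> gr G m \<Longrightarrow> \<beta> x = 0"
    using G.ex_hom_on_basis_degree[OF F.module_axioms, of n "\<lambda>b. scl F (v b) 1"] by metis
  have "module_hom (scl G) (\<lambda>r c. \<epsilon> r * c) (\<lambda>x. aug (\<beta> x))"
    by (rule module_homI[OF G.module_axioms module_residue[OF residue]])
      (simp_all add: module_hom.add[OF \<beta>(1)] module_hom.scale[OF \<beta>(1)] aug_add aug_scale)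
  then have n: "aug (\<beta> x) = \<gamma> x" if "x \<in> gr G n" for x
    by (rule G.hom_eq_on_gr[OF _ \<gamma> _ that]) (simp add: \<beta>(2) aug_scale_one v)
  have "\<beta> x \<in> gr F 0" if "x \<in> gr G n" for x
  proof -
    have "G.subspace {x. \<beta> x \<in> gr F 0}"
      using module_hom.subspace_linear_preimage[OF \<beta>(1) F.subspace_gr] .
    moreover have "G.basis n \<subseteq> {x. \<beta> x \<in> gr F 0}"
      by (auto simp: \<beta>(2) F.gr_scale one_in_gr)
    ultimately show ?thesis using G.gr_subset that by blast
  qed
  then have "\<beta> x \<in> gr F (m + - n)" if "x \<in> gr G m" for m x
    using that \<beta>(3)[of m x] by (cases "m = n") auto
  then have "\<beta> \<in> hom_gr G F (- n)" using \<beta>(1) by (auto simp: hom_gr_def)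
  moreover have "aug (\<beta> x) = \<gamma> x" for x
  proof (rule G.additive_eqI)
    show "additive (\<lambda>x. aug (\<beta> x))"
      by (simp add: additive_def module_hom.add[OF \<beta>(1)] aug_add)
    show "additive \<gamma>" by (rule module_hom_additive[OF \<gamma>])
    show "aug (\<beta> x) = \<gamma> x" if "x \<in> gr G m" for m x
      using n[of x] deg[OF that] \<beta>(3)[of m x] that by (cases "m = n") auto
  qed
  ultimately show ?thesis by blast
qed

end

section \<open>The complex \<open>G \<otimes> F\<close>\<close>

locale tensor_setting = free_and_closure \<epsilon> F G + tensor_product "scl G" "scl F" sT tens
  for \<epsilon> :: "'r::comm_ring_1 \<Rightarrow> 'k::field"
    and F :: "('r, 'f::ring_1, 'z) gamma_alg_scheme"
    and G :: "('r, 'g::ab_group_add, 'y) dgmod_scheme"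
    and sT :: "'r \<Rightarrow> 't::ab_group_add \<Rightarrow> 't"
    and tens :: "'g \<Rightarrow> 'f \<Rightarrow> 't"
begin

abbreviation GF :: "('r, 't) dgmod" where
  "GF \<equiv> tens_cplx G F sT tens"

lemma scl_GF [simp]: "scl GF = sT"
  by (simp add: tens_cplx_def)

lemma gr_GF: "gr GF n = T.span {tens g f | g f i j. g \<in> gr G i \<and> f \<in> gr F j \<and> i + j = n}"
  by (simp add: tens_cplx_def)

lemma subspace_gr_GF: "T.subspace (gr GF n)"
  by (simp add: gr_GF)

lemma tens_in_gr: "g \<in> gr G i \<Longrightarrow> f \<in> gr F j \<Longrightarrow> tens g f \<in> gr GF (i + j)"
  unfolding gr_GF by (rule T.span_base) blast

lemma gr_GF_subset:
  assumes "T.subspace S"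
    and "\<And>g f i j. g \<in> gr G i \<Longrightarrow> f \<in> gr F j \<Longrightarrow> i + j = n \<Longrightarrow> tens g f \<in> S"
  shows "gr GF n \<subseteq> S"
  unfolding gr_GF by (rule T.span_minimal) (use assms in auto)

text \<open>The Koszul signs in the differential and in the derivation action depend on the degree
  of the left factor, so those formulas are available only for homogeneous \<open>g\<close>.\<close>

lemma tensor_eqI_homogeneous:
  assumes "additive \<phi>" "additive \<psi>"
    and "\<And>i g f. g \<in> gr G i \<Longrightarrow> \<phi> (tens g f) = \<psi> (tens g f)"
  shows "\<phi> = \<psi>"
proof (rule tensor_eqI[OF assms(1,2)])
  fix g f
  show "\<phi> (tens g f) = \<psi> (tens g f)"
    by (rule G.additive_eqI[where f = "\<lambda>g. \<phi> (tens g f)"])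
      (use assms in \<open>auto simp: additive_def tens_add_left\<close>)
qed

lemma dif_GF_char: "module_hom sT sT (dif GF) \<and> (\<forall>i. \<forall>g\<in>gr G i. \<forall>f.
  dif GF (tens g f) = tens (dif G g) f + ksgn i (tens g (dif F f)))"
proof -
  let ?P = "\<lambda>D. additive D \<and> (\<forall>i. \<forall>g\<in>gr G i. \<forall>f.
       D (tens g f) = tens (dif G g) f + ksgn i (tens g (dif F f)))"
  \<comment> \<open>The sign is absorbed into the linear map \<open>\<sigma>\<close>, which is
    \<open>ksgn n\<close> on degree \<open>n\<close>; this turns the formula for the differential
    into a bilinear one to which the universal property applies.\<close>
  obtain \<sigma> where \<sigma>: "module_hom (scl G) (scl G) \<sigma>" "\<And>n x. x \<in> gr G n \<Longrightarrow> \<sigma> x = ksgn n x"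
    using G.ex_module_hom_on_components[where h = ksgn and s = "scl G"]
      module_hom_ksgn[OF module.module_hom_ident[OF G.module_axioms]] by blast
  have "\<exists>D. module_hom sT sT D \<and> (\<forall>g f. D (tens g f) = tens (dif G g) f + tens (\<sigma> g) (dif F f))"
    by (rule ex_tensor_lift; rule module_homI)
      (simp_all add: G.module_axioms F.module_axioms T.module_axioms G.dif_add F.dif_add G.dif_scale
        F.dif_scale tens_add_left tens_add_right tens_scale_left tens_scale_right
        T.scale_right_distrib module_hom.add[OF \<sigma>(1)] module_hom.scale[OF \<sigma>(1)])
  then obtain D where D: "module_hom sT sT D"
    "\<And>g f. D (tens g f) = tens (dif G g) f + tens (\<sigma> g) (dif F f)" by blast
  have "?P D" using module_hom_additive[OF D(1)] by (auto simp: D(2) \<sigma>(2) tens_ksgn_left)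
  moreover have "E = D" if "?P E" for E
    by (rule tensor_eqI_homogeneous) (use that \<open>?P D\<close> in auto)
  ultimately have "(THE D. ?P D) = D" by (rule the_equality)
  then have "dif GF = D" by (simp add: tens_cplx_def)
  then show ?thesis using D(1) \<open>?P D\<close> by simp
qed

lemma module_hom_dif_GF: "module_hom sT sT (dif GF)"
  and dif_tens: "g \<in> gr G i \<Longrightarrow>
    dif GF (tens g f) = tens (dif G g) f + ksgn i (tens g (dif F f))"
  using dif_GF_char by auto

lemmas dif_GF_zero [simp] = module_hom.zero[OF module_hom_dif_GF]
  and dif_GF_add = module_hom.add[OF module_hom_dif_GF]
  and dif_GF_diff = module_hom.diff[OF module_hom_dif_GF]
  and dif_GF_scale = module_hom.scale[OF module_hom_dif_GF]
  and dif_GF_sum = module_hom.sum[OF module_hom_dif_GF]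
  and dif_GF_ksgn = ksgn_additive[OF module_hom_additive[OF module_hom_dif_GF]]

lemma dif_GF_in_gr: "x \<in> gr GF n \<Longrightarrow> dif GF x \<in> gr GF (n - 1)"
proof -
  have "dif GF (tens g f) \<in> gr GF (n - 1)" if "g \<in> gr G i" "f \<in> gr F j" "i + j = n" for g f i j
  proof -
    have "tens (dif G g) f \<in> gr GF (n - 1)"
      using tens_in_gr[OF G.dif_in_gr[OF that(1)] that(2)] that(3) by (simp add: algebra_simps)
    moreover have "tens g (dif F f) \<in> gr GF (n - 1)"
      using tens_in_gr[OF that(1) F.dif_in_gr[OF that(2)]] that(3) by (simp add: algebra_simps)
    ultimately show ?thesis
      by (simp add: dif_tens[OF that(1)] T.subspace_add T.subspace_ksgn subspace_gr_GF)
  qed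
  then have "gr GF n \<subseteq> {x. dif GF x \<in> gr GF (n - 1)}"
    using module_hom.subspace_linear_preimage[OF module_hom_dif_GF subspace_gr_GF]
    by (intro gr_GF_subset) auto
  then show "x \<in> gr GF n \<Longrightarrow> dif GF x \<in> gr GF (n - 1)" by blast
qed

lemma dif_GF_dif_GF [simp]: "dif GF (dif GF x) = 0"
proof -
  have "(\<lambda>x. dif GF (dif GF x)) = (\<lambda>_. 0)"
  proof (rule tensor_eqI_homogeneous)
    fix i g f assume g: "g \<in> gr G i"
    have "ksgn (i - 1) (tens (dif G g) (dif F f)) = - ksgn i (tens (dif G g) (dif F f))"
      by (simp add: ksgn_def)
    then show "dif GF (dif GF (tens g f)) = 0"
      by (simp add: dif_tens[OF g] dif_tens[OF G.dif_in_gr[OF g]] dif_GF_add dif_GF_ksgn ksgn_add)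
  qed (simp_all add: additive_def dif_GF_add)
  then show ?thesis by (rule fun_cong)
qed

lemma tens_rmult_tens: "tens_rmult tens (tens g f') f = tens g (f' * f)"
  and tens_rmult_add: "tens_rmult tens (t + t') f = tens_rmult tens t f + tens_rmult tens t' f"
proof -
  have "\<exists>H. module_hom sT sT H \<and> (\<forall>g f'. H (tens g f') = tens g (f' * f))"
    by (rule ex_tensor_lift; rule module_homI)
      (simp_all add: G.module_axioms F.module_axioms T.module_axioms tens_add_left tens_add_right
        tens_scale_left tens_scale_right distrib_right scale_mult_left)
  then obtain H where H: "module_hom sT sT H" "\<And>g f'. H (tens g f') = tens g (f' * f)" by blast
  have "(THE h. additive h \<and> (\<forall>g f'. h (tens g f') = tens g (f' * f))) = H"
  proof (rule the_equality)
    show "additive H \<and> (\<forall>g f'. H (tens g f') = tens g (f' * f))"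
      using H module_hom_additive by auto
    show "h = H" if "additive h \<and> (\<forall>g f'. h (tens g f') = tens g (f' * f))" for h
      by (rule tensor_eqI) (use H module_hom_additive that in auto)
  qed
  then have "tens_rmult tens t f = H t" for t by (simp add: tens_rmult_def)
  then show "tens_rmult tens (tens g f') f = tens g (f' * f)"
    "tens_rmult tens (t + t') f = tens_rmult tens t f + tens_rmult tens t' f"
    by (simp_all add: H(2) module_hom.add[OF H(1)])
qed


section \<open>The isomorphism of \<open>Hom\<^sub>R(G, F)\<close> and \<open>Hom\<^sub>F(G \<otimes> F, F)\<close>\<close>

definition Phi :: "('g \<Rightarrow> 'f) \<Rightarrow> 't \<Rightarrow> 'f" where
  "Phi \<beta> = (SOME \<psi>. module_hom sT (scl F) \<psi> \<and> (\<forall>g f. \<psi> (tens g f) = \<beta> g * f))"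

lemma Phi_char:
  assumes "module_hom (scl G) (scl F) \<beta>"
  shows module_hom_Phi: "module_hom sT (scl F) (Phi \<beta>)" and Phi_tens: "Phi \<beta> (tens g f) = \<beta> g * f"
proof -
  have "\<exists>\<psi>. module_hom sT (scl F) \<psi> \<and> (\<forall>g f. \<psi> (tens g f) = \<beta> g * f)"
    by (rule ex_tensor_lift; rule module_homI)
      (simp_all add: G.module_axioms F.module_axioms distrib_left distrib_right scale_mult_left
        scale_mult_right module_hom.add[OF assms] module_hom.scale[OF assms])
  from someI_ex[OF this, folded Phi_def] show "module_hom sT (scl F) (Phi \<beta>)"
    "Phi \<beta> (tens g f) = \<beta> g * f" by auto
qed

lemma Phi_eqI:
  assumes "module_hom (scl G) (scl F) \<beta>" and "additive \<psi>"
    and "\<And>i g f. g \<in> gr G i \<Longrightarrow> \<psi> (tens g f) = \<beta> g * f"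
  shows "\<psi> = Phi \<beta>"
  by (rule tensor_eqI_homogeneous)
    (use assms module_hom_additive[OF module_hom_Phi[OF assms(1)]] in \<open>auto simp: Phi_tens\<close>)

lemma Phi_add:
  assumes "module_hom (scl G) (scl F) \<beta>" "module_hom (scl G) (scl F) \<beta>'"
  shows "Phi (\<beta> + \<beta>') = Phi \<beta> + Phi \<beta>'"
proof (rule Phi_eqI[symmetric])
  show "module_hom (scl G) (scl F) (\<beta> + \<beta>')"
    unfolding plus_fun_def by (rule Hom.pair.module_hom_add[OF assms])
qed (use assms in \<open>simp_all add: additive_def module_hom.add[OF module_hom_Phi] Phi_tens
  distrib_right\<close>)

lemma Phi_scale:
  assumes "module_hom (scl G) (scl F) \<beta>"
  shows "Phi (\<lambda>x. scl F r (\<beta> x)) = (\<lambda>t. scl F r (Phi \<beta> t))"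
proof (rule Phi_eqI[symmetric])
  show "module_hom (scl G) (scl F) (\<lambda>x. scl F r (\<beta> x))"
    by (rule Hom.pair.module_hom_scale[OF assms])
qed (use assms in \<open>simp_all add: additive_def module_hom.add[OF module_hom_Phi] Phi_tens
  F.scale_right_distrib scale_mult_left\<close>)

lemma Phi_in_homFF:
  assumes \<beta>: "\<beta> \<in> hom_gr G F d"
  shows "Phi \<beta> \<in> homFF F GF tens d"
proof -
  note hom = hom_grD(1)[OF \<beta>]
  have "Phi \<beta> (tens_rmult tens t f) = Phi \<beta> t * f" for t f
    by (induction t rule: tensor_induct)
      (simp_all add: tens_rmult_add tens_rmult_tens Phi_tens[OF hom] module_hom.add[OF module_hom_Phi[OF hom]]
        mult.assoc distrib_right)
  moreover have "gr GF n \<subseteq> {t. Phi \<beta> t \<in> gr F (n + d)}" for n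
  proof (rule gr_GF_subset)
    show "T.subspace {t. Phi \<beta> t \<in> gr F (n + d)}"
      by (rule module_hom.subspace_linear_preimage[OF module_hom_Phi[OF hom] F.subspace_gr])
    fix g f i j assume *: "g \<in> gr G i" "f \<in> gr F j" "i + j = n"
    have "n + d = (i + d) + j" using *(3) by simp
    then show "tens g f \<in> {t. Phi \<beta> t \<in> gr F (n + d)}"
      using mult_in_gr[OF hom_grD(2)[OF \<beta> *(1)] *(2)] by (simp only: Phi_tens[OF hom] mem_Collect_eq)
  qed
  ultimately show ?thesis
    using module_hom_additive[OF module_hom_Phi[OF hom]] by (auto simp: homFF_def homF_gr_def)
qed

lemma Phi_surj:
  assumes "\<psi> \<in> homFF F GF tens d"
  shows "\<exists>\<beta>\<in>hom_gr G F d. \<psi> = Phi \<beta>"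
proof -
  have add: "additive \<psi>" and lin: "\<And>t f. \<psi> (tens_rmult tens t f) = \<psi> t * f"
    and deg: "\<And>n t. t \<in> gr GF n \<Longrightarrow> \<psi> t \<in> gr F (n + d)"
    using assms unfolding homFF_def homF_gr_def by blast+
  define \<beta> where "\<beta> g = \<psi> (tens g 1)" for g
  have tens: "\<psi> (tens g f) = \<beta> g * f" for g f
    using lin[of "tens g 1" f] by (simp add: \<beta>_def tens_rmult_tens)
  have "module_hom (scl G) (scl F) \<beta>"
  proof (rule module_homI[OF G.module_axioms F.module_axioms])
    show "\<beta> (x + y) = \<beta> x + \<beta> y" for x y
      by (simp add: \<beta>_def tens_add_left additive.add[OF add])
    show "\<beta> (scl G r x) = scl F r (\<beta> x)" for r x
    proof -
      \<comment> \<open>Membership in \<open>homFF\<close> speaks of multiplication by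
        \<open>F\<close> only; moving the scalar to the right factor as \<open>scl F r 1\<close>
        yields linearity over the base ring.\<close>
      have "\<beta> (scl G r x) = \<psi> (tens x (scl F r 1))"
        by (simp add: \<beta>_def tens_scale_left tens_scale_right)
      then show ?thesis by (simp add: tens scale_mult_right)
    qed
  qed
  moreover have "\<beta> x \<in> gr F (n + d)" if "x \<in> gr G n" for n x
    using deg[OF tens_in_gr[OF that one_in_gr]] by (simp add: \<beta>_def)
  ultimately have "\<beta> \<in> hom_gr G F d" and "\<psi> = Phi \<beta>"
    using Phi_eqI[of \<beta> \<psi>] add tens by (auto simp: hom_gr_def)
  then show ?thesis by blast
qed

lemma homFF_eq_image: "homFF F GF tens d = Phi ` hom_gr G F d"
  using Phi_in_homFF Phi_surj by blast

lemma Phi_inj: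
  assumes "\<beta> \<in> hom_gr G F d" "\<beta>' \<in> hom_gr G F d" "Phi \<beta> = Phi \<beta>'"
  shows "\<beta> = \<beta>'"
proof
  fix g
  show "\<beta> g = \<beta>' g"
    using Phi_tens[OF hom_grD(1)[OF assms(1)], of g 1] Phi_tens[OF hom_grD(1)[OF assms(2)], of g 1] assms(3)
    by simp
qed

text \<open>On \<open>tens g f\<close> the product \<open>\<beta> g * dif F f\<close> arises from
  the Leibniz rule in \<open>F\<close> and from the differential of the tensor, both times with the
  sign of \<open>i + d\<close>, and cancels.\<close>

lemma Phi_hom_dif:
  assumes \<beta>: "\<beta> \<in> hom_gr G F d"
  shows "hom_dif GF F d (Phi \<beta>) = Phi (hom_dif G F d \<beta>)"
proof (rule Phi_eqI)
  note hom = hom_grD(1)[OF \<beta>]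
  show "module_hom (scl G) (scl F) (hom_dif G F d \<beta>)"
    by (rule hom_grD(1)[OF Hom.hom_dif_in_hom_gr[OF \<beta>]])
  show "additive (hom_dif GF F d (Phi \<beta>))"
    by (simp add: additive_def hom_dif_def F.dif_add dif_GF_add module_hom.add[OF module_hom_Phi[OF hom]]
        ksgn_add)
  fix i g f assume g: "g \<in> gr G i"
  have "ksgn d (ksgn i x) = ksgn (i + d) x" for x :: 'f
    by (simp add: ksgn_ksgn add.commute)
  then show "hom_dif GF F d (Phi \<beta>) (tens g f) = hom_dif G F d \<beta> g * f"
    using ksgn_additive[OF module_hom_additive[OF module_hom_Phi[OF hom]], of i]
    by (simp add: hom_dif_def Phi_tens[OF hom] dif_tens[OF g] dif_mult[OF hom_grD(2)[OF \<beta> g]]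
        module_hom.add[OF module_hom_Phi[OF hom]] ksgn_add left_diff_distrib ksgn_mult_left)
qed

text \<open>
  Only the Leibniz rule of a \<open>\<Gamma>\<close>-derivation enters, and the maps satisfying it are closed under
  the differential, so compatibility with divided powers never has to be checked.
\<close>

definition leibniz :: "int \<Rightarrow> ('f \<Rightarrow> 'f) set" where
  "leibniz p = {\<theta> \<in> hom_gr F F p.
     \<forall>i. \<forall>a\<in>gr F i. \<forall>b. \<theta> (a * b) = \<theta> a * b + ksgn (p * i) (a * \<theta> b)}"

lemma der_act_Phi:
  assumes \<beta>: "\<beta> \<in> hom_gr G F d" and \<theta>: "\<theta> \<in> leibniz p"
  shows "der_act G tens p d \<theta> (Phi \<beta>) = Phi (\<theta> \<circ> \<beta>)"
proof -
  note hom = hom_grD(1)[OF \<beta>]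
  have \<theta>_hom: "module_hom (scl F) (scl F) \<theta>"
    and \<theta>_mult: "\<And>i a b. a \<in> gr F i \<Longrightarrow> \<theta> (a * b) = \<theta> a * b + ksgn (p * i) (a * \<theta> b)"
    using \<theta> by (auto simp: leibniz_def hom_gr_def)
  have comp: "module_hom (scl G) (scl F) (\<theta> \<circ> \<beta>)"
    using hom \<theta>_hom by (auto simp: module_hom_iff)
  \<comment> \<open>\<open>\<beta> g\<close> has degree \<open>j + d\<close>, so its Leibniz sign is
    exactly the one built into \<open>der_act\<close>.\<close>
  have *: "\<theta> (Phi \<beta> (tens g f)) - ksgn (p * (d + j)) (Phi \<beta> (tens g (\<theta> f))) = (\<theta> \<circ> \<beta>) g * f"
    if "g \<in> gr G j" for j g f
    using \<theta>_mult[OF hom_grD(2)[OF \<beta> that]] by (simp add: Phi_tens[OF hom] add.commute)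
  show ?thesis
    unfolding der_act_def
  proof (rule the_equality)
    show "additive (Phi (\<theta> \<circ> \<beta>)) \<and> (\<forall>j. \<forall>g\<in>gr G j. \<forall>f. Phi (\<theta> \<circ> \<beta>) (tens g f) =
        \<theta> (Phi \<beta> (tens g f)) - ksgn (p * (d + j)) (Phi \<beta> (tens g (\<theta> f))))"
      using module_hom_additive[OF module_hom_Phi[OF comp]] * by (simp add: Phi_tens[OF comp])
    fix \<chi> assume "additive \<chi> \<and> (\<forall>j. \<forall>g\<in>gr G j. \<forall>f. \<chi> (tens g f) =
        \<theta> (Phi \<beta> (tens g f)) - ksgn (p * (d + j)) (Phi \<beta> (tens g (\<theta> f))))"
    then show "\<chi> = Phi (\<theta> \<circ> \<beta>)"
      by (intro Phi_eqI[OF comp]) (use * in auto)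
  qed
qed

lemma end_act_Phi:
  assumes \<beta>: "\<beta> \<in> hom_gr G F d" and \<alpha>: "\<alpha> \<in> hom_gr G G q"
  shows "end_act tens (Phi \<beta>) \<alpha> = Phi (\<beta> \<circ> \<alpha>)"
proof -
  note hom = hom_grD(1)[OF \<beta>]
  have comp: "module_hom (scl G) (scl F) (\<beta> \<circ> \<alpha>)"
    using hom \<alpha> by (auto simp: module_hom_iff hom_gr_def)
  show ?thesis
    unfolding end_act_def
  proof (rule the_equality)
    show "additive (Phi (\<beta> \<circ> \<alpha>)) \<and> (\<forall>g f. Phi (\<beta> \<circ> \<alpha>) (tens g f) = Phi \<beta> (tens (\<alpha> g) f))"
      using module_hom_additive[OF module_hom_Phi[OF comp]] by (simp add: Phi_tens[OF comp] Phi_tens[OF hom])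
    fix \<chi> assume "additive \<chi> \<and> (\<forall>g f. \<chi> (tens g f) = Phi \<beta> (tens (\<alpha> g) f))"
    then show "\<chi> = Phi (\<beta> \<circ> \<alpha>)"
      by (intro Phi_eqI[OF comp]) (auto simp: Phi_tens[OF hom])
  qed
qed

end

section \<open>The kernel of \<open>G \<otimes> F \<rightarrow> G \<otimes> k\<close> is acyclic\<close>

context tensor_setting
begin

text \<open>
  \<open>Kpart I n\<close> is the part of \<open>(G \<otimes> ker aug)\<^sub>n\<close> whose \<open>G\<close>-degrees lie in \<open>I\<close>.
\<close>

definition Kgen :: "int set \<Rightarrow> int \<Rightarrow> 't set" where
  "Kgen I n = {tens g f | g f i. i \<in> I \<and> g \<in> gr G i \<and> f \<in> gr F (n - i) \<and> aug f = 0}"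

definition Kpart :: "int set \<Rightarrow> int \<Rightarrow> 't set" where
  "Kpart I n = T.span (Kgen I n)"

lemma subspace_Kpart: "T.subspace (Kpart I n)"
  by (simp add: Kpart_def)

lemma Kpart_mono: "I \<subseteq> J \<Longrightarrow> Kpart I n \<subseteq> Kpart J n"
  unfolding Kpart_def Kgen_def by (rule T.span_mono) blast

lemma tens_in_Kpart:
  "i \<in> I \<Longrightarrow> g \<in> gr G i \<Longrightarrow> f \<in> gr F (n - i) \<Longrightarrow> aug f = 0 \<Longrightarrow> tens g f \<in> Kpart I n"
  unfolding Kpart_def Kgen_def by (rule T.span_base) blast

lemma Kpart_subset:
  assumes "T.subspace S"
    and "\<And>i g f. i \<in> I \<Longrightarrow> g \<in> gr G i \<Longrightarrow> f \<in> gr F (n - i) \<Longrightarrow> aug f = 0 \<Longrightarrow> tens g f \<in> S"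
  shows "Kpart I n \<subseteq> S"
  unfolding Kpart_def Kgen_def by (rule T.span_minimal) (use assms in auto)

lemma Kpart_subset_gr: "Kpart I n \<subseteq> gr GF n"
proof (rule Kpart_subset[OF subspace_gr_GF])
  fix i g f assume "g \<in> gr G i" "f \<in> gr F (n - i)"
  then show "tens g f \<in> gr GF n" using tens_in_gr[of g i f "n - i"] by simp
qed

text \<open>The differential of \<open>g\<close> lowers the \<open>G\<close>-degree by one, hence
  the closure condition on \<open>I\<close>; the differential of \<open>f\<close> keeps it and stays
  in the kernel because boundaries have augmentation 0.\<close>

lemma dif_Kpart:
  assumes "x \<in> Kpart I n" and "\<And>i. i \<in> I \<Longrightarrow> i - 1 \<in> I"
  shows "dif GF x \<in> Kpart I (n - 1)"
proof -
  have "Kpart I n \<subseteq> {x. dif GF x \<in> Kpart I (n - 1)}"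
  proof (rule Kpart_subset)
    show "T.subspace {x. dif GF x \<in> Kpart I (n - 1)}"
      by (rule module_hom.subspace_linear_preimage[OF module_hom_dif_GF subspace_Kpart])
    fix i g f assume *: "i \<in> I" "g \<in> gr G i" "f \<in> gr F (n - i)" "aug f = 0"
    have "tens (dif G g) f \<in> Kpart I (n - 1)"
      by (rule tens_in_Kpart[of "i - 1"]) (use * assms(2) G.dif_in_gr in auto)
    moreover have "tens g (dif F f) \<in> Kpart I (n - 1)"
      by (rule tens_in_Kpart[of i]) (use * F.dif_in_gr[OF *(3)] in \<open>auto simp: algebra_simps\<close>)
    ultimately show "tens g f \<in> {x. dif GF x \<in> Kpart I (n - 1)}"
      by (simp add: dif_tens[OF *(2)] T.subspace_add T.subspace_ksgn subspace_Kpart)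
  qed
  then show ?thesis using assms(1) by blast
qed

text \<open>The scalar is moved to the right factor, where \<open>aug\<close> kills it: modulo
  \<open>K\<close>, the complex is one of vector spaces over \<open>k\<close>. This supplies the
  last hypothesis of \<open>ex_extend_functional\<close>.\<close>

lemma scale_in_Kpart:
  assumes "x \<in> gr GF n" and "\<epsilon> r = 0"
  shows "sT r x \<in> Kpart UNIV n"
proof -
  have "gr GF n \<subseteq> {x. sT r x \<in> Kpart UNIV n}"
  proof (rule gr_GF_subset)
    show "T.subspace {x. sT r x \<in> Kpart UNIV n}"
      by (rule module_hom.subspace_linear_preimage[OF T.module_hom_scale_self subspace_Kpart])
    fix g f i j assume *: "g \<in> gr G i" "f \<in> gr F j" "i + j = n"
    have "tens g (scl F r f) \<in> Kpart UNIV n"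
      by (rule tens_in_Kpart[of i]) (use * assms(2) in \<open>auto simp: aug_scale F.gr_scale\<close>)
    then show "tens g f \<in> {x. sT r x \<in> Kpart UNIV n}" by (simp add: tens_scale_right)
  qed
  then show ?thesis using assms(1) by blast
qed

text \<open>The coordinate of \<open>b\<close>, tensored with \<open>F\<close>. These maps take the
  place of a decomposition of the part in \<open>G\<close>-degree \<open>i\<close> into copies of
  \<open>F\<close>.\<close>

lemma ex_basis_coordinate:
  assumes "b \<in> G.basis i"
  shows "\<exists>c. module_hom sT (scl F) c \<and>
    (\<forall>b'\<in>G.basis i. \<forall>f. c (tens b' f) = (if b' = b then f else 0)) \<and>
    (\<forall>j g f. j \<noteq> i \<longrightarrow> g \<in> gr G j \<longrightarrow> c (tens g f) = 0)"
proof -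
  have "module ((*) :: 'r \<Rightarrow> 'r \<Rightarrow> 'r)" by unfold_locales (simp_all add: algebra_simps)
  from G.ex_hom_on_basis_degree[OF this, of i "\<lambda>b'. if b' = b then 1 else 0"]
  obtain \<pi> where \<pi>: "module_hom (scl G) (*) \<pi>"
    "\<And>b'. b' \<in> G.basis i \<Longrightarrow> \<pi> b' = (if b' = b then 1 else 0)"
    "\<And>m x. m \<noteq> i \<Longrightarrow> x \<in> gr G m \<Longrightarrow> \<pi> x = 0" by blast
  have "\<exists>c. module_hom sT (scl F) c \<and> (\<forall>g f. c (tens g f) = scl F (\<pi> g) f)"
    by (rule ex_tensor_lift; rule module_homI)
      (simp_all add: G.module_axioms F.module_axioms module_hom.add[OF \<pi>(1)]
        module_hom.scale[OF \<pi>(1)] F.scale_left_distrib F.scale_right_distrib mult.commute)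
  then obtain c where "module_hom sT (scl F) c" "\<And>g f. c (tens g f) = scl F (\<pi> g) f" by blast
  then show ?thesis using \<pi> by (intro exI[of _ c]) auto
qed

lemma Kpart_singletonE:
  assumes "x \<in> Kpart {i} n"
  obtains S v where "finite S" "S \<subseteq> G.basis i" "\<forall>b. v b \<in> gr F (n - i) \<and> aug (v b) = 0"
    "x = (\<Sum>b\<in>S. tens b (v b))"
proof -
  \<comment> \<open>Requiring \<open>v\<close> to vanish off \<open>S\<close> as well lets two such
    expressions be added over the union of their index sets.\<close>
  define N where "N = {x. \<exists>S v. finite S \<and> S \<subseteq> G.basis i \<and>
    (\<forall>b. v b \<in> gr F (n - i) \<and> aug (v b) = 0) \<and> (\<forall>b. b \<notin> S \<longrightarrow> v b = 0) \<and>
    x = (\<Sum>b\<in>S. tens b (v b))}"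
  have N: "T.subspace N"
  proof (rule T.subspaceI)
    show "0 \<in> N"
      unfolding N_def by (intro CollectI exI[of _ "{}"] exI[of _ "\<lambda>_. 0"]) auto
  next
    fix x y assume "x \<in> N" "y \<in> N"
    then obtain S v S' v' where *: "finite S" "S \<subseteq> G.basis i" "\<forall>b. v b \<in> gr F (n - i) \<and> aug (v b) = 0"
      "\<forall>b. b \<notin> S \<longrightarrow> v b = 0" "x = (\<Sum>b\<in>S. tens b (v b))" "finite S'" "S' \<subseteq> G.basis i"
      "\<forall>b. v' b \<in> gr F (n - i) \<and> aug (v' b) = 0" "\<forall>b. b \<notin> S' \<longrightarrow> v' b = 0"
      "y = (\<Sum>b\<in>S'. tens b (v' b))"
      unfolding N_def by blast
    have "x = (\<Sum>b\<in>S \<union> S'. tens b (v b))" "y = (\<Sum>b\<in>S \<union> S'. tens b (v' b))"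
      unfolding *(5,10) by (rule sum.mono_neutral_left; use * in auto)+
    then show "x + y \<in> N"
      unfolding N_def using *
      by (intro CollectI exI[of _ "S \<union> S'"] exI[of _ "\<lambda>b. v b + v' b"])
        (auto simp: F.gr_add aug_add tens_add_right sum.distrib)
  next
    fix r x assume "x \<in> N"
    then obtain S v where *: "finite S" "S \<subseteq> G.basis i" "\<forall>b. v b \<in> gr F (n - i) \<and> aug (v b) = 0"
      "\<forall>b. b \<notin> S \<longrightarrow> v b = 0" "x = (\<Sum>b\<in>S. tens b (v b))"
      unfolding N_def by blast
    then show "sT r x \<in> N"
      unfolding N_def
      by (intro CollectI exI[of _ S] exI[of _ "\<lambda>b. scl F r (v b)"])
        (auto simp: F.gr_scale aug_scale tens_scale_right T.scale_sum_right)
  qed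
  have "Kpart {i} n \<subseteq> N"
  proof (rule Kpart_subset[OF N])
    fix j g f assume *: "j \<in> {i}" "g \<in> gr G j" "f \<in> gr F (n - j)" "aug f = 0"
    have "G.subspace {g. tens g f \<in> N}"
      by (auto intro!: G.subspaceI simp: T.subspace_0[OF N] T.subspace_add[OF N] T.subspace_scale[OF N]
          tens_add_left tens_scale_left)
    moreover have "tens b f \<in> N" if "b \<in> G.basis i" for b
      unfolding N_def using * that
      by (intro CollectI exI[of _ "{b}"] exI[of _ "\<lambda>b'. if b' = b then f else 0"]) auto
    ultimately show "tens g f \<in> N" using G.gr_subset[of "{g. tens g f \<in> N}" i] * by blast
  qed
  then show thesis using assms that unfolding N_def by blast
qed

text \<open>
  Filter by the degree in \<open>G\<close>: the top component of a cycle is \<open>\<Sum> b \<otimes> v\<^sub>b\<close> over a basis of \<open>G\<^sub>i\<close>, and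
  comparing coordinates shows that every \<open>v\<^sub>b\<close> is a cycle, hence a boundary.
\<close>

lemma Kpart_bounded_acyclic:
  "z \<in> Kpart {..<int k} n \<Longrightarrow> dif GF z = 0 \<Longrightarrow> \<exists>w\<in>Kpart UNIV (n + 1). dif GF w = z"
proof (induction k arbitrary: z)
  case 0
  \<comment> \<open>\<open>G\<close> vanishes in negative degrees, which is where the filtration
    starts.\<close>
  have "Kpart {..<int 0} n \<subseteq> {0}"
    by (rule Kpart_subset) (auto simp: G.bounded)
  then have "z = 0" using 0 by blast
  then show ?case by (intro bexI[of _ 0]) (simp_all add: T.subspace_0[OF subspace_Kpart])
next
  case (Suc k)
  let ?I = "{..<int k}" and ?i = "int k"
  have down: "i - 1 \<in> ?I" if "i \<in> ?I" for i using that by simp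
  have "{..<int (Suc k)} = ?I \<union> {?i}" by auto
  then have "Kgen {..<int (Suc k)} n = Kgen ?I n \<union> Kgen {?i} n"
    unfolding Kgen_def by blast
  then have "Kpart {..<int (Suc k)} n = {x + y | x y. x \<in> Kpart ?I n \<and> y \<in> Kpart {?i} n}"
    by (simp add: Kpart_def T.span_Un)
  then obtain x y where z: "z = x + y" and x: "x \<in> Kpart ?I n" and yK: "y \<in> Kpart {?i} n"
    using Suc.prems(1) by blast
  obtain S v where S: "finite S" "S \<subseteq> G.basis ?i" and v: "\<forall>b. v b \<in> gr F (n - ?i) \<and> aug (v b) = 0"
    and y: "y = (\<Sum>b\<in>S. tens b (v b))"
    by (rule Kpart_singletonE[OF yK]) (rule that)
  have gr: "b \<in> gr G ?i" if "b \<in> S" for b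
    using S that G.basis_in_gr by blast
  have "dif F (v b) = 0" if "b \<in> S" for b
  proof -
    have "b \<in> G.basis ?i" using S that by blast
    from ex_basis_coordinate[OF this] obtain c where c: "module_hom sT (scl F) c"
      "\<And>b' f. b' \<in> G.basis ?i \<Longrightarrow> c (tens b' f) = (if b' = b then f else 0)"
      "\<And>j g f. j \<noteq> ?i \<Longrightarrow> g \<in> gr G j \<Longrightarrow> c (tens g f) = 0" by blast
    have "Kpart ?I (n - 1) \<subseteq> {x. c x = 0}"
    proof (rule Kpart_subset[OF module_hom.subspace_kernel[OF c(1)]])
      fix i g f assume "i \<in> ?I" "g \<in> gr G i"
      then show "tens g f \<in> {x. c x = 0}" using c(3)[of i g f] by simp
    qed
    then have "c (dif GF x) = 0" using dif_Kpart[OF x down] by blast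
    \<comment> \<open>The part of the boundary that comes from \<open>dif G b'\<close> has
      \<open>G\<close>-degree \<open>k - 1\<close> and is invisible to \<open>c\<close>; what
      remains is the coordinate of \<open>b\<close>.\<close>
    moreover have "c (dif GF y) = (\<Sum>b'\<in>S. if b' = b then ksgn ?i (dif F (v b')) else 0)"
      unfolding y dif_GF_sum module_hom.sum[OF c(1)]
    proof (rule sum.cong[OF refl])
      fix b' assume b': "b' \<in> S"
      have "c (tens (dif G b') (v b')) = 0"
        by (rule c(3)[OF _ G.dif_in_gr[OF gr[OF b']]]) simp
      moreover have "b' \<in> G.basis ?i" using S b' by blast
      ultimately show "c (dif GF (tens b' (v b'))) = (if b' = b then ksgn ?i (dif F (v b')) else 0)"
        by (simp add: dif_tens[OF gr[OF b']] module_hom.add[OF c(1)] c(2)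
            ksgn_additive[OF module_hom_additive[OF c(1)]])
    qed
    then have "c (dif GF y) = ksgn ?i (dif F (v b))" using S(1) that by simp
    moreover have "c (dif GF x) + c (dif GF y) = 0"
      using Suc.prems(2) by (simp add: z dif_GF_add module_hom.zero[OF c(1)] flip: module_hom.add[OF c(1)])
    ultimately have "ksgn ?i (dif F (v b)) = 0" by simp
    then show ?thesis by (simp add: ksgn_def split: if_splits)
  qed
  then have "\<forall>b\<in>S. \<exists>u. u \<in> gr F (n - ?i + 1) \<and> dif F u = v b \<and> aug u = 0"
    using acyclic v by blast
  then obtain u where u: "\<And>b. b \<in> S \<Longrightarrow> u b \<in> gr F (n - ?i + 1) \<and> dif F (u b) = v b \<and> aug (u b) = 0"
    by metis
  \<comment> \<open>The sign cancels the Koszul sign, so that \<open>w\<close> has boundary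
    \<open>y\<close> plus the term \<open>x'\<close> of lower \<open>G\<close>-degree. Hence
    \<open>x - x'\<close> is a cycle to which the induction hypothesis applies.\<close>
  define w where "w = ksgn ?i (\<Sum>b\<in>S. tens b (u b))"
  define x' where "x' = ksgn ?i (\<Sum>b\<in>S. tens (dif G b) (u b))"
  have "tens b (u b) \<in> Kpart UNIV (n + 1)" if "b \<in> S" for b
    by (rule tens_in_Kpart[of ?i]) (use gr[OF that] u[OF that] in \<open>auto simp: algebra_simps\<close>)
  then have w: "w \<in> Kpart UNIV (n + 1)"
    unfolding w_def by (intro T.subspace_ksgn T.subspace_sum subspace_Kpart)
  have "tens (dif G b) (u b) \<in> Kpart ?I n" if "b \<in> S" for b
    by (rule tens_in_Kpart[of "?i - 1"])
      (use G.dif_in_gr[OF gr[OF that]] u[OF that] in \<open>auto simp: algebra_simps\<close>)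
  then have x': "x' \<in> Kpart ?I n"
    unfolding x'_def by (intro T.subspace_ksgn T.subspace_sum subspace_Kpart)
  have dif_w: "dif GF w = x' + y"
    unfolding w_def x'_def y
    by (simp add: dif_GF_ksgn dif_GF_sum dif_tens[OF gr] u sum.distrib ksgn_add flip: ksgn_sum)
  have "dif GF (x - x') = dif GF (z - dif GF w)" by (simp add: z dif_w)
  also have "\<dots> = 0" using Suc.prems(2) by (simp add: dif_GF_diff)
  finally have "\<exists>w'\<in>Kpart UNIV (n + 1). dif GF w' = x - x'"
    by (intro Suc.IH T.subspace_diff[OF subspace_Kpart] x x')
  then obtain w' where "w' \<in> Kpart UNIV (n + 1)" "dif GF w' = x - x'" by blast
  then show ?case
    using w by (intro bexI[of _ "w' + w"]) (simp_all add: dif_GF_add dif_w z T.subspace_add[OF subspace_Kpart])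
qed

abbreviation K :: "int \<Rightarrow> 't set" where
  "K \<equiv> Kpart UNIV"

text \<open>An element of \<open>K n\<close> is a finite sum of tensors, so the
  \<open>G\<close>-degrees that occur in it are bounded and it lies in one of the filtration
  steps.\<close>

lemma K_acyclic:
  assumes "z \<in> K n" and "dif GF z = 0"
  shows "\<exists>w\<in>K (n + 1). dif GF w = z"
proof -
  define N where "N = {z. \<exists>k. z \<in> Kpart {..<int k} n}"
  have "K n \<subseteq> N"
  proof (rule Kpart_subset)
    show "T.subspace N"
    proof (rule T.subspaceI)
      show "0 \<in> N" unfolding N_def using T.subspace_0[OF subspace_Kpart] by blast
    next
      fix x y assume "x \<in> N" "y \<in> N"
      then obtain k k' where "x \<in> Kpart {..<int k} n" "y \<in> Kpart {..<int k'} n"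
        unfolding N_def by blast
      then have "x \<in> Kpart {..<int (max k k')} n" "y \<in> Kpart {..<int (max k k')} n"
        using Kpart_mono[of "{..<int k}" "{..<int (max k k')}" n]
          Kpart_mono[of "{..<int k'}" "{..<int (max k k')}" n] by auto
      then show "x + y \<in> N" unfolding N_def using T.subspace_add[OF subspace_Kpart] by blast
    next
      fix r x assume "x \<in> N"
      then show "sT r x \<in> N" unfolding N_def using T.subspace_scale[OF subspace_Kpart] by blast
    qed
    fix i g f assume "g \<in> gr G i" "f \<in> gr F (n - i)" "aug f = 0"
    then have "tens g f \<in> Kpart {..<int (nat (i + 1))} n"
      by (intro tens_in_Kpart[of i]) auto
    then show "tens g f \<in> N" unfolding N_def by blast
  qed
  then obtain k where "z \<in> Kpart {..<int k} n" using assms(1) unfolding N_def by blast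
  then show ?thesis using Kpart_bounded_acyclic assms(2) by blast
qed

lemma K_subset_gr: "K n \<subseteq> gr GF n"
  by (rule Kpart_subset_gr)

text \<open>The boundary of \<open>t\<close> is a cycle of \<open>K\<close>, hence the boundary of
  some element of \<open>K\<close>, and subtracting that element makes \<open>t\<close> a cycle. In
  other words, every cycle of \<open>G \<otimes> k\<close> lifts to a cycle of
  \<open>G \<otimes> F\<close>.\<close>

lemma cycle_mod_KE:
  assumes "t \<in> gr GF n" and "dif GF t \<in> K (n - 1)"
  obtains z \<kappa> where "z \<in> gr GF n" "dif GF z = 0" "\<kappa> \<in> K n" "t = z + \<kappa>"
proof -
  obtain \<kappa> where \<kappa>: "\<kappa> \<in> K n" "dif GF \<kappa> = dif GF t"
    using K_acyclic[OF assms(2)] by auto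
  have "t - \<kappa> \<in> gr GF n"
    using T.subspace_diff[OF subspace_gr_GF assms(1)] \<kappa>(1) K_subset_gr by blast
  then show thesis
    by (intro that[of "t - \<kappa>" \<kappa>]) (simp_all add: \<kappa> dif_GF_diff)
qed


section \<open>Functionals on \<open>G \<otimes> F\<close>\<close>

text \<open>A functional on degree \<open>n\<close> that vanishes on \<open>K\<^sub>n\<close> is determined by its values on \<open>g \<otimes> 1\<close>.\<close>

lemma ex_functional_on_G:
  assumes add: "\<And>x y. x \<in> gr GF n \<Longrightarrow> y \<in> gr GF n \<Longrightarrow> l (x + y) = l x + l y"
    and scale: "\<And>r x. x \<in> gr GF n \<Longrightarrow> l (sT r x) = \<epsilon> r * l x"
  shows "\<exists>\<gamma>. module_hom (scl G) (\<lambda>r c. \<epsilon> r * c) \<gamma> \<and> (\<forall>m x. m \<noteq> n \<longrightarrow> x \<in> gr G m \<longrightarrow> \<gamma> x = 0) \<and>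
    (\<forall>g\<in>gr G n. \<gamma> g = l (tens g 1))"
proof -
  define \<gamma> where "\<gamma> g = l (tens (G.hcomp n g) 1)" for g
  have in_gr: "tens g 1 \<in> gr GF n" if "g \<in> gr G n" for g
    using tens_in_gr[OF that one_in_gr] by simp
  have zero: "l 0 = 0" using scale[of 0 0] T.subspace_0[OF subspace_gr_GF] by (simp add: \<epsilon>_simps)
  have "module_hom (scl G) (\<lambda>r c. \<epsilon> r * c) \<gamma>"
    by (rule module_homI[OF G.module_axioms module_residue[OF residue]])
      (simp_all add: \<gamma>_def G.hcomp_add G.hcomp_scale tens_add_left tens_scale_left add scale in_gr
        G.hcomp_in_gr)
  moreover have "\<gamma> x = 0" if "m \<noteq> n" "x \<in> gr G m" for m x
    using that by (simp add: \<gamma>_def G.hcomp_homogeneous[OF that(2)] zero)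
  moreover have "\<gamma> g = l (tens g 1)" if "g \<in> gr G n" for g
    by (simp add: \<gamma>_def G.hcomp_homogeneous[OF that])
  ultimately show ?thesis by blast
qed

lemma aug_Phi_K:
  assumes \<beta>: "\<beta> \<in> hom_gr G F d" and "x \<in> K n"
  shows "aug (Phi \<beta> x) = 0"
proof -
  note hom = hom_grD(1)[OF \<beta>]
  have "K n \<subseteq> {x. aug (Phi \<beta> x) = 0}"
  proof (rule Kpart_subset)
    show "T.subspace {x. aug (Phi \<beta> x) = 0}"
      by (auto intro!: T.subspaceI simp: aug_add aug_scale module_hom.zero[OF module_hom_Phi[OF hom]]
          module_hom.add[OF module_hom_Phi[OF hom]] module_hom.scale[OF module_hom_Phi[OF hom]])
  qed (auto simp: Phi_tens[OF hom] aug_mult)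
  then show ?thesis using assms(2) by blast
qed

text \<open>Injectivity of the evaluation. By \<open>cycle_mod_KE\<close> the functional vanishes on
  cycles modulo \<open>K\<close>, so it factors through the differential, and extending the factor
  gives \<open>\<gamma>\<close> with \<open>\<gamma> (dif G x) = aug (\<beta> x)\<close>. Lifting
  \<open>\<gamma>\<close> to \<open>F\<close> shows that \<open>\<beta>\<close> differs by a
  coboundary from a cocycle with values in the kernel of \<open>aug\<close>, which
  \<open>ex_homotopy\<close> handles.\<close>

lemma boundary_if_aug_Phi_zero:
  assumes \<beta>: "\<beta> \<in> hom_gr G F d" and closed: "hom_dif G F d \<beta> = 0"
    and zero: "\<And>z. z \<in> gr GF (- d) \<Longrightarrow> dif GF z = 0 \<Longrightarrow> aug (Phi \<beta> z) = 0"
  shows "\<beta> \<in> hom_dif G F (d + 1) ` hom_gr G F (d + 1)"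
proof -
  note hom = hom_grD(1)[OF \<beta>] and \<Phi> = module_hom_Phi[OF hom_grD(1)[OF \<beta>]]
  define n where "n = - d"
  let ?\<Lambda> = "\<lambda>t. aug (Phi \<beta> t)"
  have \<Lambda>_add: "?\<Lambda> (x + y) = ?\<Lambda> x + ?\<Lambda> y" and \<Lambda>_diff: "?\<Lambda> (x - y) = ?\<Lambda> x - ?\<Lambda> y"
    and \<Lambda>_scale: "?\<Lambda> (sT r x) = \<epsilon> r * ?\<Lambda> x" for x y r
    by (simp_all add: module_hom.add[OF \<Phi>] module_hom.diff[OF \<Phi>] module_hom.scale[OF \<Phi>] aug_add
        aug_diff aug_scale)
  have vanish: "?\<Lambda> t = 0" if t: "t \<in> gr GF n" "dif GF t \<in> K (n - 1)" for t
  proof -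
    obtain z \<kappa> where "z \<in> gr GF n" "dif GF z = 0" "\<kappa> \<in> K n" "t = z + \<kappa>"
      by (rule cycle_mod_KE[OF t])
    then show ?thesis using zero aug_Phi_K[OF \<beta>] by (simp add: \<Lambda>_add n_def)
  qed
  \<comment> \<open>Modulo \<open>K\<close> these are the boundaries. The functional
    \<open>l\<close> sends the boundary of \<open>t\<close> to \<open>?\<Lambda> t\<close>, and
    \<open>vanish\<close> makes this independent of \<open>t\<close>.\<close>
  define S where "S = {dif GF t + \<kappa> | t \<kappa>. t \<in> gr GF n \<and> \<kappa> \<in> K (n - 1)}"
  define l where "l s = ?\<Lambda> (SOME t. t \<in> gr GF n \<and> s - dif GF t \<in> K (n - 1))" for s
  have l: "l (dif GF t + \<kappa>) = ?\<Lambda> t" if "t \<in> gr GF n" "\<kappa> \<in> K (n - 1)" for t \<kappa>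
  proof -
    define t' where "t' = (SOME t'. t' \<in> gr GF n \<and> dif GF t + \<kappa> - dif GF t' \<in> K (n - 1))"
    have t': "t' \<in> gr GF n \<and> dif GF t + \<kappa> - dif GF t' \<in> K (n - 1)"
      unfolding t'_def by (rule someI[of _ t]) (use that in simp)
    have "(dif GF t + \<kappa> - dif GF t') - \<kappa> \<in> K (n - 1)"
      using T.subspace_diff[OF subspace_Kpart] t' that(2) by blast
    then have "dif GF (t - t') \<in> K (n - 1)" by (simp add: dif_GF_diff)
    then have "?\<Lambda> (t - t') = 0"
      using vanish T.subspace_diff[OF subspace_gr_GF] that(1) t' by blast
    then show ?thesis by (simp add: l_def \<Lambda>_diff flip: t'_def)
  qed
  have S_sub: "T.subspace S"
  proof (rule T.subspaceI)
    show "0 \<in> S" unfolding S_def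
      using T.subspace_0[OF subspace_gr_GF] T.subspace_0[OF subspace_Kpart]
      by (intro CollectI exI[of _ 0]) auto
  next
    fix x y assume "x \<in> S" "y \<in> S"
    then obtain t \<kappa> t' \<kappa>' where *: "t \<in> gr GF n" "\<kappa> \<in> K (n - 1)" "x = dif GF t + \<kappa>"
      "t' \<in> gr GF n" "\<kappa>' \<in> K (n - 1)" "y = dif GF t' + \<kappa>'" unfolding S_def by blast
    then have "x + y = dif GF (t + t') + (\<kappa> + \<kappa>')" by (simp add: dif_GF_add)
    then show "x + y \<in> S" unfolding S_def
      using * T.subspace_add[OF subspace_gr_GF] T.subspace_add[OF subspace_Kpart] by blast
  next
    fix r x assume "x \<in> S"
    then obtain t \<kappa> where *: "t \<in> gr GF n" "\<kappa> \<in> K (n - 1)" "x = dif GF t + \<kappa>"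
      unfolding S_def by blast
    then have "sT r x = dif GF (sT r t) + sT r \<kappa>" by (simp add: dif_GF_scale T.scale_right_distrib)
    then show "sT r x \<in> S" unfolding S_def
      using * T.subspace_scale[OF subspace_gr_GF] T.subspace_scale[OF subspace_Kpart] by blast
  qed
  have "\<exists>l'. (\<forall>x\<in>S. l' x = l x) \<and>
      (\<forall>x\<in>gr GF (n - 1). \<forall>y\<in>gr GF (n - 1). l' (x + y) = l' x + l' y) \<and>
      (\<forall>r. \<forall>x\<in>gr GF (n - 1). l' (sT r x) = \<epsilon> r * l' x)"
  proof (rule T.ex_extend_functional[OF residue subspace_gr_GF S_sub])
    show "S \<subseteq> gr GF (n - 1)"
      unfolding S_def using dif_GF_in_gr K_subset_gr by (auto intro!: T.subspace_add[OF subspace_gr_GF])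
    fix x y assume "x \<in> S" "y \<in> S"
    then obtain t \<kappa> t' \<kappa>' where *: "t \<in> gr GF n" "\<kappa> \<in> K (n - 1)" "x = dif GF t + \<kappa>"
      "t' \<in> gr GF n" "\<kappa>' \<in> K (n - 1)" "y = dif GF t' + \<kappa>'" unfolding S_def by blast
    then have "x + y = dif GF (t + t') + (\<kappa> + \<kappa>')" by (simp add: dif_GF_add)
    then have "l (x + y) = ?\<Lambda> (t + t')"
      using l[of "t + t'" "\<kappa> + \<kappa>'"] * T.subspace_add[OF subspace_gr_GF] T.subspace_add[OF subspace_Kpart]
      by metis
    then show "l (x + y) = l x + l y" using * l by (simp add: \<Lambda>_add)
  next
    fix r x assume "x \<in> S"
    then obtain t \<kappa> where *: "t \<in> gr GF n" "\<kappa> \<in> K (n - 1)" "x = dif GF t + \<kappa>"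
      unfolding S_def by blast
    then have "sT r x = dif GF (sT r t) + sT r \<kappa>" by (simp add: dif_GF_scale T.scale_right_distrib)
    then have "l (sT r x) = ?\<Lambda> (sT r t)"
      using l[of "sT r t" "sT r \<kappa>"] * T.subspace_scale[OF subspace_gr_GF] T.subspace_scale[OF subspace_Kpart]
      by metis
    then show "l (sT r x) = \<epsilon> r * l x" using * l by (simp add: \<Lambda>_scale)
  next
    fix r x assume "x \<in> gr GF (n - 1)" "\<epsilon> r = 0"
    then have "sT r x \<in> K (n - 1)" by (rule scale_in_Kpart)
    then have "sT r x = dif GF 0 + sT r x \<and> 0 \<in> gr GF n \<and> sT r x \<in> K (n - 1)"
      using T.subspace_0[OF subspace_gr_GF] by simp
    moreover from this have "l (sT r x) = 0"
      using l[of 0 "sT r x"] by (simp add: module_hom.zero[OF \<Phi>])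
    ultimately show "sT r x \<in> S \<and> l (sT r x) = 0" unfolding S_def by blast
  qed
  then obtain l' where l': "\<And>x. x \<in> S \<Longrightarrow> l' x = l x"
    "\<And>x y. x \<in> gr GF (n - 1) \<Longrightarrow> y \<in> gr GF (n - 1) \<Longrightarrow> l' (x + y) = l' x + l' y"
    "\<And>r x. x \<in> gr GF (n - 1) \<Longrightarrow> l' (sT r x) = \<epsilon> r * l' x" by blast
  obtain \<gamma> where \<gamma>: "module_hom (scl G) (\<lambda>r c. \<epsilon> r * c) \<gamma>"
    "\<And>m x. m \<noteq> n - 1 \<Longrightarrow> x \<in> gr G m \<Longrightarrow> \<gamma> x = 0"
    "\<And>g. g \<in> gr G (n - 1) \<Longrightarrow> \<gamma> g = l' (tens g 1)"
    using ex_functional_on_G[of "n - 1" l', OF l'(2,3)] by blast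
  have \<gamma>_dif: "\<gamma> (dif G x) = aug (\<beta> x)" for x
  proof (rule G.additive_eqI)
    show "additive (\<lambda>x. \<gamma> (dif G x))" "additive (\<lambda>x. aug (\<beta> x))"
      by (simp_all add: additive_def G.dif_add module_hom.add[OF \<gamma>(1)] module_hom.add[OF hom] aug_add)
    fix m x assume x: "x \<in> gr G m"
    show "\<gamma> (dif G x) = aug (\<beta> x)"
    proof (cases "m = n")
      case True
      have "tens x 1 \<in> gr GF n" using tens_in_gr[OF x one_in_gr] True by simp
      moreover have "tens (dif G x) 1 = dif GF (tens x 1) + 0" by (simp add: dif_tens[OF x])
      moreover have "0 \<in> K (n - 1)" by (rule T.subspace_0[OF subspace_Kpart])
      ultimately have "tens (dif G x) 1 \<in> S" "l (tens (dif G x) 1) = ?\<Lambda> (tens x 1)"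
        unfolding S_def using l by (blast, metis)
      then show ?thesis
        using \<gamma>(3)[of "dif G x"] G.dif_in_gr[OF x] True l'(1) by (simp add: Phi_tens[OF hom])
    next
      case False
      have "\<gamma> (dif G x) = 0" using \<gamma>(2)[OF _ G.dif_in_gr[OF x]] False by simp
      moreover have "aug (\<beta> x) = 0"
        by (rule aug_gr[OF hom_grD(2)[OF \<beta> x]]) (use False in \<open>simp add: n_def\<close>)
      ultimately show ?thesis by simp
    qed
  qed
  obtain \<rho> where \<rho>: "\<rho> \<in> hom_gr G F (d + 1)" "\<And>x. aug (\<rho> x) = \<gamma> x"
  proof -
    have "\<exists>\<rho>\<in>hom_gr G F (- (n - 1)). \<forall>x. aug (\<rho> x) = \<gamma> x"
      by (rule ex_aug_lift[OF \<gamma>(1)]) (use \<gamma>(2) in blast)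
    moreover have "- (n - 1) = d + 1" by (simp add: n_def)
    ultimately show thesis using that by auto
  qed
  \<comment> \<open>After \<open>aug\<close>, only the second term of
    \<open>hom_dif G F (d + 1)\<close> survives, with the sign of \<open>d\<close>; the factor
    \<open>ksgn d\<close> removes it.\<close>
  define \<rho>' where "\<rho>' = ksgn d \<rho>"
  have \<rho>': "\<rho>' \<in> hom_gr G F (d + 1)" unfolding \<rho>'_def by (rule Hom.hom_gr_ksgn[OF \<rho>(1)])
  have "aug (hom_dif G F (d + 1) \<rho>' x) = aug (\<beta> x)" for x
    unfolding \<rho>'_def Hom.hom_dif_ksgn
    by (simp add: hom_dif_def ksgn_def aug_diff aug_add \<rho>(2) \<gamma>_dif additive.minus[OF additive_aug])
  then have aug_zero: "aug ((\<beta> - hom_dif G F (d + 1) \<rho>') x) = 0" for x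
    by (simp add: aug_diff)
  have in_hom: "\<beta> - hom_dif G F (d + 1) \<rho>' \<in> hom_gr G F d"
    using Hom.hom_gr_diff[OF \<beta>] Hom.hom_dif_in_hom_gr[OF \<rho>'] by simp
  have "hom_dif G F d (\<beta> - hom_dif G F (d + 1) \<rho>') = 0"
    using closed Hom.hom_dif_hom_dif[OF \<rho>'] by (simp add: Hom.hom_dif_diff)
  from ex_homotopy[OF in_hom this aug_zero] obtain h where
    h: "h \<in> hom_gr G F (d + 1)" "hom_dif G F (d + 1) h = \<beta> - hom_dif G F (d + 1) \<rho>'" by blast
  \<comment> \<open>\<open>ksgn 1\<close> is negation: the primitive is the sum of \<open>h\<close>
    and \<open>\<rho>'\<close>, written as a difference so that the rules for differences
    apply.\<close>
  have "h - ksgn 1 \<rho>' \<in> hom_gr G F (d + 1)"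
    by (intro Hom.hom_gr_diff Hom.hom_gr_ksgn h(1) \<rho>')
  moreover have "hom_dif G F (d + 1) (h - ksgn 1 \<rho>') = \<beta>"
    unfolding Hom.hom_dif_diff Hom.hom_dif_ksgn h(2) by (simp add: ksgn_def)
  ultimately show ?thesis by blast
qed

text \<open>Surjectivity of the evaluation. The functional is extended by 0 to \<open>K\<close>,
  which is consistent because a cycle in \<open>K\<close> is a boundary, where \<open>l\<close>
  vanishes. After extension to the whole degree it is restricted to \<open>G\<close>, lifted to
  \<open>F\<close> and corrected to a cocycle.\<close>

lemma ex_cycle_with_functional:
  assumes add: "\<And>x y. x \<in> gr GF (- d) \<Longrightarrow> dif GF x = 0 \<Longrightarrow> y \<in> gr GF (- d) \<Longrightarrow> dif GF y = 0 \<Longrightarrow>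
      l (x + y) = l x + l y"
    and scale: "\<And>r x. x \<in> gr GF (- d) \<Longrightarrow> dif GF x = 0 \<Longrightarrow> l (sT r x) = \<epsilon> r * l x"
    and bnd: "\<And>w. w \<in> gr GF (- d + 1) \<Longrightarrow> l (dif GF w) = 0"
  shows "\<exists>\<beta>\<in>hom_gr G F d. hom_dif G F d \<beta> = 0 \<and>
    (\<forall>z\<in>gr GF (- d). dif GF z = 0 \<longrightarrow> aug (Phi \<beta> z) = l z)"
proof -
  define n where "n = - d"
  note add = add[folded n_def] and scale = scale[folded n_def] and bnd = bnd[folded n_def]
  define Z where "Z = {z \<in> gr GF n. dif GF z = 0}"
  have Z_sub: "T.subspace Z"
    unfolding Z_def
    by (auto intro!: T.subspaceI simp: T.subspace_0[OF subspace_gr_GF] T.subspace_add[OF subspace_gr_GF]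
        T.subspace_scale[OF subspace_gr_GF] dif_GF_add dif_GF_scale)
  have l_diff: "l (x - y) = l x - l y" if "x \<in> Z" "y \<in> Z" for x y
    using add[of "x - y" y] that T.subspace_diff[OF Z_sub that] by (simp add: Z_def)
  have l_K: "l x = 0" if "x \<in> Z" "x \<in> K n" for x
    using K_acyclic[OF that(2)] that(1) bnd K_subset_gr[of "n + 1"] by (auto simp: Z_def)
  define S where "S = {z + \<kappa> | z \<kappa>. z \<in> Z \<and> \<kappa> \<in> K n}"
  define L where "L s = l (SOME z. z \<in> Z \<and> s - z \<in> K n)" for s
  have L: "L (z + \<kappa>) = l z" if "z \<in> Z" "\<kappa> \<in> K n" for z \<kappa>
  proof -
    define z' where "z' = (SOME z'. z' \<in> Z \<and> z + \<kappa> - z' \<in> K n)"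
    have z': "z' \<in> Z \<and> z + \<kappa> - z' \<in> K n"
      unfolding z'_def by (rule someI[of _ z]) (use that in simp)
    have "(z + \<kappa> - z') - \<kappa> \<in> K n"
      using T.subspace_diff[OF subspace_Kpart] z' that(2) by blast
    then have "l (z - z') = 0"
      using l_K T.subspace_diff[OF Z_sub that(1)] z' by simp
    then show ?thesis using l_diff[OF that(1)] z' by (simp add: L_def flip: z'_def)
  qed
  have S_sub: "T.subspace S"
  proof -
    have span: "T.span Z = Z" "T.span (K n) = K n" by (simp_all add: Z_sub subspace_Kpart)
    have "S = T.span (Z \<union> K n)" unfolding S_def T.span_Un span ..
    then show ?thesis by simp
  qed
  have "\<exists>l'. (\<forall>x\<in>S. l' x = L x) \<and>
      (\<forall>x\<in>gr GF n. \<forall>y\<in>gr GF n. l' (x + y) = l' x + l' y) \<and>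
      (\<forall>r. \<forall>x\<in>gr GF n. l' (sT r x) = \<epsilon> r * l' x)"
  proof (rule T.ex_extend_functional[OF residue subspace_gr_GF S_sub])
    show "S \<subseteq> gr GF n"
      unfolding S_def Z_def using K_subset_gr by (auto intro!: T.subspace_add[OF subspace_gr_GF])
    fix x y assume "x \<in> S" "y \<in> S"
    then obtain z \<kappa> z' \<kappa>' where *: "z \<in> Z" "\<kappa> \<in> K n" "x = z + \<kappa>" "z' \<in> Z" "\<kappa>' \<in> K n" "y = z' + \<kappa>'"
      unfolding S_def by blast
    then have "L (x + y) = l (z + z')"
      using L[of "z + z'" "\<kappa> + \<kappa>'"] T.subspace_add[OF Z_sub] T.subspace_add[OF subspace_Kpart]
      by (simp add: ac_simps)
    then show "L (x + y) = L x + L y" using * L add by (simp add: Z_def)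
  next
    fix r x assume "x \<in> S"
    then obtain z \<kappa> where *: "z \<in> Z" "\<kappa> \<in> K n" "x = z + \<kappa>" unfolding S_def by blast
    then have "L (sT r x) = l (sT r z)"
      using L[of "sT r z" "sT r \<kappa>"] T.subspace_scale[OF Z_sub] T.subspace_scale[OF subspace_Kpart]
      by (simp add: T.scale_right_distrib)
    then show "L (sT r x) = \<epsilon> r * L x" using * L scale by (simp add: Z_def)
  next
    fix r x assume "x \<in> gr GF n" "\<epsilon> r = 0"
    then have "sT r x \<in> K n" by (rule scale_in_Kpart)
    moreover have "0 \<in> Z" by (rule T.subspace_0[OF Z_sub])
    moreover have "l 0 = 0" using l_diff[OF \<open>0 \<in> Z\<close> \<open>0 \<in> Z\<close>] by simp
    moreover have "sT r x = 0 + sT r x" by simp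
    ultimately show "sT r x \<in> S \<and> L (sT r x) = 0" unfolding S_def using L by (metis (mono_tags, lifting) CollectI)
  qed
  then obtain l' where l': "\<And>x. x \<in> S \<Longrightarrow> l' x = L x"
    "\<And>x y. x \<in> gr GF n \<Longrightarrow> y \<in> gr GF n \<Longrightarrow> l' (x + y) = l' x + l' y"
    "\<And>r x. x \<in> gr GF n \<Longrightarrow> l' (sT r x) = \<epsilon> r * l' x" by blast
  have l'_Z: "l' z = l z" if "z \<in> Z" for z
    using l'(1)[of z] L[OF that, of 0] that T.subspace_0[OF subspace_Kpart] by (force simp: S_def)
  have l'_K: "l' x = 0" if "x \<in> K n" for x
  proof -
    have "0 \<in> Z" by (rule T.subspace_0[OF Z_sub])
    moreover from this have "l 0 = 0" using l_diff[of 0 0] by simp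
    ultimately show ?thesis using l'(1)[of x] L[of 0 x] that by (force simp: S_def)
  qed
  obtain \<gamma> where \<gamma>: "module_hom (scl G) (\<lambda>r c. \<epsilon> r * c) \<gamma>"
    "\<And>m x. m \<noteq> n \<Longrightarrow> x \<in> gr G m \<Longrightarrow> \<gamma> x = 0"
    "\<And>g. g \<in> gr G n \<Longrightarrow> \<gamma> g = l' (tens g 1)"
    using ex_functional_on_G[of n l', OF l'(2,3)] by blast
  have \<gamma>_dif: "\<gamma> (dif G x) = 0" for x
  proof (rule G.additive_eqI[where f = "\<lambda>x. \<gamma> (dif G x)" and g = "\<lambda>_. 0"])
    show "additive (\<lambda>x. \<gamma> (dif G x))"
      by (simp add: additive_def G.dif_add module_hom.add[OF \<gamma>(1)])
    fix m x assume x: "x \<in> gr G m"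
    show "\<gamma> (dif G x) = 0"
    proof (cases "m = n + 1")
      case True
      have x1: "tens x 1 \<in> gr GF (n + 1)" using tens_in_gr[OF x one_in_gr] True by simp
      have "dif G x \<in> gr G n" using G.dif_in_gr[OF x] True by simp
      \<comment> \<open>As \<open>1\<close> is a cycle, the boundary of \<open>tens x 1\<close> is
        \<open>tens (dif G x) 1\<close>.\<close>
      then have "\<gamma> (dif G x) = l' (dif GF (tens x 1))" by (simp add: \<gamma>(3) dif_tens[OF x])
      also have "\<dots> = 0"
        using l'_Z[of "dif GF (tens x 1)"] bnd[OF x1] dif_GF_in_gr[OF x1] by (simp add: Z_def)
      finally show ?thesis .
    next
      case False
      then show ?thesis using \<gamma>(2)[OF _ G.dif_in_gr[OF x]] by simp
    qed
  qed (simp add: additive_def)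
  obtain \<rho> where \<rho>: "\<rho> \<in> hom_gr G F d" "\<And>x. aug (\<rho> x) = \<gamma> x"
    using ex_aug_lift[OF \<gamma>(1), of n] \<gamma>(2) unfolding n_def by auto
  \<comment> \<open>\<open>\<rho>\<close> need not be a cocycle, but its differential takes values
    in the kernel of \<open>aug\<close> and is therefore the differential of some \<open>h\<close>
    with values there. The difference \<open>\<rho> - h\<close> still lifts
    \<open>\<gamma>\<close>.\<close>
  have "aug (hom_dif G F d \<rho> x) = 0" for x
    by (simp add: hom_dif_def aug_diff aug_ksgn \<rho>(2) \<gamma>_dif)
  from ex_homotopy[OF Hom.hom_dif_in_hom_gr[OF \<rho>(1)] Hom.hom_dif_hom_dif[OF \<rho>(1)] this]
  obtain h where h: "h \<in> hom_gr G F d" "\<And>x. aug (h x) = 0" "hom_dif G F d h = hom_dif G F d \<rho>"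
    by auto
  define \<beta> where "\<beta> = \<rho> - h"
  have \<beta>: "\<beta> \<in> hom_gr G F d" unfolding \<beta>_def by (rule Hom.hom_gr_diff[OF \<rho>(1) h(1)])
  note hom = hom_grD(1)[OF \<beta>]
  have aug_\<beta>: "aug (\<beta> x) = \<gamma> x" for x by (simp add: \<beta>_def aug_diff \<rho>(2) h(2))
  \<comment> \<open>A tensor whose right factor has degree 0 is a multiple of some
    \<open>tens g 1\<close>, where \<open>\<gamma>\<close> gives the value; every other homogeneous
    tensor lies in \<open>K n\<close>, where both sides vanish.\<close>
  have "gr GF n \<subseteq> {t \<in> gr GF n. aug (Phi \<beta> t) = l' t}"
  proof (rule gr_GF_subset)
    have "l' 0 = 0" using l'_K T.subspace_0[OF subspace_Kpart] by blast
    then show "T.subspace {t \<in> gr GF n. aug (Phi \<beta> t) = l' t}"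
      by (auto intro!: T.subspaceI simp: T.subspace_0[OF subspace_gr_GF] T.subspace_add[OF subspace_gr_GF]
          T.subspace_scale[OF subspace_gr_GF] module_hom.zero[OF module_hom_Phi[OF hom]]
          module_hom.add[OF module_hom_Phi[OF hom]] module_hom.scale[OF module_hom_Phi[OF hom]]
          aug_add aug_scale l'(2,3))
    fix g f i j assume *: "g \<in> gr G i" "f \<in> gr F j" "i + j = n"
    have "aug (\<beta> g * f) = l' (tens g f)"
    proof (cases "j = 0")
      case True
      then obtain r where "f = scl F r 1" using * gr_0E by blast
      moreover have "g \<in> gr G n" using * True by simp
      ultimately show ?thesis
        using tens_in_gr[OF *(1) one_in_gr] *(3) True
        by (simp add: scale_mult_right aug_scale aug_\<beta> \<gamma>(3) tens_scale_right l'(3))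
    next
      case False
      have "tens g f \<in> K n"
        by (rule tens_in_Kpart[of i]) (use * False in \<open>auto intro: aug_gr\<close>)
      then show ?thesis using aug_gr[OF *(2) False] l'_K by (simp add: aug_mult)
    qed
    then show "tens g f \<in> {t \<in> gr GF n. aug (Phi \<beta> t) = l' t}"
      using tens_in_gr[OF *(1,2)] *(3) by (simp add: Phi_tens[OF hom])
  qed
  then have "aug (Phi \<beta> z) = l z" if "z \<in> gr GF n" "dif GF z = 0" for z
    using that l'_Z[of z] by (auto simp: Z_def)
  moreover have "hom_dif G F d \<beta> = 0" by (simp add: \<beta>_def Hom.hom_dif_diff h(3))
  ultimately show ?thesis using \<beta> unfolding n_def by blast
qed

end

section \<open>Transport of the action\<close>

text \<open>Compatibility passes from letters to words and from words to combinations. Membership in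
  \<open>carr\<close> is carried through both inductions because the operations are controlled only
  there.\<close>

lemma tens_act_transport:
  fixes N :: "('k, 'x, 'u) gvec_scheme" and N' :: "('k, 'y, 'v) gvec_scheme"
  assumes zer: "\<And>d. zer N d \<in> carr N d" "\<And>d. \<phi> d (zer N d) = zer N' d"
    and pls: "\<And>d x y. x \<in> carr N d \<Longrightarrow> y \<in> carr N d \<Longrightarrow>
      pls N d x y \<in> carr N d \<and> \<phi> d (pls N d x y) = pls N' d (\<phi> d x) (\<phi> d y)"
    and smul: "\<And>d c x. x \<in> carr N d \<Longrightarrow>
      smul N d c x \<in> carr N d \<and> \<phi> d (smul N d c x) = smul N' d c (\<phi> d x)"
    and act: "\<And>p d \<xi> x. \<xi> \<in> P p \<Longrightarrow> x \<in> carr N d \<Longrightarrow>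
      act p d \<xi> x \<in> carr N (p + d) \<and> \<phi> (p + d) (act p d \<xi> x) = act' p d \<xi> (\<phi> d x)"
    and t: "t \<in> tens_alg P p" and x: "x \<in> carr N d"
  shows "\<phi> (p + d) (tens_act N act p d t x) = tens_act N' act' p d t (\<phi> d x)"
proof -
  have word: "word_act act d w x \<in> carr N (d + sum_list (map fst w)) \<and>
      \<phi> (d + sum_list (map fst w)) (word_act act d w x) = word_act act' d w (\<phi> d x)"
    if "\<forall>(i, \<xi>)\<in>set w. \<xi> \<in> P i" for w
    using that
  proof (induction w)
    case Nil
    show ?case using x by simp
  next
    case (Cons l w)
    have "d + sum_list (map fst (l # w)) = fst l + (d + sum_list (map fst w))" by simp
    then show ?case
      using Cons act[of "snd l" "fst l"] by (simp only: word_act.simps) (auto simp: case_prod_beta)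
  qed
  have "tens_act N act p d t x \<in> carr N (p + d) \<and>
      \<phi> (p + d) (tens_act N act p d t x) = tens_act N' act' p d t (\<phi> d x)"
    using t
  proof (induction t)
    case Nil
    show ?case by (simp add: tens_act_def zer)
  next
    case (Cons cw t)
    obtain c w where cw: "cw = (c, w)" by (cases cw)
    have w: "sum_list (map fst w) = p" "\<forall>(i, \<xi>)\<in>set w. \<xi> \<in> P i" and "t \<in> tens_alg P p"
      using Cons.prems by (auto simp: tens_alg_def cw)
    then have IH: "tens_act N act p d t x \<in> carr N (p + d)"
      "\<phi> (p + d) (tens_act N act p d t x) = tens_act N' act' p d t (\<phi> d x)"
      using Cons.IH by auto
    have "word_act act d w x \<in> carr N (p + d)"
      "\<phi> (p + d) (word_act act d w x) = word_act act' d w (\<phi> d x)"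
      using word[OF w(2)] w(1) by (simp_all add: add.commute)
    then have "smul N (p + d) c (word_act act d w x) \<in> carr N (p + d)"
      "\<phi> (p + d) (smul N (p + d) c (word_act act d w x)) = smul N' (p + d) c (word_act act' d w (\<phi> d x))"
      using smul by auto
    then show ?case
      using pls IH by (simp add: cw tens_act_def)
  qed
  then show ?thesis by blast
qed

text \<open>
  Both sides choose the same preimage of \<open>e\<close> in the tensor algebra, so no knowledge of the kernel or
  the image of \<open>U\<pi>(R) \<rightarrow> Ext(k, k)\<close> is needed.
\<close>

lemma extend_act_transport:
  fixes N :: "('k::field, 'x, 'u) gvec_scheme" and N' :: "('k, 'y, 'v) gvec_scheme"
    and F :: "('r::comm_ring_1, 'f::ring_1, 'z) gamma_alg_scheme"
  assumes zer: "\<And>d. zer N d \<in> carr N d" "\<And>d. \<phi> d (zer N d) = zer N' d"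
    and pls: "\<And>d x y. x \<in> carr N d \<Longrightarrow> y \<in> carr N d \<Longrightarrow>
      pls N d x y \<in> carr N d \<and> \<phi> d (pls N d x y) = pls N' d (\<phi> d x) (\<phi> d y)"
    and smul: "\<And>d c x. x \<in> carr N d \<Longrightarrow>
      smul N d c x \<in> carr N d \<and> \<phi> d (smul N d c x) = smul N' d c (\<phi> d x)"
    and act: "\<And>p d \<xi> x. \<xi> \<in> homotopy_lie F p \<Longrightarrow> x \<in> carr N d \<Longrightarrow>
      act p d \<xi> x \<in> carr N (p + d) \<and> \<phi> (p + d) (act p d \<xi> x) = act' p d \<xi> (\<phi> d x)"
    and x: "x \<in> carr N d"
  shows "\<phi> (p + d) (extend_act \<epsilon> F N act p d e x) = extend_act \<epsilon> F N' act' p d e (\<phi> d x)"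
proof (cases "e \<in> env_to_ext \<epsilon> F p ` tens_alg (homotopy_lie F) p")
  case True
  then have "inv_into (tens_alg (homotopy_lie F) p) (env_to_ext \<epsilon> F p) e \<in> tens_alg (homotopy_lie F) p"
    by (rule inv_into_into)
  then have "\<phi> (p + d) (tens_act N act p d (inv_into (tens_alg (homotopy_lie F) p) (env_to_ext \<epsilon> F p) e) x) =
      tens_act N' act' p d (inv_into (tens_alg (homotopy_lie F) p) (env_to_ext \<epsilon> F p) e) (\<phi> d x)"
    by (intro tens_act_transport[where \<phi> = \<phi> and P = "homotopy_lie F"] zer pls smul act x)
  with True show ?thesis
    by (simp add: extend_act_def Let_def)
next
  case False
  then show ?thesis by (simp add: extend_act_def Let_def zer)
qed


section \<open>The bimodule isomorphism\<close>

context tensor_setting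
begin

sublocale Tor: abelian_complex "gr GF" "\<lambda>_. dif GF"
  by unfold_locales
    (simp_all add: T.subspace_0 T.subspace_diff subspace_gr_GF dif_GF_diff dif_GF_in_gr)

sublocale FF: hom_complex F F ..

sublocale GG: hom_complex G G ..

section \<open>The map from Ext to the dual of Tor, evaluated on classes\<close>

definition phi :: "int \<Rightarrow> ('g \<Rightarrow> 'f) set \<Rightarrow> 't set \<Rightarrow> 'k" where
  "phi d P = ident \<epsilon> F GF tens d (Phi ` P)"

lemma bnd_homFF: "bnd (homFF F GF tens) (hom_dif GF F) d = Phi ` Hom.bd d"
  by (auto simp: bnd_def homFF_eq_image Phi_hom_dif image_image)

lemma Phi_cls:
  assumes "\<beta> \<in> hom_gr G F d"
  shows "Phi ` Hom.cls d \<beta> = Phi \<beta> +o bnd (homFF F GF tens) (hom_dif GF F) d"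
proof -
  have "Phi (\<beta> + b) = Phi \<beta> + Phi b" if "b \<in> Hom.bd d" for b
    using that Hom.bd_subset_cyc by (intro Phi_add hom_grD(1)[OF assms] hom_grD(1)) (auto simp: Hom.cyc_def)
  then show ?thesis by (force simp: bnd_homFF elt_set_plus_def)
qed

lemma Phi_zero: "Phi 0 = 0"
  by (rule Phi_eqI[symmetric]) (use Hom.pair.module_hom_zero in \<open>auto simp: zero_fun_def additive_def\<close>)

lemma homology_homFF: "homology (homFF F GF tens) (hom_dif GF F) d =
  (\<lambda>P. Phi ` P) ` homology (hom_gr G F) (hom_dif G F) d"
proof -
  have closed: "hom_dif GF F d (Phi \<beta>) = 0 \<longleftrightarrow> hom_dif G F d \<beta> = 0" if "\<beta> \<in> hom_gr G F d" for \<beta>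
    unfolding Phi_hom_dif[OF that]
    using Phi_inj[OF Hom.hom_dif_in_hom_gr[OF that] Hom.zero_closed] Phi_zero by metis
  have "homology (homFF F GF tens) (hom_dif GF F) d =
      (\<lambda>\<beta>. Phi \<beta> +o bnd (homFF F GF tens) (hom_dif GF F) d) ` Hom.cyc d"
    by (auto simp: homology_def homFF_eq_image closed Hom.cyc_def)
  also have "\<dots> = (\<lambda>\<beta>. Phi ` Hom.cls d \<beta>) ` Hom.cyc d"
    by (rule image_cong) (simp_all add: Phi_cls Hom.cyc_def)
  finally show ?thesis by (simp add: Hom.homology_eq image_image)
qed

lemma aug_Phi_boundary:
  assumes "b \<in> Hom.bd d" and "dif GF z = 0"
  shows "aug (Phi b z) = 0"
proof -
  obtain h where h: "h \<in> hom_gr G F (d + 1)" "b = hom_dif G F (d + 1) h"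
    using assms(1) by (auto simp: bnd_def)
  then have "Phi b = hom_dif GF F (d + 1) (Phi h)" by (simp add: Phi_hom_dif)
  then show ?thesis
    using module_hom.zero[OF module_hom_Phi[OF hom_grD(1)[OF h(1)]]]
    by (simp add: hom_dif_def assms(2))
qed

lemma aug_Phi_dif:
  assumes "\<beta> \<in> Hom.cyc d"
  shows "aug (Phi \<beta> (dif GF w)) = 0"
proof -
  have "hom_dif GF F d (Phi \<beta>) = 0"
    using assms by (simp add: Hom.cyc_def Phi_hom_dif Phi_zero)
  from fun_cong[OF this, of w] have "dif F (Phi \<beta> w) = ksgn d (Phi \<beta> (dif GF w))"
    by (simp add: hom_dif_def)
  then have "aug (ksgn d (Phi \<beta> (dif GF w))) = 0" by (metis aug_dif)
  then have "ksgn d (aug (Phi \<beta> (dif GF w))) = 0" by (simp add: aug_ksgn)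
  then show ?thesis by (simp add: ksgn_def split: if_splits)
qed

text \<open>Changing \<open>\<beta>\<close> by a coboundary is invisible on cycles, and changing
  \<open>z\<close> by a boundary is invisible to cocycles, because \<open>aug\<close> kills
  boundaries of \<open>F\<close>.\<close>

lemma aug_Phi_cls:
  assumes "\<beta> \<in> Hom.cyc d" "\<beta>' \<in> Hom.cls d \<beta>" "z \<in> Tor.cyc n" "x \<in> Tor.cls n z"
  shows "aug (Phi \<beta>' x) = aug (Phi \<beta> z)"
proof -
  have \<beta>: "\<beta> \<in> hom_gr G F d" using assms(1) by (simp add: Hom.cyc_def)
  note hom = hom_grD(1)[OF \<beta>]
  obtain b where b: "b \<in> Hom.bd d" "\<beta>' = \<beta> + b" using assms(2) by (auto simp: elt_set_plus_def)
  then have "b \<in> hom_gr G F d" using Hom.bd_subset_cyc by (auto simp: Hom.cyc_def)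
  note Phi_b = Phi_add[OF hom hom_grD(1)[OF this]]
  obtain w where w: "x = z + dif GF w" using assms(4) by (auto simp: elt_set_plus_def bnd_def)
  have "dif GF x = 0" using assms(3) by (simp add: w dif_GF_add Tor.cyc_def)
  then have "aug (Phi \<beta>' x) = aug (Phi \<beta> x)"
    using aug_Phi_boundary[OF b(1)] by (simp add: b(2) Phi_b aug_add)
  also have "\<dots> = aug (Phi \<beta> z)"
    using aug_Phi_dif[OF assms(1)] by (simp add: w module_hom.add[OF module_hom_Phi[OF hom]] aug_add)
  finally show ?thesis .
qed

lemma carr_tor_gvec: "carr (tor_gvec \<epsilon> GF) n = homology (gr GF) (\<lambda>_. dif GF) n"
  and pls_tor_gvec: "pls (tor_gvec \<epsilon> GF) n = induced2 (Tor.bd n) (+)"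
  and smul_tor_gvec: "smul (tor_gvec \<epsilon> GF) n c = induced2 (Tor.bd n) sT (\<epsilon> -` {c})"
  by (simp_all add: tor_gvec_def hvec_def)

text \<open>All members of the cosets occurring in \<open>ident\<close> give the same value:
  coboundaries with values in \<open>k\<close> vanish on cycles, as \<open>k\<close> has zero
  differential, and \<open>aug_Phi_cls\<close> covers the other representatives.\<close>

lemma phi_cls:
  assumes \<beta>: "\<beta> \<in> Hom.cyc d" and z: "z \<in> Tor.cyc (- d)"
  shows "phi d (Hom.cls d \<beta>) (Tor.cls (- d) z) = aug (Phi \<beta> z)"
proof -
  let ?D = "bnd (homFk \<epsilon> F GF tens) (hom_dif GF (residue_cplx \<epsilon>)) d"
  define Q where "Q = ident_aug \<epsilon> F GF tens d (Phi ` Hom.cls d \<beta>)"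
  have Q: "Q = (\<Union>\<beta>'\<in>Hom.cls d \<beta>. (aug \<circ> Phi \<beta>') +o ?D)"
    by (simp add: Q_def ident_aug_def)
  \<comment> \<open>Zero is a coboundary; hence \<open>aug \<circ> Phi \<beta>\<close> lies in its
    own coset, and the set to which \<open>the_elem\<close> is applied is not empty.\<close>
  have "(0 :: 't \<Rightarrow> 'k) \<in> homFk \<epsilon> F GF tens (d + 1)"
    by (auto simp: homFk_def homF_gr_def residue_cplx_def additive_def)
  moreover have "hom_dif GF (residue_cplx \<epsilon>) (d + 1) 0 = 0"
    by (rule ext) (simp add: hom_dif_def residue_cplx_def)
  ultimately have "0 \<in> ?D" unfolding bnd_def by (metis image_eqI)
  then have mem: "aug \<circ> Phi \<beta> \<in> Q"
    unfolding Q using Hom.cls_self by (force simp: elt_set_plus_def)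
  have "\<chi> x = aug (Phi \<beta> z)" if \<chi>: "\<chi> \<in> Q" and x: "x \<in> Tor.cls (- d) z" for \<chi> x
  proof -
    obtain \<beta>' \<chi>' where *: "\<beta>' \<in> Hom.cls d \<beta>" "\<chi>' \<in> homFk \<epsilon> F GF tens (d + 1)"
      "\<chi> = (aug \<circ> Phi \<beta>') + hom_dif GF (residue_cplx \<epsilon>) (d + 1) \<chi>'"
      using \<chi> unfolding Q by (auto simp: elt_set_plus_def bnd_def)
    have "additive \<chi>'" using *(2) by (simp add: homFk_def homF_gr_def)
    moreover have "dif GF x = 0"
      using z x by (auto simp: elt_set_plus_def bnd_def dif_GF_add Tor.cyc_def)
    ultimately have "hom_dif GF (residue_cplx \<epsilon>) (d + 1) \<chi>' x = 0"
      by (simp add: hom_dif_def residue_cplx_def additive.zero)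
    then show ?thesis using aug_Phi_cls[OF \<beta> *(1) z x] by (simp add: *(3))
  qed
  then have "(\<Union>\<chi>\<in>Q. \<chi> ` Tor.cls (- d) z) \<subseteq> {aug (Phi \<beta> z)}" by force
  moreover have "aug (Phi \<beta> z) \<in> (\<Union>\<chi>\<in>Q. \<chi> ` Tor.cls (- d) z)"
  proof (rule UN_I[OF mem])
    show "aug (Phi \<beta> z) \<in> (aug \<circ> Phi \<beta>) ` Tor.cls (- d) z"
      by (rule image_eqI[OF _ Tor.cls_self]) simp
  qed
  ultimately have "(\<Union>\<chi>\<in>Q. \<chi> ` Tor.cls (- d) z) = {aug (Phi \<beta> z)}" by (intro equalityI) simp_all
  moreover have "Tor.cls (- d) z \<in> carr (tor_gvec \<epsilon> GF) (- d)"
    using z by (simp add: carr_tor_gvec Tor.homology_eq)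
  ultimately show ?thesis
    by (simp add: phi_def ident_def ident_eval_def flip: Q_def)
qed

lemma phi_outside: "X \<notin> homology (gr GF) (\<lambda>_. dif GF) (- d) \<Longrightarrow> phi d P X = 0"
  by (simp add: phi_def ident_def ident_eval_def carr_tor_gvec)

lemma phi_eqI:
  assumes "\<beta> \<in> Hom.cyc d"
    and "\<And>z. z \<in> Tor.cyc (- d) \<Longrightarrow> l (Tor.cls (- d) z) = aug (Phi \<beta> z)"
    and "\<And>X. X \<notin> homology (gr GF) (\<lambda>_. dif GF) (- d) \<Longrightarrow> l X = 0"
  shows "phi d (Hom.cls d \<beta>) = l"
proof
  fix X
  show "phi d (Hom.cls d \<beta>) X = l X"
    using assms phi_cls[OF assms(1)] phi_outside
    by (cases "X \<in> homology (gr GF) (\<lambda>_. dif GF) (- d)") (auto simp: Tor.homology_eq)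
qed

lemma boundaryI:
  assumes "\<beta> \<in> Hom.cyc d" and "\<And>z. z \<in> Tor.cyc (- d) \<Longrightarrow> aug (Phi \<beta> z) = 0"
  shows "\<beta> \<in> Hom.bd d"
  unfolding bnd_def using boundary_if_aug_Phi_zero[of \<beta> d] assms by (simp add: Hom.cyc_def Tor.cyc_def)

lemma inj_on_phi: "inj_on (phi d) (homology (hom_gr G F) (hom_dif G F) d)"
proof
  fix P P'
  assume "P \<in> homology (hom_gr G F) (hom_dif G F) d" "P' \<in> homology (hom_gr G F) (hom_dif G F) d"
    and eq: "phi d P = phi d P'"
  then obtain \<beta> \<beta>' where \<beta>: "\<beta> \<in> Hom.cyc d" "P = Hom.cls d \<beta>" and \<beta>': "\<beta>' \<in> Hom.cyc d" "P' = Hom.cls d \<beta>'"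
    by (auto simp: Hom.homology_eq)
  have "\<beta> - \<beta>' \<in> Hom.bd d"
  proof (rule boundaryI[OF Hom.cyc_diff[OF \<beta>(1) \<beta>'(1)]])
    fix z assume z: "z \<in> Tor.cyc (- d)"
    have "aug (Phi \<beta> z) = aug (Phi \<beta>' z)"
      using fun_cong[OF eq, of "Tor.cls (- d) z"] by (simp add: \<beta>(2) \<beta>'(2) phi_cls \<beta>(1) \<beta>'(1) z)
    moreover have "Phi \<beta> = Phi (\<beta> - \<beta>') + Phi \<beta>'"
      using Phi_add[of "\<beta> - \<beta>'" \<beta>'] Hom.cyc_diff[OF \<beta>(1) \<beta>'(1)] \<beta>'(1) hom_grD(1)
      by (auto simp: Hom.cyc_def)
    ultimately show "aug (Phi (\<beta> - \<beta>') z) = 0" by (simp add: aug_add)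
  qed
  then show "P = P'" by (simp add: \<beta>(2) \<beta>'(2) Hom.cls_eq_iff)
qed

text \<open>Two preimages of a scalar differ by an element of the kernel of
  \<open>\<epsilon>\<close>, which multiplies the cycle \<open>z\<close> into a cycle of
  \<open>K\<close>, hence into a boundary.\<close>

lemma smul_tor_cls:
  assumes z: "z \<in> Tor.cyc n"
  shows "smul (tor_gvec \<epsilon> GF) n (\<epsilon> r) (Tor.cls n z) = Tor.cls n (sT r z)"
  unfolding smul_tor_gvec
proof (rule Tor.induced2_eq_cls)
  show "\<epsilon> -` {\<epsilon> r} \<noteq> {}" "Tor.cls n z \<noteq> {}" using Tor.cls_self by auto
  fix r' x assume r': "r' \<in> \<epsilon> -` {\<epsilon> r}" and "x \<in> Tor.cls n z"
  then obtain w where w: "w \<in> gr GF (n + 1)" "x = z + dif GF w"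
    by (auto simp: elt_set_plus_def bnd_def)
  have "\<epsilon> (r' - r) = 0" using r' by (simp add: \<epsilon>_simps)
  then have "sT (r' - r) z \<in> K n" using scale_in_Kpart z by (simp add: Tor.cyc_def)
  moreover have "dif GF (sT (r' - r) z) = 0" using z by (simp add: Tor.cyc_def dif_GF_scale)
  ultimately obtain w' where "w' \<in> K (n + 1)" "dif GF w' = sT (r' - r) z" using K_acyclic by blast
  then have "sT (r' - r) z \<in> Tor.bd n" unfolding bnd_def using K_subset_gr by (metis image_eqI subsetD)
  moreover have "dif GF (sT r' w) \<in> Tor.bd n"
    unfolding bnd_def using w(1) T.subspace_scale[OF subspace_gr_GF] by blast
  ultimately have "sT (r' - r) z + dif GF (sT r' w) \<in> Tor.bd n" by (rule Tor.bd_add)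
  then show "sT r' x - sT r z \<in> Tor.bd n"
    by (simp add: w(2) T.scale_left_diff_distrib T.scale_right_distrib dif_GF_scale algebra_simps)
qed

lemma cyc_scale: "\<beta> \<in> Hom.cyc d \<Longrightarrow> (\<lambda>x. scl F r (\<beta> x)) \<in> Hom.cyc d"
  by (auto simp: Hom.cyc_def Hom.hom_gr_scale Hom.hom_dif_scale)

text \<open>For \<open>r' - r\<close> in the kernel of \<open>\<epsilon>\<close>, the functional of
  the corresponding multiple of \<open>\<beta>\<close> is zero, so \<open>boundaryI\<close> makes
  that multiple a coboundary.\<close>

lemma smul_ext_cls:
  assumes \<beta>: "\<beta> \<in> Hom.cyc d"
  shows "smul (ext_gvec \<epsilon> G F) d (\<epsilon> r) (Hom.cls d \<beta>) = Hom.cls d (\<lambda>x. scl F r (\<beta> x))"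
proof -
  have "induced2 (Hom.bd d) (\<lambda>r f x. scl F r (f x)) (\<epsilon> -` {\<epsilon> r}) (Hom.cls d \<beta>) =
      Hom.cls d (\<lambda>x. scl F r (\<beta> x))"
  proof (rule Hom.induced2_eq_cls)
    show "\<epsilon> -` {\<epsilon> r} \<noteq> {}" "Hom.cls d \<beta> \<noteq> {}" using Hom.cls_self by auto
    fix r' \<beta>' assume r': "r' \<in> \<epsilon> -` {\<epsilon> r}" and "\<beta>' \<in> Hom.cls d \<beta>"
    then obtain h where h: "h \<in> hom_gr G F (d + 1)" "\<beta>' = \<beta> + hom_dif G F (d + 1) h"
      by (auto simp: elt_set_plus_def bnd_def)
    have hom: "module_hom (scl G) (scl F) \<beta>" using \<beta> hom_grD(1) by (auto simp: Hom.cyc_def)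
    have "(\<lambda>x. scl F (r' - r) (\<beta> x)) \<in> Hom.bd d"
      by (rule boundaryI[OF cyc_scale[OF \<beta>]]) (use r' in \<open>simp add: Phi_scale[OF hom] aug_scale \<epsilon>_simps\<close>)
    moreover have "hom_dif G F (d + 1) (\<lambda>x. scl F r' (h x)) \<in> Hom.bd d"
      unfolding bnd_def using Hom.hom_gr_scale[OF h(1)] by blast
    ultimately have "(\<lambda>x. scl F (r' - r) (\<beta> x)) + hom_dif G F (d + 1) (\<lambda>x. scl F r' (h x)) \<in> Hom.bd d"
      by (rule Hom.bd_add)
    moreover have "(\<lambda>x. scl F r' (\<beta>' x)) - (\<lambda>x. scl F r (\<beta> x)) =
        (\<lambda>x. scl F (r' - r) (\<beta> x)) + hom_dif G F (d + 1) (\<lambda>x. scl F r' (h x))"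
      by (rule ext) (simp add: h(2) Hom.hom_dif_scale F.scale_left_diff_distrib F.scale_right_distrib)
    ultimately show "(\<lambda>x. scl F r' (\<beta>' x)) - (\<lambda>x. scl F r (\<beta> x)) \<in> Hom.bd d" by simp
  qed
  then show ?thesis by (simp add: ext_gvec_def hvec_def)
qed

lemma carr_ext_gvec: "carr (ext_gvec \<epsilon> G F) d = homology (hom_gr G F) (hom_dif G F) d"
  and pls_ext_gvec: "pls (ext_gvec \<epsilon> G F) d = induced2 (Hom.bd d) (+)"
  and zer_ext_gvec: "zer (ext_gvec \<epsilon> G F) d = Hom.bd d"
  by (simp_all add: ext_gvec_def hvec_def)

lemma phi_pls:
  assumes "P \<in> carr (ext_gvec \<epsilon> G F) d" "P' \<in> carr (ext_gvec \<epsilon> G F) d"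
  shows "pls (ext_gvec \<epsilon> G F) d P P' \<in> carr (ext_gvec \<epsilon> G F) d \<and>
    phi d (pls (ext_gvec \<epsilon> G F) d P P') = phi d P + phi d P'"
proof -
  obtain \<beta> \<beta>' where \<beta>: "\<beta> \<in> Hom.cyc d" "P = Hom.cls d \<beta>" and \<beta>': "\<beta>' \<in> Hom.cyc d" "P' = Hom.cls d \<beta>'"
    using assms by (auto simp: carr_ext_gvec Hom.homology_eq)
  have pls: "pls (ext_gvec \<epsilon> G F) d P P' = Hom.cls d (\<beta> + \<beta>')"
    by (simp add: pls_ext_gvec \<beta>(2) \<beta>'(2) Hom.induced2_add_cls)
  have "Phi (\<beta> + \<beta>') = Phi \<beta> + Phi \<beta>'"
    using \<beta>(1) \<beta>'(1) by (intro Phi_add hom_grD(1)) (auto simp: Hom.cyc_def)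
  then have "phi d (Hom.cls d (\<beta> + \<beta>')) = phi d P + phi d P'"
    by (intro phi_eqI[OF Hom.cyc_add[OF \<beta>(1) \<beta>'(1)]])
      (simp_all add: \<beta> \<beta>' phi_cls phi_outside aug_add)
  then show ?thesis
    using Hom.cyc_add[OF \<beta>(1) \<beta>'(1)] by (simp add: pls carr_ext_gvec Hom.homology_eq)
qed

lemma phi_smul:
  assumes "P \<in> carr (ext_gvec \<epsilon> G F) d"
  shows "smul (ext_gvec \<epsilon> G F) d c P \<in> carr (ext_gvec \<epsilon> G F) d \<and>
    phi d (smul (ext_gvec \<epsilon> G F) d c P) = (\<lambda>X. c * phi d P X)"
proof -
  obtain \<beta> where \<beta>: "\<beta> \<in> Hom.cyc d" "P = Hom.cls d \<beta>"
    using assms by (auto simp: carr_ext_gvec Hom.homology_eq)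
  have hom: "module_hom (scl G) (scl F) \<beta>" using \<beta>(1) hom_grD(1) by (auto simp: Hom.cyc_def)
  obtain r where r: "\<epsilon> r = c" using residue_map_onto[OF residue] by blast
  have smul: "smul (ext_gvec \<epsilon> G F) d c P = Hom.cls d (\<lambda>x. scl F r (\<beta> x))"
    using smul_ext_cls[OF \<beta>(1), of r] by (simp add: r \<beta>(2))
  have "phi d (Hom.cls d (\<lambda>x. scl F r (\<beta> x))) = (\<lambda>X. c * phi d P X)"
    by (intro phi_eqI[OF cyc_scale[OF \<beta>(1)]])
      (simp_all add: \<beta> phi_cls phi_outside Phi_scale[OF hom] aug_scale r)
  then show ?thesis
    using cyc_scale[OF \<beta>(1)] by (simp add: smul carr_ext_gvec Hom.homology_eq)
qed

lemma phi_zer: "phi d (Hom.bd d) = 0"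
proof -
  have "phi d (Hom.cls d 0) = 0"
    by (rule phi_eqI[OF Hom.cyc_zero]) (simp_all add: Phi_zero)
  then show ?thesis by (simp add: elt_set_plus_def)
qed

section \<open>The graded dual of Tor as the image of \<open>phi\<close>\<close>

abbreviation V :: "('k, 't set \<Rightarrow> 'k) gvec" where
  "V \<equiv> gdual (tor_gvec \<epsilon> GF)"

lemma phi_in_gdual:
  assumes "\<beta> \<in> Hom.cyc d"
  shows "phi d (Hom.cls d \<beta>) \<in> carr V d"
proof -
  have hom: "module_hom (scl G) (scl F) \<beta>" using assms hom_grD(1) by (auto simp: Hom.cyc_def)
  note \<Phi> = module_hom_Phi[OF hom]
  have "phi d (Hom.cls d \<beta>) (smul (tor_gvec \<epsilon> GF) (- d) c (Tor.cls (- d) z)) =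
      c * phi d (Hom.cls d \<beta>) (Tor.cls (- d) z)" if z: "z \<in> Tor.cyc (- d)" for c z
  proof -
    obtain r where r: "\<epsilon> r = c" using residue_map_onto[OF residue] by blast
    have "sT r z \<in> Tor.cyc (- d)"
      using z by (simp add: Tor.cyc_def T.subspace_scale[OF subspace_gr_GF] dif_GF_scale)
    then show ?thesis
      using smul_tor_cls[OF z, of r]
      by (simp add: r phi_cls[OF assms] z module_hom.scale[OF \<Phi>] aug_scale)
  qed
  then show ?thesis
    by (auto simp: gdual_def carr_tor_gvec pls_tor_gvec Tor.homology_eq Tor.induced2_add_cls
        phi_cls[OF assms] Tor.cyc_add module_hom.add[OF \<Phi>] aug_add
        intro!: phi_outside[unfolded Tor.homology_eq])
qed

lemma gdual_subset_phi:
  assumes "l \<in> carr V d"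
  shows "\<exists>\<beta>\<in>Hom.cyc d. phi d (Hom.cls d \<beta>) = l"
proof -
  have out: "\<And>X. X \<notin> homology (gr GF) (\<lambda>_. dif GF) (- d) \<Longrightarrow> l X = 0"
    and pls: "\<And>X Y. X \<in> homology (gr GF) (\<lambda>_. dif GF) (- d) \<Longrightarrow>
      Y \<in> homology (gr GF) (\<lambda>_. dif GF) (- d) \<Longrightarrow> l (pls (tor_gvec \<epsilon> GF) (- d) X Y) = l X + l Y"
    and smul: "\<And>c X. X \<in> homology (gr GF) (\<lambda>_. dif GF) (- d) \<Longrightarrow>
      l (smul (tor_gvec \<epsilon> GF) (- d) c X) = c * l X"
    using assms by (simp_all add: gdual_def carr_tor_gvec)
  let ?l = "\<lambda>z. l (Tor.cls (- d) z)"
  have mem: "Tor.cls (- d) z \<in> homology (gr GF) (\<lambda>_. dif GF) (- d)" if "z \<in> Tor.cyc (- d)" for z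
    using that by (simp add: Tor.homology_eq)
  have add: "?l (x + y) = ?l x + ?l y" if "x \<in> Tor.cyc (- d)" "y \<in> Tor.cyc (- d)" for x y
    using pls[OF mem[OF that(1)] mem[OF that(2)]] by (simp add: pls_tor_gvec Tor.induced2_add_cls)
  have "\<exists>\<beta>\<in>hom_gr G F d. hom_dif G F d \<beta> = 0 \<and>
    (\<forall>z\<in>gr GF (- d). dif GF z = 0 \<longrightarrow> aug (Phi \<beta> z) = ?l z)"
  proof (rule ex_cycle_with_functional)
    show "?l (x + y) = ?l x + ?l y"
      if "x \<in> gr GF (- d)" "dif GF x = 0" "y \<in> gr GF (- d)" "dif GF y = 0" for x y
      by (rule add) (simp_all add: that Tor.cyc_def)
    show "?l (sT r x) = \<epsilon> r * ?l x" if "x \<in> gr GF (- d)" "dif GF x = 0" for r x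
    proof -
      have "x \<in> Tor.cyc (- d)" using that by (simp add: Tor.cyc_def)
      then show ?thesis using smul[OF mem] smul_tor_cls by metis
    qed
    fix w assume "w \<in> gr GF (- d + 1)"
    then have "dif GF w - 0 \<in> Tor.bd (- d)" by (auto simp: bnd_def)
    then have "Tor.cls (- d) (dif GF w) = Tor.cls (- d) 0" unfolding Tor.cls_eq_iff .
    \<comment> \<open>Additivity at the class of 0 forces the value there, and so on every boundary,
      to be 0.\<close>
    moreover have "?l 0 + 0 = ?l 0 + ?l 0"
      using add[OF Tor.cyc_zero Tor.cyc_zero] by (simp only: add_0_right)
    ultimately show "?l (dif GF w) = 0" by (simp only: add_left_cancel)
  qed
  then obtain \<beta> where "\<beta> \<in> Hom.cyc d" "\<And>z. z \<in> Tor.cyc (- d) \<Longrightarrow> aug (Phi \<beta> z) = ?l z"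
    by (auto simp: Hom.cyc_def Tor.cyc_def)
  then show ?thesis using phi_eqI[of \<beta> d l] out by auto
qed

lemma bij_betw_phi: "bij_betw (phi d) (carr (ext_gvec \<epsilon> G F) d) (carr V d)"
  unfolding bij_betw_def carr_ext_gvec
proof (intro conjI inj_on_phi)
  show "phi d ` homology (hom_gr G F) (hom_dif G F) d = carr V d"
    using phi_in_gdual gdual_subset_phi by (fastforce simp: Hom.homology_eq)
qed

lemma ident_inv_phi:
  assumes "P \<in> carr (ext_gvec \<epsilon> G F) d"
  shows "ident_inv \<epsilon> F GF tens d (phi d P) = Phi ` P"
proof -
  have "inj_on (ident \<epsilon> F GF tens d) (homology (homFF F GF tens) (hom_dif GF F) d)"
    using inj_on_phi[of d] unfolding homology_homFF inj_on_def phi_def by blast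
  then show ?thesis
    unfolding ident_inv_def phi_def
    by (rule inv_into_f_f) (use assms in \<open>auto simp: homology_homFF carr_ext_gvec\<close>)
qed

text \<open>Separate maps \<open>h\<close> and \<open>h'\<close> serve left and right actions alike:
  one of them is \<open>Phi\<close>, the other is \<open>id\<close> on the acting class.\<close>

lemma Phi_induced2:
  assumes "\<And>x y. x \<in> X \<Longrightarrow> y \<in> Y \<Longrightarrow> f x y \<in> hom_gr G F d \<and> f' (h x) (h' y) = Phi (f x y)"
  shows "induced2 (bnd (homFF F GF tens) (hom_dif GF F) d) f' (h ` X) (h' ` Y) =
    Phi ` induced2 (Hom.bd d) f X Y"
proof -
  have "f' (h x) (h' y) +o bnd (homFF F GF tens) (hom_dif GF F) d = Phi ` Hom.cls d (f x y)"
    if "x \<in> X" "y \<in> Y" for x y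
    using assms[OF that] by (simp add: Phi_cls)
  then show ?thesis by (simp add: induced2_def image_UN cong: SUP_cong_simp)
qed


section \<open>Compatibility with the actions\<close>

text \<open>This is the graded commutator of the differential with \<open>\<tau>\<close>, and
  commutators of derivations are derivations. The parities of \<open>q\<close> and \<open>i\<close>
  decide all signs.\<close>

lemma hom_dif_leibniz:
  assumes \<tau>: "\<tau> \<in> leibniz q"
  shows "hom_dif F F q \<tau> \<in> leibniz (q - 1)"
proof -
  have hom: "\<tau> \<in> hom_gr F F q" and mult: "\<And>i a b. a \<in> gr F i \<Longrightarrow>
      \<tau> (a * b) = \<tau> a * b + ksgn (q * i) (a * \<tau> b)"
    using \<tau> by (auto simp: leibniz_def)
  have "hom_dif F F q \<tau> (a * b) = hom_dif F F q \<tau> a * b + ksgn ((q - 1) * i) (a * hom_dif F F q \<tau> b)"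
    if a: "a \<in> gr F i" for i a b
    by (cases "even q"; cases "even i")
      (simp_all add: hom_dif_def ksgn_def mult[OF a] mult[OF F.dif_in_gr[OF a]] dif_mult[OF a]
        dif_mult[OF hom_grD(2)[OF hom a]] module_hom.add[OF hom_grD(1)[OF hom]]
        module_hom.diff[OF hom_grD(1)[OF hom]] F.dif_add F.dif_diff algebra_simps)
  then show ?thesis using FF.hom_dif_in_hom_gr[OF hom] by (simp add: leibniz_def)
qed

lemma leibniz_add:
  assumes "\<theta> \<in> leibniz p" "\<theta>' \<in> leibniz p"
  shows "\<theta> + \<theta>' \<in> leibniz p"
  using assms FF.add_closed by (auto simp: leibniz_def algebra_simps ksgn_add)

text \<open>Classes are taken modulo differentials of \<Gamma>-derivations; regarding these as
  differentials of maps in \<open>leibniz\<close> keeps what is needed to act on homology.\<close>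

lemma homotopy_lieE:
  assumes "\<xi> \<in> homotopy_lie F p"
  obtains \<theta>\<^sub>0 where "\<theta>\<^sub>0 \<in> leibniz p" "hom_dif F F p \<theta>\<^sub>0 = 0" "\<theta>\<^sub>0 \<in> \<xi>"
    "\<And>\<theta>. \<theta> \<in> \<xi> \<Longrightarrow> \<exists>\<tau>\<in>leibniz (p + 1). \<theta> = \<theta>\<^sub>0 + hom_dif F F (p + 1) \<tau>"
proof -
  have sub: "der F q \<subseteq> leibniz q" for q by (auto simp: der_def leibniz_def)
  obtain \<theta>\<^sub>0 where \<theta>\<^sub>0: "\<theta>\<^sub>0 \<in> der F p" "hom_dif F F p \<theta>\<^sub>0 = 0" "\<xi> = \<theta>\<^sub>0 +o bnd (der F) (hom_dif F F) p"
    using assms by (auto simp: homotopy_lie_def homology_def)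
  have "0 \<in> der F (p + 1)"
    using FF.hom_gr_zero by (simp add: der_def)
  moreover have "hom_dif F F (p + 1) 0 = 0" by (rule FF.\<delta>_zero)
  ultimately have "0 \<in> bnd (der F) (hom_dif F F) p" unfolding bnd_def by (metis image_eqI)
  then have "\<theta>\<^sub>0 \<in> \<xi>" by (simp add: \<theta>\<^sub>0(3) mem_coset_iff)
  moreover have "\<exists>\<tau>\<in>leibniz (p + 1). \<theta> = \<theta>\<^sub>0 + hom_dif F F (p + 1) \<tau>" if "\<theta> \<in> \<xi>" for \<theta>
    using that sub[of "p + 1"] by (auto simp: \<theta>\<^sub>0(3) elt_set_plus_def bnd_def)
  ultimately show thesis using that[of \<theta>\<^sub>0] \<theta>\<^sub>0(1,2) sub[of p] by blast
qed

lemma homotopy_lie_subset_leibniz: "\<xi> \<in> homotopy_lie F p \<Longrightarrow> \<xi> \<subseteq> leibniz p"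
proof
  fix \<theta> assume "\<xi> \<in> homotopy_lie F p" "\<theta> \<in> \<xi>"
  then obtain \<theta>\<^sub>0 \<tau> where "\<theta>\<^sub>0 \<in> leibniz p" "\<tau> \<in> leibniz (p + 1)" "\<theta> = \<theta>\<^sub>0 + hom_dif F F (p + 1) \<tau>"
    by (elim homotopy_lieE) blast
  then show "\<theta> \<in> leibniz p" using leibniz_add hom_dif_leibniz[of \<tau> "p + 1"] by simp
qed

lemma comp_in_hom_gr:
  assumes "\<theta> \<in> hom_gr F F p" "\<beta> \<in> hom_gr G F d"
  shows "\<theta> \<circ> \<beta> \<in> hom_gr G F (p + d)"
proof -
  have "module_hom (scl G) (scl F) (\<theta> \<circ> \<beta>)"
    using hom_grD(1)[OF assms(1)] hom_grD(1)[OF assms(2)] by (auto simp: module_hom_iff)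
  moreover have "\<theta> (\<beta> x) \<in> gr F (n + (p + d))" if "x \<in> gr G n" for n x
    using hom_grD(2)[OF assms(1) hom_grD(2)[OF assms(2) that]] by (simp add: ac_simps)
  ultimately show ?thesis by (auto simp: hom_gr_def)
qed

lemma hom_dif_comp:
  assumes \<theta>: "\<theta> \<in> hom_gr F F p"
  shows "hom_dif G F (p + d) (\<theta> \<circ> \<beta>) = (hom_dif F F p \<theta> \<circ> \<beta>) + ksgn p (\<theta> \<circ> hom_dif G F d \<beta>)"
  by (rule ext)
    (simp add: hom_dif_def ksgn_def module_hom.diff[OF hom_grD(1)[OF \<theta>]]
      module_hom.add[OF hom_grD(1)[OF \<theta>]] module_hom.neg[OF hom_grD(1)[OF \<theta>]])

text \<open>Composition respects classes: the differential of \<open>\<tau>\<close> followed by a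
  cocycle is exact, and a cocycle applied to a coboundary is exact up to sign. Both follow from
  \<open>hom_dif_comp\<close>.\<close>

lemma ext_lie_act_closed:
  assumes \<xi>: "\<xi> \<in> homotopy_lie F p" and P: "P \<in> carr (ext_gvec \<epsilon> G F) d"
  shows "ext_lie_act G F p d \<xi> P \<in> carr (ext_gvec \<epsilon> G F) (p + d)"
proof -
  obtain \<beta> where \<beta>: "\<beta> \<in> Hom.cyc d" "P = Hom.cls d \<beta>"
    using P by (auto simp: carr_ext_gvec Hom.homology_eq)
  then have \<beta>_hom: "\<beta> \<in> hom_gr G F d" "hom_dif G F d \<beta> = 0" by (simp_all add: Hom.cyc_def)
  obtain \<theta>\<^sub>0 where \<theta>\<^sub>0: "\<theta>\<^sub>0 \<in> leibniz p" "hom_dif F F p \<theta>\<^sub>0 = 0" "\<theta>\<^sub>0 \<in> \<xi>"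
    and \<xi>_elem: "\<And>\<theta>. \<theta> \<in> \<xi> \<Longrightarrow> \<exists>\<tau>\<in>leibniz (p + 1). \<theta> = \<theta>\<^sub>0 + hom_dif F F (p + 1) \<tau>"
    by (rule homotopy_lieE[OF \<xi>]) (rule that)
  have \<theta>\<^sub>0_hom: "\<theta>\<^sub>0 \<in> hom_gr F F p" using \<theta>\<^sub>0(1) by (simp add: leibniz_def)
  note \<theta>\<^sub>0_zero = module_hom.zero[OF hom_grD(1)[OF \<theta>\<^sub>0_hom]]
  have "\<theta>\<^sub>0 \<circ> (0 :: 'g \<Rightarrow> 'f) = 0" by (rule ext) (simp add: \<theta>\<^sub>0_zero)
  then have cyc: "\<theta>\<^sub>0 \<circ> \<beta> \<in> Hom.cyc (p + d)"
    using comp_in_hom_gr[OF \<theta>\<^sub>0_hom \<beta>_hom(1)]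
    by (simp add: Hom.cyc_def hom_dif_comp[OF \<theta>\<^sub>0_hom] \<theta>\<^sub>0(2) \<beta>_hom(2)) (simp add: zero_fun_def comp_def)
  have "ext_lie_act G F p d \<xi> P = Hom.cls (p + d) (\<theta>\<^sub>0 \<circ> \<beta>)"
    unfolding ext_lie_act_def
  proof (rule Hom.induced2_eq_cls)
    show "\<xi> \<noteq> {}" "P \<noteq> {}" using \<theta>\<^sub>0(3) Hom.cls_self by (auto simp: \<beta>(2))
    fix \<theta> \<beta>' assume "\<theta> \<in> \<xi>" "\<beta>' \<in> P"
    obtain \<tau> where \<tau>: "\<tau> \<in> leibniz (p + 1)" "\<theta> = \<theta>\<^sub>0 + hom_dif F F (p + 1) \<tau>"
      using \<xi>_elem[OF \<open>\<theta> \<in> \<xi>\<close>] by blast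
    obtain h where h: "h \<in> hom_gr G F (d + 1)" "\<beta>' = \<beta> + hom_dif G F (d + 1) h"
      using \<open>\<beta>' \<in> P\<close> by (auto simp: \<beta>(2) elt_set_plus_def bnd_def)
    have "\<beta>' \<in> Hom.cyc d"
      using \<open>\<beta>' \<in> P\<close> P Hom.homology_subset_cyc by (auto simp: carr_ext_gvec)
    then have \<beta>': "\<beta>' \<in> hom_gr G F d" "hom_dif G F d \<beta>' = 0" by (simp_all add: Hom.cyc_def)
    have \<tau>_hom: "\<tau> \<in> hom_gr F F (p + 1)" using \<tau>(1) by (simp add: leibniz_def)
    have "\<tau> \<circ> (0 :: 'g \<Rightarrow> 'f) = 0"
      by (rule ext) (simp add: module_hom.zero[OF hom_grD(1)[OF \<tau>_hom]])
    then have 1: "hom_dif F F (p + 1) \<tau> \<circ> \<beta>' = hom_dif G F (p + d + 1) (\<tau> \<circ> \<beta>')"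
      using hom_dif_comp[OF \<tau>_hom, of d \<beta>'] by (simp add: \<beta>'(2) ac_simps)
    have "hom_dif F F p \<theta>\<^sub>0 \<circ> h = 0" by (rule ext) (simp add: \<theta>\<^sub>0(2))
    then have 2: "\<theta>\<^sub>0 \<circ> hom_dif G F (d + 1) h = ksgn p (hom_dif G F (p + d + 1) (\<theta>\<^sub>0 \<circ> h))"
      using hom_dif_comp[OF \<theta>\<^sub>0_hom, of "d + 1" h] by (simp add: ac_simps)
    \<comment> \<open>The change is split as
      \<open>(\<theta> - \<theta>\<^sub>0) \<circ> \<beta>'\<close> plus
      \<open>\<theta>\<^sub>0 \<circ> (\<beta>' - \<beta>)\<close>, so that only one argument varies
      in each summand.\<close>
    have "(\<theta> \<circ> \<beta>') - (\<theta>\<^sub>0 \<circ> \<beta>) =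
        (hom_dif F F (p + 1) \<tau> \<circ> \<beta>') + (\<theta>\<^sub>0 \<circ> hom_dif G F (d + 1) h)"
      by (rule ext) (simp add: \<tau>(2) h(2) module_hom.add[OF hom_grD(1)[OF \<theta>\<^sub>0_hom]])
    also have "\<dots> = hom_dif G F (p + d + 1) (\<tau> \<circ> \<beta>') +
        hom_dif G F (p + d + 1) (ksgn p (\<theta>\<^sub>0 \<circ> h))"
      by (simp only: 1 2 Hom.hom_dif_ksgn)
    also have "\<dots> \<in> Hom.bd (p + d)"
    proof (rule Hom.bd_add)
      have "\<tau> \<circ> \<beta>' \<in> hom_gr G F (p + d + 1)" "\<theta>\<^sub>0 \<circ> h \<in> hom_gr G F (p + d + 1)"
        using comp_in_hom_gr[OF \<tau>_hom \<beta>'(1)] comp_in_hom_gr[OF \<theta>\<^sub>0_hom h(1)] by (simp_all add: ac_simps)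
      then show "hom_dif G F (p + d + 1) (\<tau> \<circ> \<beta>') \<in> Hom.bd (p + d)"
        "hom_dif G F (p + d + 1) (ksgn p (\<theta>\<^sub>0 \<circ> h)) \<in> Hom.bd (p + d)"
        unfolding bnd_def using Hom.hom_gr_ksgn by blast+
    qed
    finally show "(\<theta> \<circ> \<beta>') - (\<theta>\<^sub>0 \<circ> \<beta>) \<in> Hom.bd (p + d)" .
  qed
  then show ?thesis using cyc by (simp add: carr_ext_gvec Hom.homology_eq)
qed

lemma elements_in_hom_gr: "P \<in> carr (ext_gvec \<epsilon> G F) d \<Longrightarrow> \<beta> \<in> P \<Longrightarrow> \<beta> \<in> hom_gr G F d"
  using Hom.homology_subset_cyc by (auto simp: carr_ext_gvec Hom.cyc_def)

lemma phi_ext_lie_act: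
  assumes \<xi>: "\<xi> \<in> homotopy_lie F p" and P: "P \<in> carr (ext_gvec \<epsilon> G F) d"
  shows "phi (p + d) (ext_lie_act G F p d \<xi> P) = tor_lie_act \<epsilon> G F GF tens p d \<xi> (phi d P)"
proof -
  have "induced2 (bnd (homFF F GF tens) (hom_dif GF F) (p + d)) (der_act G tens p d) (id ` \<xi>) (Phi ` P) =
      Phi ` ext_lie_act G F p d \<xi> P"
    unfolding ext_lie_act_def
  proof (rule Phi_induced2)
    fix \<theta> \<beta> assume "\<theta> \<in> \<xi>" "\<beta> \<in> P"
    then have "\<theta> \<in> leibniz p" "\<beta> \<in> hom_gr G F d"
      using homotopy_lie_subset_leibniz[OF \<xi>] elements_in_hom_gr[OF P] by auto
    then show "\<theta> \<circ> \<beta> \<in> hom_gr G F (p + d) \<and> der_act G tens p d (id \<theta>) (Phi \<beta>) = Phi (\<theta> \<circ> \<beta>)"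
      using comp_in_hom_gr der_act_Phi by (auto simp: leibniz_def)
  qed
  then show ?thesis by (simp add: tor_lie_act_def ident_inv_phi[OF P] phi_def[of "p + d"])
qed

lemma phi_ract:
  assumes a: "a \<in> ext_self G q" and P: "P \<in> carr (ext_gvec \<epsilon> G F) d"
  shows "phi (d + q) (induced2 (Hom.bd (d + q)) (\<lambda>\<beta> \<alpha>. \<beta> \<circ> \<alpha>) P a) =
    tor_end_act \<epsilon> F GF tens d q (phi d P) a"
proof -
  have "induced2 (bnd (homFF F GF tens) (hom_dif GF F) (d + q)) (end_act tens) (Phi ` P) (id ` a) =
      Phi ` induced2 (Hom.bd (d + q)) (\<lambda>\<beta> \<alpha>. \<beta> \<circ> \<alpha>) P a"
  proof (rule Phi_induced2)
    fix \<beta> \<alpha> assume "\<beta> \<in> P" "\<alpha> \<in> a"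
    then have \<beta>: "\<beta> \<in> hom_gr G F d" and \<alpha>: "\<alpha> \<in> hom_gr G G q"
      using elements_in_hom_gr[OF P] a GG.homology_subset_cyc by (auto simp: ext_self_def GG.cyc_def)
    have "\<beta> (\<alpha> x) \<in> gr F (n + (d + q))" if "x \<in> gr G n" for n x
      using hom_grD(2)[OF \<beta> hom_grD(2)[OF \<alpha> that]] by (simp add: ac_simps)
    then have "\<beta> \<circ> \<alpha> \<in> hom_gr G F (d + q)"
      using hom_grD(1)[OF \<alpha>] hom_grD(1)[OF \<beta>] by (auto simp: hom_gr_def module_hom_iff)
    then show "\<beta> \<circ> \<alpha> \<in> hom_gr G F (d + q) \<and> end_act tens (Phi \<beta>) (id \<alpha>) = Phi (\<beta> \<circ> \<alpha>)"
      using end_act_Phi[OF \<beta> \<alpha>] by simp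
  qed
  then show ?thesis by (simp add: tor_end_act_def ident_inv_phi[OF P] phi_def[of "d + q"])
qed

lemma phi_lact:
  assumes "P \<in> carr (ext_gvec \<epsilon> G F) d"
  shows "phi (p + d) (extend_act \<epsilon> F (ext_gvec \<epsilon> G F) (ext_lie_act G F) p d e P) =
    extend_act \<epsilon> F V (tor_lie_act \<epsilon> G F GF tens) p d e (phi d P)"
proof (rule extend_act_transport[where \<phi> = phi])
  show "zer (ext_gvec \<epsilon> G F) d \<in> carr (ext_gvec \<epsilon> G F) d" for d
  proof -
    have "Hom.bd d = Hom.cls d 0" by (simp add: elt_set_plus_def)
    then show ?thesis
      unfolding zer_ext_gvec carr_ext_gvec Hom.homology_eq using Hom.cyc_zero by (rule image_eqI)
  qed
  show "phi d (zer (ext_gvec \<epsilon> G F) d) = zer V d" for d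
    by (simp add: zer_ext_gvec phi_zer gdual_def)
qed (use phi_pls phi_smul ext_lie_act_closed phi_ext_lie_act assms in \<open>auto simp: gdual_def\<close>)

text \<open>The family \<open>E\<close> is arbitrary because \<open>phi_lact\<close> holds for every
  \<open>e\<close>: the two sides of the left action always take the same branch of
  \<open>extend_act\<close>.\<close>

theorem ext_bimod_isomorphic_tor_dual_bimod:
  "gbimod_isomorphic E (ext_self G) (ext_bimod \<epsilon> G F) (tor_dual_bimod \<epsilon> G F sT tens)"
  unfolding gbimod_isomorphic_def
proof (intro exI[of _ phi] allI conjI ballI)
  fix d
  show "bij_betw (phi d) (carr (ext_bimod \<epsilon> G F) d) (carr (tor_dual_bimod \<epsilon> G F sT tens) d)"
    using bij_betw_phi by (simp add: ext_bimod_def tor_dual_bimod_def gvec.extend_def Let_def)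
next
  fix d x y assume "x \<in> carr (ext_bimod \<epsilon> G F) d" "y \<in> carr (ext_bimod \<epsilon> G F) d"
  then show "phi d (pls (ext_bimod \<epsilon> G F) d x y) =
      pls (tor_dual_bimod \<epsilon> G F sT tens) d (phi d x) (phi d y)"
    using phi_pls
    by (simp add: ext_bimod_def tor_dual_bimod_def gvec.extend_def Let_def gdual_def)
next
  fix d c x assume "x \<in> carr (ext_bimod \<epsilon> G F) d"
  then show "phi d (smul (ext_bimod \<epsilon> G F) d c x) =
      smul (tor_dual_bimod \<epsilon> G F sT tens) d c (phi d x)"
    using phi_smul
    by (simp add: ext_bimod_def tor_dual_bimod_def gvec.extend_def Let_def gdual_def)
next
  fix d p e x assume "x \<in> carr (ext_bimod \<epsilon> G F) d"
  then show "phi (p + d) (lact (ext_bimod \<epsilon> G F) p d e x) =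
      lact (tor_dual_bimod \<epsilon> G F sT tens) p d e (phi d x)"
    using phi_lact by (simp add: ext_bimod_def tor_dual_bimod_def gvec.extend_def Let_def)
next
  fix d q a x assume "a \<in> ext_self G q" "x \<in> carr (ext_bimod \<epsilon> G F) d"
  then show "phi (d + q) (ract (ext_bimod \<epsilon> G F) d q x a) =
      ract (tor_dual_bimod \<epsilon> G F sT tens) d q (phi d x) a"
    using phi_ract by (simp add: ext_bimod_def tor_dual_bimod_def gvec.extend_def Let_def)
qed

end

theorem corollary4p2:
  fixes \<epsilon> :: "'r::comm_ring_1 \<Rightarrow> 'k::field"
    and sM :: "'r \<Rightarrow> 'm::ab_group_add \<Rightarrow> 'm"
    and F :: "('r, 'f::ring_1) gamma_alg"
    and G :: "('r, 'g::ab_group_add) dgmod"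
    and \<eta> :: "'g \<Rightarrow> 'm"
    and sT :: "'r \<Rightarrow> 't::ab_group_add \<Rightarrow> 't"
    and tens :: "'g \<Rightarrow> 'f \<Rightarrow> 't"
  assumes "is_local_ring TYPE('r)" and "is_noetherian_ring TYPE('r)"
    and "residue_map \<epsilon>"
    and "module sM"
    and "acyclic_closure \<epsilon> F"
    and "free_resolution sM G \<eta>"
    and "is_tensor_product (scl G) (scl F) sT tens"
  shows "gbimod_isomorphic (ext_self F) (ext_self G)
           (ext_bimod \<epsilon> G F) (tor_dual_bimod \<epsilon> G F sT tens)"
proof -
  have "chain_complex G" using assms(6) by (simp add: free_resolution_def)
  then interpret G: dg_mod G by (rule dg_modI)
  interpret tensor_setting \<epsilon> F G sT tens
    using assms(3,5,6,7) by unfold_locales (auto simp: free_resolution_def)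
  show ?thesis by (rule ext_bimod_isomorphic_tor_dual_bimod)
qed

end
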